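(* Let $(\Omega,\mathcal F,\mathbb P,\theta,T,X)$ be the linear random dynamical system generated by $A$ as in the context. If there exists a measurably contracting $k$-cone family $\mathcal C=\{C(\omega)\}_{\omega\in\Omega}$, then there exists a measurably dominated splitting $X=E(\cdot)\oplus F(\cdot)$ with $\dim E(\cdot)=k(\cdot)$ and $F(\cdot)\cap C(\cdot)=\{0\}$.
   Context: Setting. $(X,|\cdot|)$ is a separable Banach space, $L(X)$ the bounded linear operators on $X$. $(\Omega,\mathcal F,\mathbb P)$ is a complete probability space and $\theta:\Omega\to\Omega$ is a bijection such that $\theta,\theta^{-1}$ are measurable and $\mathbb P$-preserving. $A:\Omega\to L(X)$ is strongly measurable ($\omega\mapsto A(\omega)x$ is measurable for each $x\in X$) and $A(\omega)$ is injective for a.e. $\omega$. $T^n(\omega)=A(\theta^{n-1}\omega)\cdots A(\omega)$ for $n\in\mathbb N$, $T^0=\mathrm{id}$. Separation index. With $S=\{v\in X:|v|=1\}$, for a subspace or cone $L\subset X$ and a nonempty $C\subset X$, $\underline{\mathrm{dist}}(L,C)=\inf_{v\in L\cap S}\inf_{u\in C}|v-u|$. $k$-cone. A closed $C\subset X$ is a $k$-cone if: $lv\in C$ for all $v\in C$, $l\in\mathbb R$; $C$ contains a $k$-dimensional subspace; there is a $k$-codimensional subspace $L$ with $L\cap C=\{0\}$. It is solid if $\mathrm{int}\,C\ne\emptyset$. Measurably contracting. A family $\mathcal C=\{C(\omega)\}_{\omega\in\Omega}$ of solid cones is a measurably contracting $k$-cone family if: C1) $k:\Omega\to\mathbb N$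 is measurable and $\theta$-invariant and, for $\mathbb P$-a.e. $\omega$, $C(\omega)$ is a closed solid $k(\omega)$-cone and $A(\omega)C(\omega)\subset C(\theta\omega)$. C2) There is a measurable splitting $X=E_0(\omega)\oplus F_0(\omega)$ (the associated projections are strongly measurable) with $\dim E_0(\omega)=\mathrm{codim}\,F_0(\omega)=k(\omega)$, $E_0(\omega)\subset\mathrm{int}\,C(\omega)\cup\{0\}$ and $F_0(\omega)\cap C(\omega)=\{0\}$ for a.e. $\omega$. C3) There is a measurable $\chi:\Omega\to[1,\infty)$ such that for a.e. $\omega$, $\lim_{n\to\pm\infty}\frac1n\log\chi(\theta^n\omega)=0$ and $\underline{\mathrm{dist}}(A(\omega)C(\omega),X\setminus C(\theta\omega))\ge\frac1{\chi(\omega)}$. Measurably dominated splitting. The system admits a measurably dominated splitting if there are a $\theta$-invariant set $\tilde\Omega$ of full measure and a measurable $\theta$-invariant $k:\Omega\to\mathbb N$ such that: D1) for all $\omega\in\tilde\Omega$ there is a splitting $X=E(\omega)\oplus F(\omega)$ with $\dim E(\omega)=\mathrm{codim}\,F(\omega)=k(\omega)$, $A(\omega)E(\omega)=E(\theta\omega)$, $A(\omega)F(\omega)\subset F(\theta\omega)$; D2) the associated projections $\pi_E,\pi_F$ are strongly measurable and $\lim_{n\to\pm\infty}\frac1n\log\underline{\mathrm{dist}}(E(\theta^n\omega),F(\theta^n\omega))=0$, i.e. $\lim_{n\to\pm\infty}\frac1n\log\max\{\|\pi_E(\theta^n\omega)\|,\|\pi_F(\theta^n\omega)\|\}=0$;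 D3) there are a $\theta$-invariant measurable $\delta:\Omega\to(0,\infty)$ and a measurable $K:\Omega\to[1,\infty)$ with $\lim_{n\to\pm\infty}\frac1n\log K(\theta^n\omega)=0$ such that for all $\omega\in\tilde\Omega$ and $n\ge0$, $\big\|(T^n(\omega)|_{E(\omega)})^{-1}\big\|\,\big\|T^n(\omega)|_{F(\omega)}\big\|\le K(\omega)e^{-n\delta(\omega)}$. *)

theory Defs
  imports "HOL-Probability.Probability"
begin

section \<open>Linear random dynamical systems\<close>

definition strongly_measurable :: "'w measure \<Rightarrow> ('w \<Rightarrow> 'a::real_normed_vector \<Rightarrow> 'a) \<Rightarrow> bool" where
  "strongly_measurable M B \<longleftrightarrow> (\<forall>x. (\<lambda>\<omega>. B \<omega> x) \<in> borel_measurable M)"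

locale linear_rds = prob_space M + complete_measure M
  for M :: "'w measure" +
  fixes \<theta> :: "'w \<Rightarrow> 'w"
    and A :: "'w \<Rightarrow> 'a::{banach, second_countable_topology} \<Rightarrow>\<^sub>L 'a"
  assumes bij: "bij_betw \<theta> (space M) (space M)"
    and measurable: "\<theta> \<in> measurable M M"
    and measurable_inv: "inv_into (space M) \<theta> \<in> measurable M M"
    and preserving: "distr M M \<theta> = M"
    and preserving_inv: "distr M M (inv_into (space M) \<theta>) = M"
    and strongly_measurable: "strongly_measurable M (\<lambda>\<omega>. blinfun_apply (A \<omega>))"
    and injective: "AE \<omega> in M. inj (blinfun_apply (A \<omega>))"

fun cocycle :: "('w \<Rightarrow> 'w) \<Rightarrow> ('w \<Rightarrow> 'a::real_normed_vector \<Rightarrow>\<^sub>L 'a) \<Rightarrow> nat \<Rightarrow> 'w \<Rightarrow> 'a \<Rightarrow>\<^sub>L 'a" where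
  "cocycle \<theta> A 0 \<omega> = id_blinfun"
| "cocycle \<theta> A (Suc n) \<omega> = A ((\<theta> ^^ n) \<omega>) o\<^sub>L cocycle \<theta> A n \<omega>"

definition int_iterate :: "'w measure \<Rightarrow> ('w \<Rightarrow> 'w) \<Rightarrow> int \<Rightarrow> 'w \<Rightarrow> 'w" where
  "int_iterate M \<theta> n =
     (if 0 \<le> n then \<theta> ^^ nat n else inv_into (space M) \<theta> ^^ nat (- n))"

definition invariant_function :: "'w measure \<Rightarrow> ('w \<Rightarrow> 'w) \<Rightarrow> ('w \<Rightarrow> 'b) \<Rightarrow> bool" where
  "invariant_function M \<theta> f \<longleftrightarrow> (\<forall>\<omega>\<in>space M. f (\<theta> \<omega>) = f \<omega>)"

definition tempered_at :: "'w measure \<Rightarrow> ('w \<Rightarrow> 'w) \<Rightarrow> ('w \<Rightarrow> real) \<Rightarrow> 'w \<Rightarrow> bool" where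
  "tempered_at M \<theta> f \<omega> \<longleftrightarrow>
     ((\<lambda>n. ln (f (int_iterate M \<theta> n \<omega>)) / of_int n) \<longlongrightarrow> 0) at_top \<and>
     ((\<lambda>n. ln (f (int_iterate M \<theta> n \<omega>)) / of_int n) \<longlongrightarrow> 0) at_bot"


section \<open>Subspaces, splittings and cones\<close>

text \<open>The library's \<^term>\<open>dim\<close> is \<open>0\<close> on infinite-dimensional subspaces, so it cannot be used to
  say that a subspace of a Banach space has dimension \<open>n\<close>.\<close>

definition has_dim :: "'a::real_vector set \<Rightarrow> nat \<Rightarrow> bool" where
  "has_dim E n \<longleftrightarrow> (\<exists>B. finite B \<and> card B = n \<and> independent B \<and> span B = E)"

text \<open>\<open>dim (X / F) = n\<close>, expressed through an algebraic complement of \<open>F\<close>. \<open>F\<close> need not be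
  closed here.\<close>

definition has_codim :: "'a::real_vector set \<Rightarrow> nat \<Rightarrow> bool" where
  "has_codim F n \<longleftrightarrow> subspace F \<and>
     (\<exists>G. has_dim G n \<and> G \<inter> F = {0} \<and> (\<forall>x. \<exists>g\<in>G. \<exists>f\<in>F. x = g + f))"

definition splitting :: "'a::real_normed_vector set \<Rightarrow> 'a set \<Rightarrow> bool" where
  "splitting E F \<longleftrightarrow> subspace E \<and> subspace F \<and> closed E \<and> closed F \<and>
     E \<inter> F = {0} \<and> (\<forall>x. \<exists>e\<in>E. \<exists>f\<in>F. x = e + f)"

text \<open>The projection onto \<open>E\<close> along \<open>F\<close>; it is meaningful only if \<open>splitting E F\<close>.\<close>

definition proj_along :: "'a::real_vector set \<Rightarrow> 'a set \<Rightarrow> 'a \<Rightarrow> 'a" where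
  "proj_along E F x = (THE e. e \<in> E \<and> x - e \<in> F)"

text \<open>Values are extended reals so that the infimum over an empty set is \<open>\<infinity>\<close>; this matters
  because a \<open>k\<close>-cone is the whole space when \<open>k\<close> is the dimension of the space.\<close>

definition separation_index :: "'a::real_normed_vector set \<Rightarrow> 'a set \<Rightarrow> ereal" where
  "separation_index L C = (INF v\<in>L \<inter> sphere 0 1. INF u\<in>C. ereal (norm (v - u)))"

text \<open>Operator norm of the restriction of \<open>f\<close> to the subspace \<open>S\<close>; the point \<open>0\<close> contributes
  \<open>0 / 0 = 0\<close>.\<close>

definition onorm_on :: "'a::real_normed_vector set \<Rightarrow> ('a \<Rightarrow> 'b::real_normed_vector) \<Rightarrow> real" where
  "onorm_on S f = (SUP x\<in>S. norm (f x) / norm x)"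

definition k_cone :: "nat \<Rightarrow> 'a::real_normed_vector set \<Rightarrow> bool" where
  "k_cone k C \<longleftrightarrow> closed C \<and>
     (\<forall>v\<in>C. \<forall>l::real. l *\<^sub>R v \<in> C) \<and>
     (\<exists>V. has_dim V k \<and> V \<subseteq> C) \<and>
     (\<exists>L. has_codim L k \<and> L \<inter> C = {0})"


section \<open>Measurably contracting cone families\<close>

definition measurably_contracting ::
  "'w measure \<Rightarrow> ('w \<Rightarrow> 'w) \<Rightarrow> ('w \<Rightarrow> 'a::real_normed_vector \<Rightarrow>\<^sub>L 'a) \<Rightarrow> ('w \<Rightarrow> nat) \<Rightarrow> ('w \<Rightarrow> 'a set) \<Rightarrow> bool"
where
  "measurably_contracting M \<theta> A k C \<longleftrightarrow>
     k \<in> measurable M (count_space UNIV) \<and>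
     invariant_function M \<theta> k \<and>
     (AE \<omega> in M. k_cone (k \<omega>) (C \<omega>) \<and> interior (C \<omega>) \<noteq> {} \<and>
        blinfun_apply (A \<omega>) ` C \<omega> \<subseteq> C (\<theta> \<omega>)) \<and>
     (\<exists>E\<^sub>0 F\<^sub>0.
        (AE \<omega> in M. splitting (E\<^sub>0 \<omega>) (F\<^sub>0 \<omega>) \<and>
           has_dim (E\<^sub>0 \<omega>) (k \<omega>) \<and> has_codim (F\<^sub>0 \<omega>) (k \<omega>) \<and>
           E\<^sub>0 \<omega> \<subseteq> interior (C \<omega>) \<union> {0} \<and> F\<^sub>0 \<omega> \<inter> C \<omega> = {0}) \<and>
        strongly_measurable M (\<lambda>\<omega>. proj_along (E\<^sub>0 \<omega>) (F\<^sub>0 \<omega>)) \<and>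
        strongly_measurable M (\<lambda>\<omega>. proj_along (F\<^sub>0 \<omega>) (E\<^sub>0 \<omega>))) \<and>
     (\<exists>c\<in>borel_measurable M. (\<forall>\<omega>\<in>space M. 1 \<le> c \<omega>) \<and>
        (AE \<omega> in M. tempered_at M \<theta> c \<omega> \<and>
           ereal (1 / c \<omega>) \<le> separation_index (blinfun_apply (A \<omega>) ` C \<omega>) (- C (\<theta> \<omega>))))"


section \<open>Measurably dominated splittings\<close>

text \<open>The two temperedness conditions on the splitting are equivalent. The separation index in the
  first one is finite unless \<open>E\<close> is trivial.\<close>

definition measurably_dominated_splitting ::
  "'w measure \<Rightarrow> ('w \<Rightarrow> 'w) \<Rightarrow> ('w \<Rightarrow> 'a::real_normed_vector \<Rightarrow>\<^sub>L 'a) \<Rightarrow> 'w set \<Rightarrow> ('w \<Rightarrow> nat) \<Rightarrow>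
   ('w \<Rightarrow> 'a set) \<Rightarrow> ('w \<Rightarrow> 'a set) \<Rightarrow> bool"
where
  "measurably_dominated_splitting M \<theta> A \<Omega>' k E F \<longleftrightarrow>
     \<Omega>' \<in> sets M \<and> \<theta> ` \<Omega>' = \<Omega>' \<and> measure M \<Omega>' = 1 \<and>
     k \<in> measurable M (count_space UNIV) \<and>
     invariant_function M \<theta> k \<and>
     (\<forall>\<omega>\<in>\<Omega>'. splitting (E \<omega>) (F \<omega>) \<and>
        has_dim (E \<omega>) (k \<omega>) \<and> has_codim (F \<omega>) (k \<omega>) \<and>
        blinfun_apply (A \<omega>) ` E \<omega> = E (\<theta> \<omega>) \<and>
        blinfun_apply (A \<omega>) ` F \<omega> \<subseteq> F (\<theta> \<omega>)) \<and>
     strongly_measurable M (\<lambda>\<omega>. proj_along (E \<omega>) (F \<omega>)) \<and>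
     strongly_measurable M (\<lambda>\<omega>. proj_along (F \<omega>) (E \<omega>)) \<and>
     (\<forall>\<omega>\<in>\<Omega>'.
        tempered_at M \<theta> (\<lambda>\<omega>. real_of_ereal (separation_index (E \<omega>) (F \<omega>))) \<omega> \<and>
        tempered_at M \<theta> (\<lambda>\<omega>. max (onorm (proj_along (E \<omega>) (F \<omega>)))
                                    (onorm (proj_along (F \<omega>) (E \<omega>)))) \<omega>) \<and>
     (\<exists>\<delta>\<in>borel_measurable M. \<exists>K\<in>borel_measurable M.
        invariant_function M \<theta> \<delta> \<and>
        (\<forall>\<omega>\<in>space M. 0 < \<delta> \<omega> \<and> 1 \<le> K \<omega>) \<and>
        (\<forall>\<omega>\<in>\<Omega>'. tempered_at M \<theta> K \<omega> \<and>
           (\<forall>n. onorm_on (E ((\<theta> ^^ n) \<omega>)) (inv_into (E \<omega>) (blinfun_apply (cocycle \<theta> A n \<omega>))) *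
                onorm_on (F \<omega>) (blinfun_apply (cocycle \<theta> A n \<omega>))
                \<le> K \<omega> * exp (- real n * \<delta> \<omega>))))"

end

theory Submission imports Defs begin

text \<open>The separation hypothesis says that the image \<open>A v\<close> of a cone vector is the centre of a ball of
  radius \<open>norm (A v) / c\<close> inside the next cone. Two facts follow. A subspace that avoids the next cone
  stays at distance \<open>norm (A v) / c\<close> from \<open>A v\<close> (\<open>angle\<close>). And if a segment \<open>v + t u\<close> with
  \<open>\<bar>t\<bar> \<le> s\<close> lies in the cone while \<open>A u\<close> lies in such a subspace, then in the next cone the segment
  can be lengthened by the factor \<open>1 + 1 / (c (1 + c))\<close> (\<open>cone_step\<close>). Over \<open>n\<close> steps these factors
  multiply, whereas the angle limits how long a segment in a cone can be. Hence the \<open>u\<close>-direction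
  contracts relative to the \<open>v\<close>-direction by the product of the factors (\<open>cone_growth_bound\<close>). This
  single estimate yields the splitting and its domination.

  The subspace \<open>F\<close> is the limit of the preimages of \<open>F0\<close> under \<open>n\<close> steps, and \<open>E\<close> is the limit of
  the images of \<open>E0\<close> under \<open>n\<close> steps from the past. In both cases the projections form Cauchy sequences,
  because a discrepancy between two stages would be a direction avoiding the cones and is contracted
  (\<open>proj_n_contract\<close>, \<open>cone_pair_contraction\<close>). The projection onto \<open>E\<close> is bounded by \<open>c\<close> at the
  preceding point, so it is tempered along with \<open>c\<close>. The measurability of the limits is inherited from
  finite stages, where the projections solve a linear equation on a finite-dimensional space (\<open>borel_measurable_unique_solution\<close>).

  The product of the factors is exponential: the logarithm of one factor is a bounded positive function,
  and the ergodic theorem gives its time averages a positive invariant limit \<open>L\<close>, the same in forward and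
  backward time (\<open>two_sided_mean\<close>). The rate of domination is \<open>L / 2\<close>; the other half absorbs the
  subexponential errors, uniformly enough for the constant \<open>K\<close> to be tempered
  (\<open>domination_constant_bound\<close>).\<close>

section \<open>Finite-dimensional subspaces and closed complements\<close>

lemma has_dim_subspace: "has_dim E n \<Longrightarrow> subspace E"
  unfolding has_dim_def by auto

text \<open>A vector of \<open>G\<close> outside \<open>V\<close> would extend a basis of
  \<open>V\<close> to \<open>n + 1\<close> independent vectors in the span of
  \<open>n\<close>.\<close>

lemma has_dim_subset_eq:
  fixes V G :: "'a::real_vector set"
  assumes "has_dim V n" "has_dim G n" "V \<subseteq> G"
  shows "V = G"
proof -
  obtain B where B: "finite B" "card B = n" "independent B" "span B = V"
    using assms(1) by (auto simp: has_dim_def)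
  obtain D where D: "finite D" "card D = n" "span D = G"
    using assms(2) by (auto simp: has_dim_def)
  have "x \<in> V" if "x \<in> G" for x
  proof (rule ccontr)
    assume "x \<notin> V"
    then have "x \<notin> span B" "x \<notin> B" using B(4) span_base by auto
    then have "independent (insert x B)" using B(3) by (simp add: independent_insert)
    moreover have "insert x B \<subseteq> span D"
      using that assms(3) B(4) D(3) span_superset by auto
    ultimately have "card (insert x B) \<le> card D"
      using independent_span_bound[OF D(1)] by blast
    then show False using \<open>x \<notin> B\<close> B D by simp
  qed
  then show ?thesis using assms(3) by auto
qed

lemma has_dim_image:
  assumes "has_dim V n" "linear f" "inj_on f V"
  shows "has_dim (f ` V) n"
proof -
  obtain B where B: "finite B" "card B = n" "independent B" "span B = V"
    using assms(1) by (auto simp: has_dim_def)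
  have "inj_on f B" using assms(3) B(4) span_superset inj_on_subset by metis
  then show ?thesis unfolding has_dim_def
    using B assms linear_independent_injective_image[OF assms(2) B(3)]
    by (intro exI[of _ "f ` B"]) (auto simp: card_image linear_span_image)
qed

text \<open>A direct sum without topology. The intermediate splittings are recognised by
  counting dimensions, which says nothing about closedness; continuity of their projections
  comes from the cones instead.\<close>

locale algebraic_splitting =
  fixes E F :: "'a::real_vector set"
  assumes subspace_E: "subspace E" and subspace_F: "subspace F"
    and inter: "E \<inter> F = {0}" and sum: "\<And>x. \<exists>e\<in>E. \<exists>f\<in>F. x = e + f"
begin

lemma proj_unique: assumes "e \<in> E" "x - e \<in> F" shows "proj_along E F x = e"
  unfolding proj_along_def
proof (rule the_equality)
  fix e' assume e': "e' \<in> E \<and> x - e' \<in> F"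
  have "e' - e \<in> E" using assms e' subspace_E by (simp add: subspace_diff)
  moreover have "e' - e = (x - e) - (x - e')" by simp
  then have "e' - e \<in> F" using assms e' subspace_F by (metis subspace_diff)
  ultimately have "e' - e = 0" using inter by blast
  then show "e' = e" by simp
qed (use assms in simp)

lemma proj_mem: "proj_along E F x \<in> E" and proj_compl: "x - proj_along E F x \<in> F"
proof -
  obtain e f where "e \<in> E" "f \<in> F" "x = e + f" using sum by blast
  then have "proj_along E F x = e" by (intro proj_unique) auto
  then show "proj_along E F x \<in> E" "x - proj_along E F x \<in> F"
    using \<open>e \<in> E\<close> \<open>f \<in> F\<close> \<open>x = e + f\<close> by auto
qed

lemma linear_proj: "linear (proj_along E F)"
proof (rule linearI)
  fix x y r
  have "x + y - (proj_along E F x + proj_along E F y)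
     = (x - proj_along E F x) + (y - proj_along E F y)" by simp
  then show "proj_along E F (x + y) = proj_along E F x + proj_along E F y"
    by (intro proj_unique subspace_add[OF subspace_E] proj_mem)
       (metis subspace_add[OF subspace_F] proj_compl)
  have "r *\<^sub>R x - r *\<^sub>R proj_along E F x = r *\<^sub>R (x - proj_along E F x)"
    by (simp add: scaleR_diff_right)
  then show "proj_along E F (r *\<^sub>R x) = r *\<^sub>R proj_along E F x"
    by (intro proj_unique subspace_scale[OF subspace_E] proj_mem)
       (metis subspace_scale[OF subspace_F] proj_compl)
qed

lemma proj_fix: "e \<in> E \<Longrightarrow> proj_along E F e = e"
  by (rule proj_unique) (auto simp: subspace_0 subspace_F)

lemma proj_zero_iff: "proj_along E F x = 0 \<longleftrightarrow> x \<in> F"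
  using proj_compl[of x] proj_unique[of 0 x] subspace_0[OF subspace_E] by auto

lemma swap: "algebraic_splitting F E"
  by unfold_locales (use subspace_E subspace_F inter sum in \<open>auto, metis add.commute\<close>)

lemma proj_swap: "proj_along F E x = x - proj_along E F x"
  by (rule algebraic_splitting.proj_unique[OF swap]) (auto simp: proj_compl proj_mem)

end

lemma splitting_imp_algebraic: "splitting E F \<Longrightarrow> algebraic_splitting E F"
  unfolding splitting_def algebraic_splitting_def by auto

text \<open>This turns transversality to a cone into a direct sum: projecting along
  \<open>F\<close> onto a known complement is injective on \<open>V\<close>, hence onto, by
  equality of dimensions.\<close>

lemma complement_of_dim:
  fixes F :: "'a::real_vector set"
  assumes F: "has_codim F n" and V: "has_dim V n" and VF: "V \<inter> F = {0}"
  shows "algebraic_splitting V F"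
proof -
  obtain G where G: "has_dim G n" "G \<inter> F = {0}" "\<And>x. \<exists>g\<in>G. \<exists>f\<in>F. x = g + f"
    and sF: "subspace F" using F by (auto simp: has_codim_def)
  interpret G: algebraic_splitting G F
    using G sF has_dim_subspace by unfold_locales auto
  note sV = has_dim_subspace[OF V]
  have inj: "inj_on (proj_along G F) V"
  proof (rule inj_onI)
    fix x y assume xy: "x \<in> V" "y \<in> V" "proj_along G F x = proj_along G F y"
    then have "proj_along G F (x - y) = 0" using linear_diff[OF G.linear_proj] by simp
    then have "x - y \<in> F" using G.proj_zero_iff by blast
    moreover have "x - y \<in> V" using xy sV subspace_diff by blast
    ultimately have "x - y \<in> {0}" using VF by blast
    then show "x = y" by simp
  qed
  have "proj_along G F ` V = G"
    by (rule has_dim_subset_eq[OF has_dim_image[OF V G.linear_proj inj] G(1)])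
       (use G.proj_mem in auto)
  show ?thesis
  proof (unfold_locales, fact sV, fact sF, fact VF)
    fix x
    obtain v where v: "v \<in> V" "proj_along G F x = proj_along G F v"
      using \<open>proj_along G F ` V = G\<close> G.proj_mem by (metis imageE)
    then have "x - v \<in> F" using G.proj_zero_iff linear_diff[OF G.linear_proj] by force
    then show "\<exists>e\<in>V. \<exists>f\<in>F. x = e + f" using v by force
  qed
qed

lemma splitting_has_codim:
  "algebraic_splitting E F \<Longrightarrow> has_dim E n \<Longrightarrow> has_codim F n"
  unfolding has_codim_def algebraic_splitting_def by blast

text \<open>Adding one basis vector \<open>b\<close> to a closed subspace keeps it closed and
  makes the coefficient of \<open>b\<close> a bounded functional, because \<open>b\<close> has
  positive distance from that subspace; induction over the basis does the rest. With
  \<open>g = id\<close> the estimate bounds the projection onto \<open>span B\<close> along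
  \<open>F\<close>; with \<open>F = {0}\<close> it says that a linear map on a
  finite-dimensional space is bounded.\<close>

lemma finite_dim_complement_bounded:
  fixes F :: "'a::banach set" and g :: "'a \<Rightarrow> 'b::real_normed_vector"
  assumes "finite B" "independent B" "subspace F" "closed F" "span B \<inter> F = {0}" "linear g"
  shows "closed {x + f |x f. x \<in> span B \<and> f \<in> F} \<and> (\<exists>M. \<forall>x\<in>span B. \<forall>f\<in>F. norm (g x) \<le> M * norm (x + f))"
  using assms(1,2,5)
proof (induction B)
  case empty
  then show ?case using assms by (auto simp: linear_0 intro: exI[of _ 0])
next
  case (insert b B)
  let ?G = "{x + f |x f. x \<in> span B \<and> f \<in> F}"
  have ind: "independent B" "b \<notin> span B" using insert by (auto simp: independent_insert)
  have sub: "span B \<subseteq> span (insert b B)" by (simp add: span_mono subset_insertI)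
  have "0 \<in> span B" "0 \<in> F" using assms(3) by (auto simp: span_zero subspace_0)
  then have tr: "span B \<inter> F = {0}" using insert.prems(2) sub by blast
  from insert.IH[OF ind(1) tr] obtain M0 where
    cl: "closed ?G" and M0: "\<And>x f. x \<in> span B \<Longrightarrow> f \<in> F \<Longrightarrow> norm (g x) \<le> M0 * norm (x + f)" by blast
  define M where "M = max M0 0"
  have M: "norm (g x) \<le> M * norm (x + f)" if "x \<in> span B" "f \<in> F" for x f
    using M0[OF that] mult_right_mono[of M0 M "norm (x + f)"] by (simp add: M_def)
  have M_nn: "0 \<le> M" by (simp add: M_def)
  have bG: "b \<notin> ?G"
  proof
    assume "b \<in> ?G"
    then obtain x f where xf: "x \<in> span B" "f \<in> F" "b = x + f" by blast
    then have "f = b - x" by simp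
    then have "f \<in> span (insert b B)"
      using xf sub by (metis insertI1 span_base span_diff subset_iff)
    then have "f = 0" using xf insert.prems(2) by blast
    then show False using xf ind by simp
  qed
  have sG: "subspace ?G" using subspace_sums[OF subspace_span assms(3)] .
  have "?G \<noteq> {}" using sG subspace_0 by blast
  define d where "d = infdist b ?G"
  have d: "d > 0" unfolding d_def
    using bG cl \<open>?G \<noteq> {}\<close> infdist_pos_not_in_closed by blast
  have coef: "\<bar>a\<bar> * d \<le> norm (y + a *\<^sub>R b)" if "y \<in> ?G" for a y
  proof (cases "a = 0")
    case False
    have "d \<le> dist b ((-1/a) *\<^sub>R y)" unfolding d_def
      by (rule infdist_le) (rule subspace_scale[OF sG that])
    then have "\<bar>a\<bar> * d \<le> \<bar>a\<bar> * norm (b + (1/a) *\<^sub>R y)" by (simp add: dist_norm mult_left_mono)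
    also have "\<dots> = norm (a *\<^sub>R (b + (1/a) *\<^sub>R y))" by simp
    also have "a *\<^sub>R (b + (1/a) *\<^sub>R y) = y + a *\<^sub>R b" using False by (simp add: scaleR_add_right)
    finally show ?thesis .
  qed simp
  have dec: "\<exists>y a. x = y + a *\<^sub>R b \<and> y \<in> span B" if "x \<in> span (insert b B)" for x
    using that span_breakdown_eq[of x b B] by (metis diff_add_cancel)
  let ?H = "{x + f |x f. x \<in> span (insert b B) \<and> f \<in> F}"
  have "closed ?H"
  proof (unfold closed_sequential_limits, safe)
    fix X l assume X: "\<forall>n. X n \<in> ?H" "X \<longlonglongrightarrow> l"
    have "\<exists>y a. X n = y + a *\<^sub>R b \<and> y \<in> ?G" for n
    proof -
      obtain x f where xf: "X n = x + f" "x \<in> span (insert b B)" "f \<in> F" using X(1) by blast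
      obtain y a where "x = y + a *\<^sub>R b" "y \<in> span B" using dec xf by blast
      then show ?thesis using xf by (intro exI[of _ "y + f"] exI[of _ a]) auto
    qed
    then have "\<forall>n. \<exists>p. X n = fst p + snd p *\<^sub>R b \<and> fst p \<in> ?G" by simp
    then obtain p where p: "\<forall>n. X n = fst (p n) + snd (p n) *\<^sub>R b \<and> fst (p n) \<in> ?G"
      by (rule choice[THEN exE])
    define y a where "y n = fst (p n)" and "a n = snd (p n)" for n
    have ya: "X n = y n + a n *\<^sub>R b" "y n \<in> ?G" for n
      using p unfolding y_def a_def by blast+
    have "Cauchy a"
    proof (rule metric_CauchyI)
      fix e :: real assume "e > 0"
      have "Cauchy X" using X(2) LIMSEQ_imp_Cauchy by blast
      then obtain N where N: "\<And>m n. m \<ge> N \<Longrightarrow> n \<ge> N \<Longrightarrow> dist (X m) (X n) < e * d"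
        using metric_CauchyD[of X "e*d"] \<open>e > 0\<close> d by auto
      show "\<exists>M. \<forall>m\<ge>M. \<forall>n\<ge>M. dist (a m) (a n) < e"
      proof (intro exI allI impI)
        fix m n assume mn: "m \<ge> N" "n \<ge> N"
        have "\<bar>a m - a n\<bar> * d \<le> norm ((y m - y n) + (a m - a n) *\<^sub>R b)"
          by (rule coef) (rule subspace_diff[OF sG ya(2) ya(2)])
        also have "(y m - y n) + (a m - a n) *\<^sub>R b = X m - X n" by (simp add: ya(1) algebra_simps)
        also have "norm (X m - X n) < e * d" using N[OF mn] by (simp add: dist_norm)
        finally show "dist (a m) (a n) < e" using d by (simp add: dist_real_def)
      qed
    qed
    then obtain \<alpha> where \<alpha>: "a \<longlonglongrightarrow> \<alpha>" using Cauchy_convergent convergent_def by blast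
    have "(\<lambda>n. X n - a n *\<^sub>R b) \<longlonglongrightarrow> l - \<alpha> *\<^sub>R b" by (intro tendsto_intros X \<alpha>)
    moreover have "(\<lambda>n. X n - a n *\<^sub>R b) = y" by (auto simp: ya(1))
    ultimately have "y \<longlonglongrightarrow> l - \<alpha> *\<^sub>R b" by simp
    then have "l - \<alpha> *\<^sub>R b \<in> ?G" by (rule closed_sequentially[OF cl ya(2)])
    then obtain x f where xf: "l - \<alpha> *\<^sub>R b = x + f" "x \<in> span B" "f \<in> F" by blast
    have "x + \<alpha> *\<^sub>R b \<in> span (insert b B)"
      using xf sub by (meson insertI1 span_add span_base span_scale subsetD)
    moreover have "l = (x + \<alpha> *\<^sub>R b) + f" using xf(1) by (simp add: algebra_simps)
    ultimately show "\<exists>x f. l = x + f \<and> x \<in> span (insert b B) \<and> f \<in> F" using xf by blast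
  qed
  moreover have "norm (g x) \<le> (M + (M * norm b + norm (g b)) / d) * norm (x + f)"
    if x: "x \<in> span (insert b B)" and f: "f \<in> F" for x f
  proof -
    obtain y a where ya: "x = y + a *\<^sub>R b" "y \<in> span B" using dec x by blast
    have eq: "(y + f) + a *\<^sub>R b = x + f" by (simp add: ya)
    have "\<bar>a\<bar> * d \<le> norm (x + f)" using coef[of "y + f" a] ya f unfolding eq by blast
    then have a: "\<bar>a\<bar> \<le> norm (x + f) / d" using d by (simp add: field_simps)
    have "y + f = (x + f) - a *\<^sub>R b" by (simp add: ya)
    then have "norm (y + f) \<le> norm (x + f) + \<bar>a\<bar> * norm b" by (metis norm_triangle_ineq4 norm_scaleR)
    then have "norm (g y) \<le> M * (norm (x + f) + \<bar>a\<bar> * norm b)"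
      using order_trans[OF M[OF ya(2) f] mult_left_mono[OF _ M_nn]] by blast
    moreover have "g x = g y + a *\<^sub>R g b"
      by (simp add: ya linear_add[OF assms(6)] linear_scale[OF assms(6)])
    then have "norm (g x) \<le> norm (g y) + \<bar>a\<bar> * norm (g b)"
      using norm_triangle_ineq[of "g y" "a *\<^sub>R g b"] by simp
    ultimately have "norm (g x) \<le> M * norm (x + f) + \<bar>a\<bar> * (M * norm b + norm (g b))"
      by (simp add: algebra_simps)
    also have "\<dots> \<le> M * norm (x + f) + (norm (x + f) / d) * (M * norm b + norm (g b))"
      by (intro add_left_mono mult_right_mono a) (simp add: M_nn)
    finally show ?thesis by (simp add: field_simps)
  qed
  ultimately show ?case by blast
qed

lemma bounded_linear_proj_along:
  fixes F :: "'a::banach set"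
  assumes "splitting E F" "has_dim E n"
  shows "bounded_linear (proj_along E F)"
proof -
  interpret algebraic_splitting E F using assms(1) by (rule splitting_imp_algebraic)
  obtain B where B: "finite B" "independent B" "span B = E"
    using assms(2) by (auto simp: has_dim_def)
  obtain M where M: "\<And>x f. x \<in> E \<Longrightarrow> f \<in> F \<Longrightarrow> norm x \<le> M * norm (x + f)"
    using finite_dim_complement_bounded[OF B(1,2), of F id] B(3) inter assms(1)
    by (auto simp: splitting_def linear_id)
  have "norm (proj_along E F x) \<le> norm x * M" for x
    using M[OF proj_mem proj_compl, of x x] by (simp add: mult.commute)
  then show ?thesis
    by (intro bounded_linear_intro linear_add[OF linear_proj] linear_scale[OF linear_proj])
qed

text \<open>The lower bound is an upper bound for a linear left inverse of \<open>R\<close> on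
  the finite-dimensional image.\<close>

lemma inj_on_finite_dim_bounded_below:
  fixes R :: "'a::banach \<Rightarrow> 'a"
  assumes V: "has_dim V n" and R: "linear R" and inj: "\<And>v. v \<in> V \<Longrightarrow> R v = 0 \<Longrightarrow> v = 0"
  shows "\<exists>m. \<forall>v\<in>V. norm v \<le> m * norm (R v)"
proof -
  obtain B where B: "finite B" "independent B" "span B = V" using V by (auto simp: has_dim_def)
  have inj': "inj_on R (span B)"
    using linear_inj_on_iff_eq_0[OF R subspace_span] inj B(3) by blast
  obtain G where G: "linear G" "\<And>x. x \<in> span B \<Longrightarrow> G (R x) = x"
    using linear_inj_on_left_inverse[OF R inj'] by auto
  have "independent (R ` B)" using linear_independent_injective_image[OF R B(2) inj'] .
  then obtain m where m: "\<And>x. x \<in> span (R ` B) \<Longrightarrow> norm (G x) \<le> m * norm x"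
    using finite_dim_complement_bounded[OF _ _ _ _ _ G(1), of "R ` B" "{0}"] B(1)
    by (auto simp: span_zero)
  have "norm v \<le> m * norm (R v)" if "v \<in> V" for v
    using m[of "R v"] that G(2)[of v] B(3) linear_span_image[OF R, of B] by auto
  then show ?thesis by blast
qed

lemma closed_has_dim:
  fixes V :: "'a::banach set"
  assumes "has_dim V n"
  shows "closed V"
proof -
  obtain B where B: "finite B" "independent B" "span B = V" using assms by (auto simp: has_dim_def)
  have "{x + f |x f. x \<in> span B \<and> f \<in> {0}} = V" by (simp add: B(3))
  moreover have "span B \<inter> {0} = {0}" by (auto simp: span_zero)
  ultimately show ?thesis
    using finite_dim_complement_bounded[OF B(1,2) _ _ _ linear_id, of "{0}"] by simp
qed

section \<open>Temperedness as sublinear growth\<close>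

text \<open>Limits of \<open>a i / i\<close> at both ends are awkward to combine when indices
  are shifted or added. A bound by \<open>\<epsilon> \<bar>i\<bar> + D\<close> for all integers
  at once is equivalent, as shown below, and passes through such operations by plain
  arithmetic.\<close>

definition sublinear :: "(int \<Rightarrow> real) \<Rightarrow> bool" where
  "sublinear a \<longleftrightarrow> (\<forall>\<epsilon>>0. \<exists>D. \<forall>i. \<bar>a i\<bar> \<le> \<epsilon> * \<bar>real_of_int i\<bar> + D)"

lemma sublinearD: assumes "sublinear a" "\<epsilon> > 0"
  obtains D where "0 \<le> D" "\<And>i. \<bar>a i\<bar> \<le> \<epsilon> * \<bar>real_of_int i\<bar> + D"
proof -
  obtain D where D: "\<And>i. \<bar>a i\<bar> \<le> \<epsilon> * \<bar>real_of_int i\<bar> + D" using assms unfolding sublinear_def by blast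
  have "0 \<le> D" using D[of 0] by simp
  then show ?thesis using that D by blast
qed

lemma tendsto_0_imp_linear_bound:
  fixes x :: "nat \<Rightarrow> real"
  assumes "(\<lambda>n. x n / real n) \<longlonglongrightarrow> 0" "\<epsilon> > 0"
  shows "\<exists>D. \<forall>n. \<bar>x n\<bar> \<le> \<epsilon> * real n + D"
proof -
  obtain N where N: "\<And>n. n \<ge> N \<Longrightarrow> \<bar>x n / real n\<bar> < \<epsilon>"
    using LIMSEQ_D[OF assms] by auto
  have "\<bar>x n\<bar> \<le> \<epsilon> * real n + (\<Sum>i\<le>N. \<bar>x i\<bar>)" for n
  proof (cases "n \<le> N")
    case True
    have "\<bar>x n\<bar> \<le> (\<Sum>i\<le>N. \<bar>x i\<bar>)" using True by (intro member_le_sum) auto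
    moreover have "0 \<le> \<epsilon> * real n" using assms(2) by simp
    ultimately show ?thesis by linarith
  next
    case False
    then have "\<bar>x n\<bar> \<le> \<epsilon> * real n" using N[of n] by (auto simp: field_simps)
    moreover have "0 \<le> (\<Sum>i\<le>N. \<bar>x i\<bar>)" by (intro sum_nonneg) auto
    ultimately show ?thesis by linarith
  qed
  then show ?thesis by blast
qed

lemma linear_bound_imp_tendsto_0:
  fixes x :: "nat \<Rightarrow> real"
  assumes "\<And>\<epsilon>. \<epsilon> > 0 \<Longrightarrow> \<exists>D. \<forall>n. \<bar>x n\<bar> \<le> \<epsilon> * real n + D"
  shows "(\<lambda>n. x n / real n) \<longlonglongrightarrow> 0"
proof (rule LIMSEQ_I)
  fix r :: real assume r: "r > 0"
  obtain D where D: "\<And>n. \<bar>x n\<bar> \<le> (r/2) * real n + D" using assms[of "r/2"] r by auto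
  obtain N where N: "2 * D / r < real N" using reals_Archimedean2 by blast
  have "norm (x n / real n - 0) < r" if "n \<ge> Suc N" for n
  proof -
    have "D < (r/2) * real N" using N r by (simp add: field_simps)
    also have "\<dots> \<le> (r/2) * real n" using that r by simp
    finally have "\<bar>x n\<bar> < r * real n" using D[of n] by (simp add: field_simps)
    then show ?thesis using that by (simp add: field_simps)
  qed
  then show "\<exists>no. \<forall>n\<ge>no. norm (x n / real n - 0) < r" by blast
qed

lemma sublinear_iff_nat:
  "sublinear a \<longleftrightarrow> (\<lambda>n. a (int n) / real n) \<longlonglongrightarrow> 0 \<and> (\<lambda>n. a (- int n) / real n) \<longlonglongrightarrow> 0"
proof
  assume s: "sublinear a"
  have "\<exists>D. \<forall>n. \<bar>a (int n)\<bar> \<le> \<epsilon> * real n + D" "\<exists>D. \<forall>n. \<bar>a (- int n)\<bar> \<le> \<epsilon> * real n + D"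
    if e: "\<epsilon> > 0" for \<epsilon>
  proof -
    obtain D where D: "\<And>i. \<bar>a i\<bar> \<le> \<epsilon> * \<bar>real_of_int i\<bar> + D" using sublinearD[OF s e] by blast
    show "\<exists>D. \<forall>n. \<bar>a (int n)\<bar> \<le> \<epsilon> * real n + D" using D[of "int _"] by auto
    show "\<exists>D. \<forall>n. \<bar>a (- int n)\<bar> \<le> \<epsilon> * real n + D" using D[of "- int _"] by auto
  qed
  then show "(\<lambda>n. a (int n) / real n) \<longlonglongrightarrow> 0 \<and> (\<lambda>n. a (- int n) / real n) \<longlonglongrightarrow> 0"
    by (intro conjI linear_bound_imp_tendsto_0)
next
  assume lim: "(\<lambda>n. a (int n) / real n) \<longlonglongrightarrow> 0 \<and> (\<lambda>n. a (- int n) / real n) \<longlonglongrightarrow> 0"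
  show "sublinear a" unfolding sublinear_def
  proof (intro allI impI)
    fix \<epsilon> :: real assume e: "\<epsilon> > 0"
    obtain D1 where D1: "\<And>n. \<bar>a (int n)\<bar> \<le> \<epsilon> * real n + D1"
      using tendsto_0_imp_linear_bound[OF conjunct1[OF lim] e] by blast
    obtain D2 where D2: "\<And>n. \<bar>a (- int n)\<bar> \<le> \<epsilon> * real n + D2"
      using tendsto_0_imp_linear_bound[OF conjunct2[OF lim] e] by blast
    have "\<bar>a i\<bar> \<le> \<epsilon> * \<bar>real_of_int i\<bar> + max D1 D2" for i
    proof (cases "0 \<le> i")
      case True
      then show ?thesis using D1[of "nat i"] by simp
    next
      case False
      then show ?thesis using D2[of "nat (- i)"] by simp
    qed
    then show "\<exists>D. \<forall>i. \<bar>a i\<bar> \<le> \<epsilon> * \<bar>real_of_int i\<bar> + D" by blast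
  qed
qed

lemma filterlim_int_at_top_iff:
  fixes f :: "int \<Rightarrow> 'b"
  shows "filterlim f G at_top \<longleftrightarrow> filterlim (\<lambda>n. f (int n)) G sequentially"
proof
  show "filterlim f G at_top \<Longrightarrow> filterlim (\<lambda>n. f (int n)) G sequentially"
    by (rule filterlim_compose[OF _ filterlim_int_sequentially])
  assume "filterlim (\<lambda>n. f (int n)) G sequentially"
  then have "filterlim (\<lambda>i. f (int (nat i))) G at_top"
    by (rule filterlim_compose) (rule filterlim_nat_sequentially)
  then show "filterlim f G at_top"
    by (rule filterlim_mono_eventually[OF _ order_refl order_refl])
       (use eventually_ge_at_top[of "0::int"] in eventually_elim, simp)
qed

lemma filterlim_int_at_bot_iff:
  fixes f :: "int \<Rightarrow> 'b"
  shows "filterlim f G at_bot \<longleftrightarrow> filterlim (\<lambda>n. f (- int n)) G sequentially"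
  unfolding filterlim_int_at_top_iff[of "\<lambda>i. f (- i)", symmetric]
  by (subst at_bot_mirror) (simp add: filterlim_filtermap)

lemma tempered_at_iff_sublinear:
  "tempered_at M \<theta> f w \<longleftrightarrow> sublinear (\<lambda>i. ln (f (int_iterate M \<theta> i w)))"
proof -
  have "(\<lambda>n. ln (f (int_iterate M \<theta> (- int n) w)) / real_of_int (- int n)) \<longlonglongrightarrow> 0 \<longleftrightarrow>
        (\<lambda>n. ln (f (int_iterate M \<theta> (- int n) w)) / real n) \<longlonglongrightarrow> 0"
    using tendsto_minus_cancel_left[of "\<lambda>n. ln (f (int_iterate M \<theta> (- int n) w)) / real n" 0] by simp
  then show ?thesis
    unfolding tempered_at_def sublinear_iff_nat filterlim_int_at_top_iff filterlim_int_at_bot_iff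
    by simp
qed

lemma sublinear_add: assumes "sublinear a" "sublinear b" shows "sublinear (\<lambda>i. a i + b i)"
  unfolding sublinear_def
proof (intro allI impI)
  fix \<epsilon> :: real assume e: "\<epsilon> > 0"
  obtain D1 where D1: "\<And>i. \<bar>a i\<bar> \<le> \<epsilon>/2 * \<bar>real_of_int i\<bar> + D1" using sublinearD[OF assms(1), of "\<epsilon>/2"] e by (metis half_gt_zero)
  obtain D2 where D2: "\<And>i. \<bar>b i\<bar> \<le> \<epsilon>/2 * \<bar>real_of_int i\<bar> + D2" using sublinearD[OF assms(2), of "\<epsilon>/2"] e by (metis half_gt_zero)
  have "\<bar>a i + b i\<bar> \<le> \<epsilon> * \<bar>real_of_int i\<bar> + (D1 + D2)" for i
    using D1[of i] D2[of i] by (auto simp: field_simps)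
  then show "\<exists>D. \<forall>i. \<bar>a i + b i\<bar> \<le> \<epsilon> * \<bar>real_of_int i\<bar> + D" by blast
qed

lemma sublinear_const: "sublinear (\<lambda>i. C)"
  unfolding sublinear_def by (intro allI impI exI[of _ "\<bar>C\<bar>"]) simp

lemma sublinear_mono: assumes "sublinear a" "\<And>i. \<bar>b i\<bar> \<le> \<bar>a i\<bar>" shows "sublinear b"
  using assms unfolding sublinear_def by (meson order_trans)

lemma sublinear_shift: assumes "sublinear a" shows "sublinear (\<lambda>i. a (i + k))"
  unfolding sublinear_def
proof (intro allI impI)
  fix \<epsilon> :: real assume e: "\<epsilon> > 0"
  obtain D where D: "\<And>i. \<bar>a i\<bar> \<le> \<epsilon> * \<bar>real_of_int i\<bar> + D" using sublinearD[OF assms e] by blast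
  have "\<bar>a (i + k)\<bar> \<le> \<epsilon> * \<bar>real_of_int i\<bar> + (\<epsilon> * \<bar>real_of_int k\<bar> + D)" for i
  proof -
    have "\<epsilon> * \<bar>real_of_int (i + k)\<bar> \<le> \<epsilon> * (\<bar>real_of_int i\<bar> + \<bar>real_of_int k\<bar>)"
      using e by (intro mult_left_mono) auto
    then show ?thesis using D[of "i+k"] by (simp add: algebra_simps)
  qed
  then show "\<exists>D. \<forall>i. \<bar>a (i + k)\<bar> \<le> \<epsilon> * \<bar>real_of_int i\<bar> + D" by blast
qed

section \<open>The ergodic theorem for bounded functions\<close>

definition birkhoff_sum :: "('w \<Rightarrow> 'w) \<Rightarrow> ('w \<Rightarrow> real) \<Rightarrow> nat \<Rightarrow> 'w \<Rightarrow> real" where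
  "birkhoff_sum T f n w = (\<Sum>j<n. f ((T ^^ j) w))"

locale measure_preserving_map = prob_space M for M :: "'w measure" +
  fixes T :: "'w \<Rightarrow> 'w"
  assumes T_meas[measurable]: "T \<in> measurable M M" and T_pres: "distr M M T = M"
begin

lemma iter_meas[measurable]: "(T ^^ n) \<in> measurable M M"
  by (induction n) (auto intro: measurable_comp[OF _ T_meas])

lemma iter_space: "w \<in> space M \<Longrightarrow> (T ^^ n) w \<in> space M"
  using iter_meas by (rule measurable_space)

lemma integrable_T: "integrable M f \<Longrightarrow> integrable M (\<lambda>w. f (T w))" for f :: "'w \<Rightarrow> real"
  using integrable_distr[OF T_meas, of f] T_pres by simp

lemma integral_T: "f \<in> borel_measurable M \<Longrightarrow> integral\<^sup>L M (\<lambda>w. f (T w)) = integral\<^sup>L M f" for f :: "'w \<Rightarrow> real"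
  using integral_distr[OF T_meas, of f] T_pres by simp

lemma integrable_iter: "integrable M f \<Longrightarrow> integrable M (\<lambda>w. f ((T ^^ n) w))" for f :: "'w \<Rightarrow> real"
  by (induction n arbitrary: f) (auto simp: funpow_swap1 dest: integrable_T)

lemma integral_iter: "f \<in> borel_measurable M \<Longrightarrow> integral\<^sup>L M (\<lambda>w. f ((T ^^ n) w)) = integral\<^sup>L M f" for f :: "'w \<Rightarrow> real"
proof (induction n)
  case (Suc n)
  have "integral\<^sup>L M (\<lambda>w. f ((T ^^ n) (T w))) = integral\<^sup>L M (\<lambda>w. f ((T ^^ n) w))"
    using Suc.prems by (intro integral_T measurable_compose[OF iter_meas])
  then show ?case using Suc by (simp add: funpow_swap1)
qed simp

lemma AE_iter:
  assumes "AE w in M. P w"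
  shows "AE w in M. P ((T ^^ n) w)"
proof (induction n)
  case (Suc n)
  have "AE w in distr M M T. P ((T ^^ n) w)" unfolding T_pres by (rule Suc)
  then have "AE w in M. P ((T ^^ n) (T w))" by (rule AE_distrD[OF T_meas])
  then show ?case by (simp add: funpow_swap1)
qed (use assms in simp)

abbreviation bsum :: "('w \<Rightarrow> real) \<Rightarrow> nat \<Rightarrow> 'w \<Rightarrow> real" where
  "bsum \<equiv> birkhoff_sum T"

lemma bsum_0[simp]: "bsum f 0 w = 0" by (simp add: birkhoff_sum_def)

lemma bsum_Suc: "bsum f (Suc n) w = f w + bsum f n (T w)"
  unfolding birkhoff_sum_def by (subst sum.lessThan_Suc_shift) (simp add: funpow_swap1)

lemma bsum_meas[measurable]: "f \<in> borel_measurable M \<Longrightarrow> bsum f n \<in> borel_measurable M"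
  unfolding birkhoff_sum_def[abs_def] by (intro borel_measurable_sum measurable_compose[OF iter_meas])

lemma integrable_bsum: "integrable M f \<Longrightarrow> integrable M (bsum f n)"
  unfolding birkhoff_sum_def[abs_def] by (intro Bochner_Integration.integrable_sum integrable_iter)

text \<open>Garsia's argument. With \<open>m\<close> the maximum of the Birkhoff sums up to
  \<open>N\<close>, including the empty one, \<open>m - m \<circ> T \<le> f\<close> holds where
  \<open>m > 0\<close>, and elsewhere the left-hand side is not positive; its integral vanishes
  by invariance.\<close>

lemma maximal_ergodic_finite:
  assumes f: "integrable M f"
  shows "0 \<le> (\<integral>w. f w * indicator {w\<in>space M. \<exists>n\<le>N. 0 < bsum f n w} w \<partial>M)"
proof -
  define m where "m w = Max ((\<lambda>n. bsum f n w) ` {..N})" for w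
  have fm[measurable]: "f \<in> borel_measurable M" using f by auto
  have m_ge: "bsum f n w \<le> m w" if "n \<le> N" for n w
    unfolding m_def using that by (intro Max_ge) auto
  have m_nn: "0 \<le> m w" for w using m_ge[of 0] by simp
  have m_in: "\<exists>n\<le>N. m w = bsum f n w" for w
    using Max_in[of "(\<lambda>n. bsum f n w) ` {..N}"] unfolding m_def by fastforce
  have m_meas[measurable]: "m \<in> borel_measurable M"
    unfolding m_def[abs_def] by (intro borel_measurable_Max) auto
  have m_int: "integrable M m"
  proof (rule Bochner_Integration.integrable_bound)
    show "integrable M (\<lambda>w. \<Sum>n\<le>N. \<bar>bsum f n w\<bar>)"
      by (intro Bochner_Integration.integrable_sum integrable_abs integrable_bsum f)
    show "AE w in M. norm (m w) \<le> norm (\<Sum>n\<le>N. \<bar>bsum f n w\<bar>)"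
    proof (rule AE_I2)
      fix w
      obtain n where n: "n \<le> N" "m w = bsum f n w" using m_in by blast
      have "\<bar>bsum f n w\<bar> \<le> (\<Sum>n\<le>N. \<bar>bsum f n w\<bar>)" using n(1) by (intro member_le_sum) auto
      then show "norm (m w) \<le> norm (\<Sum>n\<le>N. \<bar>bsum f n w\<bar>)" using n by simp
    qed
  qed simp
  define I where "I = {w\<in>space M. \<exists>n\<le>N. 0 < bsum f n w}"
  have [measurable]: "I \<in> sets M" unfolding I_def by measurable
  have pt: "m w - m (T w) \<le> f w * indicator I w" if "w \<in> space M" for w
  proof (cases "w \<in> I")
    case True
    obtain n where n: "n \<le> N" "m w = bsum f n w" using m_in by blast
    have "0 < m w" using True m_ge unfolding I_def by (auto intro: less_le_trans)
    then obtain j where j: "n = Suc j" using n by (cases n) auto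
    have "bsum f j (T w) \<le> m (T w)" using n j by (intro m_ge) simp
    then show ?thesis using n j True by (simp add: bsum_Suc)
  next
    case False
    obtain n where n: "n \<le> N" "m w = bsum f n w" using m_in by blast
    then have "m w \<le> 0" using False that unfolding I_def by (auto simp: not_less)
    then show ?thesis using False m_nn[of "T w"] by simp
  qed
  have "0 = (\<integral>w. m w - m (T w) \<partial>M)"
    using m_int integrable_T[OF m_int] integral_T[OF m_meas] by simp
  also have "\<dots> \<le> (\<integral>w. f w * indicator I w \<partial>M)"
    using m_int integrable_T[OF m_int] f pt
    by (intro integral_mono) (auto intro!: integrable_real_mult_indicator)
  finally show ?thesis unfolding I_def .
qed

lemma maximal_ergodic:
  assumes f: "integrable M f"
  shows "0 \<le> (\<integral>w. f w * indicator {w\<in>space M. \<exists>n. 0 < bsum f n w} w \<partial>M)"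
proof (rule LIMSEQ_le_const)
  have fm[measurable]: "f \<in> borel_measurable M" using f by auto
  let ?I = "\<lambda>N. {w\<in>space M. \<exists>n\<le>N. 0 < bsum f n w}" and ?J = "{w\<in>space M. \<exists>n. 0 < bsum f n w}"
  show "(\<lambda>N. \<integral>w. f w * indicator (?I N) w \<partial>M) \<longlonglongrightarrow> (\<integral>w. f w * indicator ?J w \<partial>M)"
  proof (rule integral_dominated_convergence[where w = "\<lambda>w. \<bar>f w\<bar>"])
    show "AE w in M. (\<lambda>N. f w * indicator (?I N) w) \<longlonglongrightarrow> f w * indicator ?J w"
    proof (rule AE_I2)
      fix w assume "w \<in> space M"
      show "(\<lambda>N. f w * indicator (?I N) w) \<longlonglongrightarrow> f w * indicator ?J w"
      proof (cases "w \<in> ?J")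
        case True
        then obtain n where n: "0 < bsum f n w" by blast
        have "eventually (\<lambda>N. f w * indicator (?I N) w = f w * indicator ?J w) sequentially"
          using eventually_ge_at_top[of n]
          by eventually_elim (use n \<open>w \<in> space M\<close> in \<open>auto simp: indicator_def\<close>)
        then show ?thesis by (rule tendsto_eventually)
      next
        case False
        then have "(\<lambda>N. f w * indicator (?I N) w) = (\<lambda>N. f w * indicator ?J w)"
          by (auto simp: indicator_def)
        then show ?thesis by simp
      qed
    qed
  qed (use f in \<open>auto simp: indicator_def\<close>)
  show "\<exists>N. \<forall>n\<ge>N. 0 \<le> (\<integral>w. f w * indicator (?I n) w \<partial>M)"
    using maximal_ergodic_finite[OF f] by blast
qed

definition invariant_set :: "'w set \<Rightarrow> bool" where
  "invariant_set B \<longleftrightarrow> B \<in> sets M \<and> (\<forall>w\<in>space M. T w \<in> B \<longleftrightarrow> w \<in> B)"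

lemma invariant_set_iter: "invariant_set B \<Longrightarrow> w \<in> space M \<Longrightarrow> (T ^^ n) w \<in> B \<longleftrightarrow> w \<in> B"
  by (induction n) (auto simp: invariant_set_def iter_space)

text \<open>The maximal inequality for \<open>(f - a) 1\<^sub>B\<close>: since \<open>B\<close>
  is invariant, its Birkhoff sums are those of \<open>f - a\<close> on \<open>B\<close> and
  vanish off \<open>B\<close>, so the set where some sum is positive is \<open>B\<close>
  itself.\<close>

lemma integral_ge_on_invariant:
  fixes f :: "'w \<Rightarrow> real"
  assumes f: "integrable M f" and B: "invariant_set B"
    and ex: "\<And>w. w \<in> B \<Longrightarrow> \<exists>n>0. a < bsum f n w / real n"
  shows "a * prob B \<le> (\<integral>w. f w * indicator B w \<partial>M)"
proof -
  have Bm[measurable]: "B \<in> sets M" using B by (simp add: invariant_set_def)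
  have Bs: "B \<subseteq> space M" using Bm sets.sets_into_space by blast
  let ?g = "\<lambda>w. (f w - a) * indicator B w"
  have int: "integrable M ?g" using f by (intro integrable_real_mult_indicator) auto
  have bs: "bsum ?g n w = (bsum f n w - real n * a) * indicator B w" if "w \<in> space M" for n w
    unfolding birkhoff_sum_def using invariant_set_iter[OF B that]
    by (auto simp: sum_subtractf indicator_def)
  have "{w\<in>space M. \<exists>n. 0 < bsum ?g n w} = B"
  proof safe
    fix w n assume "w \<in> space M" "0 < bsum ?g n w"
    then have "0 < (bsum f n w - real n * a) * indicator B w" using bs[of w n] by simp
    then show "w \<in> B" by (cases "w \<in> B") auto
  next
    fix w assume "w \<in> B"
    then obtain n where "n > 0" "a < bsum f n w / real n" using ex by blast
    then have "0 < bsum ?g n w" using bs[of w n] \<open>w \<in> B\<close> Bs by (auto simp: field_simps)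
    then show "\<exists>n. 0 < bsum ?g n w" by blast
  qed (use Bs in auto)
  then have "0 \<le> (\<integral>w. ?g w * indicator B w \<partial>M)" using maximal_ergodic[OF int] by simp
  also have "(\<lambda>w. ?g w * indicator B w) = (\<lambda>w. f w * indicator B w - a * indicator B w)"
    by (auto simp: indicator_def)
  also have "(\<integral>w. f w * indicator B w - a * indicator B w \<partial>M)
     = (\<integral>w. f w * indicator B w \<partial>M) - a * prob B"
    using f Bs by (subst Bochner_Integration.integral_diff)
      (auto intro!: integrable_real_mult_indicator simp: Int_absorb2 less_top[symmetric])
  finally show ?thesis by simp
qed

definition upper_mean :: "('w \<Rightarrow> real) \<Rightarrow> 'w \<Rightarrow> ereal" where
  "upper_mean f w = limsup (\<lambda>n. ereal (bsum f n w / real n))"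
definition lower_mean :: "('w \<Rightarrow> real) \<Rightarrow> 'w \<Rightarrow> ereal" where
  "lower_mean f w = liminf (\<lambda>n. ereal (bsum f n w / real n))"

lemma mean_meas[measurable]:
  assumes [measurable]: "f \<in> borel_measurable M"
  shows "upper_mean f \<in> borel_measurable M" "lower_mean f \<in> borel_measurable M"
  unfolding upper_mean_def[abs_def] lower_mean_def[abs_def] by measurable

lemma bsum_bound: assumes "\<And>w. \<bar>f w\<bar> \<le> b" shows "\<bar>bsum f n w\<bar> \<le> real n * b"
  unfolding birkhoff_sum_def
  by (rule order_trans[OF sum_abs order_trans[OF sum_bounded_above[of _ _ b]]]) (use assms in auto)

text \<open>The two Birkhoff sums differ only in their first and last terms.\<close>

lemma mean_shift:
  assumes b: "\<And>w. \<bar>f w\<bar> \<le> b"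
  shows "(\<lambda>n. bsum f n (T w) / real n - bsum f n w / real n) \<longlonglongrightarrow> 0"
proof (rule Lim_null_comparison)
  have "norm (bsum f n (T w) / real n - bsum f n w / real n) \<le> (2 * b) / real n" for n
  proof -
    have "f w + bsum f n (T w) = bsum f n w + f ((T ^^ n) w)"
      using bsum_Suc[of f n w] by (simp add: birkhoff_sum_def)
    then have "\<bar>bsum f n (T w) - bsum f n w\<bar> \<le> 2 * b" using b[of w] b[of "(T ^^ n) w"] by linarith
    then show ?thesis by (simp add: diff_divide_distrib[symmetric] divide_right_mono)
  qed
  then show "eventually (\<lambda>n. norm (bsum f n (T w) / real n - bsum f n w / real n) \<le> (2 * b) / real n) sequentially"
    by simp
  show "(\<lambda>n. (2 * b) / real n) \<longlonglongrightarrow> 0" by (rule lim_const_over_n)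
qed

lemma mean_invariant:
  assumes b: "\<And>w. \<bar>f w\<bar> \<le> b"
  shows "upper_mean f (T w) = upper_mean f w" "lower_mean f (T w) = lower_mean f w"
proof -
  let ?u = "\<lambda>n. ereal (bsum f n (T w) / real n - bsum f n w / real n)"
  have u: "?u \<longlonglongrightarrow> 0" using tendsto_ereal[OF mean_shift[OF b]] by (simp add: zero_ereal_def)
  let ?v = "\<lambda>n. ereal (bsum f n w / real n)"
  have eq: "(\<lambda>n. ereal (bsum f n (T w) / real n)) = (\<lambda>n. ?u n + ?v n)" by simp
  show "upper_mean f (T w) = upper_mean f w" "lower_mean f (T w) = lower_mean f w"
    unfolding upper_mean_def lower_mean_def eq
    using ereal_limsup_lim_add[OF u, of ?v] ereal_liminf_lim_add[OF u, of ?v] by simp_all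
qed

lemma upper_mean_neg: "upper_mean (\<lambda>w. - f w) w = - lower_mean f w"
proof -
  have "bsum (\<lambda>w. - f w) n w / real n = - (bsum f n w / real n)" for n
    by (simp add: birkhoff_sum_def sum_negf)
  then have "(\<lambda>n. ereal (bsum (\<lambda>w. - f w) n w / real n)) = (\<lambda>n. - ereal (bsum f n w / real n))" by simp
  then show ?thesis unfolding upper_mean_def lower_mean_def by (simp only: ereal_Limsup_uminus)
qed

lemma less_limsup_ex:
  assumes "ereal a < limsup (\<lambda>n. ereal (x n / real n))"
  shows "\<exists>n>0. a < x n / real n"
proof (rule ccontr)
  assume "\<not> ?thesis"
  then have "\<forall>n>0. ereal (x n / real n) \<le> ereal a" by (metis ereal_less_eq(3) not_less)
  then have "eventually (\<lambda>n. ereal (x n / real n) \<le> ereal a) sequentially"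
    by (intro eventually_mono[OF eventually_gt_at_top[of "0::nat"]]) blast
  then have "limsup (\<lambda>n. ereal (x n / real n)) \<le> ereal a" by (rule Limsup_bounded)
  then show False using assms by simp
qed

lemma upper_mean_above_integral:
  assumes f[measurable]: "f \<in> borel_measurable M" and b: "\<And>w. \<bar>f w\<bar> \<le> b" and B: "invariant_set B"
    and above: "\<And>w. w \<in> B \<Longrightarrow> ereal a < upper_mean f w"
  shows "a * prob B \<le> (\<integral>w. f w * indicator B w \<partial>M)"
proof (rule integral_ge_on_invariant[OF _ B])
  show "integrable M f" using b by (intro integrable_const_bound[where B = b]) auto
  show "\<exists>n>0. a < bsum f n w / real n" if "w \<in> B" for w
    using above[OF that] unfolding upper_mean_def by (rule less_limsup_ex)
qed

lemma lower_mean_below_integral: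
  assumes f[measurable]: "f \<in> borel_measurable M" and b: "\<And>w. \<bar>f w\<bar> \<le> b" and B: "invariant_set B"
    and below: "\<And>w. w \<in> B \<Longrightarrow> lower_mean f w < ereal a"
  shows "(\<integral>w. f w * indicator B w \<partial>M) \<le> a * prob B"
proof -
  have "- a * prob B \<le> (\<integral>w. - f w * indicator B w \<partial>M)"
    using b below
    by (intro upper_mean_above_integral[OF _ _ B, of _ b])
       (auto simp: upper_mean_neg ereal_uminus_less_reorder simp flip: uminus_ereal.simps)
  then show ?thesis by simp
qed

lemma lower_le_upper: "lower_mean f w \<le> upper_mean f w"
  unfolding lower_mean_def upper_mean_def by (rule Liminf_le_Limsup) simp

text \<open>If the lower mean were below \<open>p\<close> and the upper mean above
  \<open>q > p\<close> on an invariant set of positive measure, the integral of \<open>f\<close>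
  over it would be both at most \<open>p\<close> and at least \<open>q\<close> times that
  measure. Countably many rational pairs suffice.\<close>

lemma means_agree_AE:
  assumes f[measurable]: "f \<in> borel_measurable M" and b: "\<And>w. \<bar>f w\<bar> \<le> b"
  shows "AE w in M. lower_mean f w = upper_mean f w"
proof -
  have null: "AE w in M. \<not> (lower_mean f w < ereal p \<and> ereal q < upper_mean f w)" if "p < q" for p q
  proof -
    let ?B = "{w\<in>space M. lower_mean f w < ereal p \<and> ereal q < upper_mean f w}"
    have Bm[measurable]: "?B \<in> sets M" by measurable
    have inv: "invariant_set ?B"
      unfolding invariant_set_def using mean_invariant[OF b] Bm measurable_space[OF T_meas] by auto
    have "q * prob ?B \<le> p * prob ?B"
      using upper_mean_above_integral[OF f b inv, of q] lower_mean_below_integral[OF f b inv, of p] by simp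
    then have "prob ?B \<le> 0" using that by (simp add: mult_le_cancel_right)
    then have "prob ?B = 0" using measure_nonneg[of M ?B] by linarith
    then have "?B \<in> null_sets M" using Bm by (auto simp: null_sets_def emeasure_eq_measure)
    then show ?thesis by (rule AE_I') auto
  qed
  have "AE w in M. \<forall>pq\<in>\<rat> \<times> \<rat>. fst pq < snd pq \<longrightarrow>
      \<not> (lower_mean f w < ereal (fst pq) \<and> ereal (snd pq) < upper_mean f w)"
    using null by (subst AE_ball_countable) (simp_all add: countable_SIGMA countable_rat, blast?)
  then show ?thesis
  proof eventually_elim
    case (elim w)
    show ?case
    proof (rule ccontr)
      assume "lower_mean f w \<noteq> upper_mean f w"
      then have "lower_mean f w < upper_mean f w" using lower_le_upper order.not_eq_order_implies_strict by blast
      then obtain r where r: "lower_mean f w < ereal r" "ereal r < upper_mean f w" using ereal_dense2 by blast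
      obtain s where s: "r < s" "ereal s < upper_mean f w" using ereal_dense2[OF r(2)] by auto
      obtain p where p: "p \<in> \<rat>" "r < p" "p < s" using Rats_dense_in_real[OF s(1)] by blast
      obtain q where q: "q \<in> \<rat>" "p < q" "q < s" using Rats_dense_in_real[OF p(3)] by blast
      have "lower_mean f w < ereal p" using r p by (meson less_ereal.simps(1) less_trans)
      moreover have "ereal q < upper_mean f w" using s q by (meson less_ereal.simps(1) less_trans)
      ultimately show False using elim p q by force
    qed
  qed
qed

text \<open>The limit is the upper mean rather than a conditional expectation: it is invariant
  at every point, not just almost everywhere. Its integrals over invariant sets, which identify
  it almost everywhere, follow by dominated convergence.\<close>

lemma birkhoff_bounded:
  assumes f[measurable]: "f \<in> borel_measurable M" and b: "\<And>w. \<bar>f w\<bar> \<le> b"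
  obtains L where "L \<in> borel_measurable M" "\<And>w. w \<in> space M \<Longrightarrow> L (T w) = L w" "\<And>w. \<bar>L w\<bar> \<le> b"
    "AE w in M. (\<lambda>n. bsum f n w / real n) \<longlonglongrightarrow> L w"
    "\<And>B. invariant_set B \<Longrightarrow> (\<integral>w. L w * indicator B w \<partial>M) = (\<integral>w. f w * indicator B w \<partial>M)"
proof
  let ?L = "\<lambda>w. real_of_ereal (upper_mean f w)"
  have bnn: "0 \<le> b" using b[of undefined] by linarith
  have avg: "\<bar>bsum f n w / real n\<bar> \<le> b" for n w
    using bsum_bound[of f b n w, OF b] bnn by (cases "n = 0") (auto simp: field_simps)
  have avg': "bsum f n w / real n \<le> b" "- b \<le> bsum f n w / real n" for n w
    using avg[of n w] unfolding abs_le_iff by linarith+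
  have up: "upper_mean f w \<le> ereal b" for w
    unfolding upper_mean_def using avg' by (intro Limsup_bounded always_eventually) simp
  have lo: "ereal (-b) \<le> lower_mean f w" for w
    unfolding lower_mean_def using avg' by (intro Liminf_bounded always_eventually) simp
  have fin: "ereal (?L w) = upper_mean f w" for w
    using up[of w] lo[of w] lower_le_upper[of f w] by (cases "upper_mean f w") auto
  show Lm[measurable]: "?L \<in> borel_measurable M" by measurable
  show "?L (T w) = ?L w" if "w \<in> space M" for w using mean_invariant[OF b] by simp
  show Lb: "\<bar>?L w\<bar> \<le> b" for w
  proof -
    have "ereal (?L w) \<le> ereal b" "ereal (-b) \<le> ereal (?L w)"
      unfolding fin using up lo lower_le_upper order_trans by blast+
    then show ?thesis unfolding abs_le_iff by (simp add: minus_le_iff)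
  qed
  show lim: "AE w in M. (\<lambda>n. bsum f n w / real n) \<longlonglongrightarrow> ?L w"
    using means_agree_AE[OF f b]
  proof eventually_elim
    case (elim w)
    have "(\<lambda>n. ereal (bsum f n w / real n)) \<longlonglongrightarrow> ereal (?L w)"
      using elim fin[of w] unfolding upper_mean_def lower_mean_def
      by (subst tendsto_iff_Liminf_eq_Limsup) auto
    then show ?case by simp
  qed
  fix B assume B: "invariant_set B"
  then have Bm[measurable]: "B \<in> sets M" by (simp add: invariant_set_def)
  have "(\<lambda>n. \<integral>w. bsum f n w / real n * indicator B w \<partial>M) \<longlonglongrightarrow> (\<integral>w. ?L w * indicator B w \<partial>M)"
  proof (rule integral_dominated_convergence[where w = "\<lambda>_. b"])
    show "AE w in M. (\<lambda>n. bsum f n w / real n * indicator B w) \<longlonglongrightarrow> ?L w * indicator B w"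
      using lim by eventually_elim (intro tendsto_intros)
    show "AE w in M. norm (bsum f n w / real n * indicator B w) \<le> b" for n
      using avg[of n] bnn by (intro AE_I2) (auto simp: indicator_def)
  qed auto
  moreover have "eventually (\<lambda>n. (\<integral>w. f w * indicator B w \<partial>M) = (\<integral>w. bsum f n w / real n * indicator B w \<partial>M)) sequentially"
    using eventually_gt_at_top[of "0::nat"]
  proof eventually_elim
    case (elim n)
    let ?h = "\<lambda>w. f w * indicator B w"
    have hi: "integrable M ?h" using b bnn
      by (intro integrable_const_bound[where B = b]) (auto simp: indicator_def)
    have "(\<integral>w. bsum f n w / real n * indicator B w \<partial>M) = (\<integral>w. (\<Sum>j<n. ?h ((T ^^ j) w)) / real n \<partial>M)"
      using invariant_set_iter[OF B]
      by (intro Bochner_Integration.integral_cong) (auto simp: birkhoff_sum_def indicator_def)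
    also have "\<dots> = (\<Sum>j<n. (\<integral>w. ?h ((T ^^ j) w) \<partial>M)) / real n"
      by (simp only: integral_divide_zero Bochner_Integration.integral_sum[OF integrable_iter[OF hi]])
    also have "\<dots> = (\<Sum>j<n. (\<integral>w. ?h w \<partial>M)) / real n"
      by (subst integral_iter) (use hi in auto)
    also have "\<dots> = (\<integral>w. ?h w \<partial>M)" using elim by simp
    finally show ?case by simp
  qed
  then have "(\<lambda>n. \<integral>w. bsum f n w / real n * indicator B w \<partial>M) \<longlonglongrightarrow> (\<integral>w. f w * indicator B w \<partial>M)"
    by (rule Lim_transform_eventually[OF tendsto_const])
  ultimately show "(\<integral>w. ?L w * indicator B w \<partial>M) = (\<integral>w. f w * indicator B w \<partial>M)"
    by (rule LIMSEQ_unique)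
qed

end

section \<open>Growth of segments inside the cones\<close>

text \<open>The factor by which a segment inside the cones is guaranteed to lengthen in
  \<open>n\<close> steps; see \<open>cone_step\<close> for the origin of the single
  factor.\<close>

definition expansion :: "('w \<Rightarrow> 'w) \<Rightarrow> ('w \<Rightarrow> real) \<Rightarrow> nat \<Rightarrow> 'w \<Rightarrow> real" where
  "expansion \<theta> c n w = (\<Prod>j<n. 1 + 1 / (c ((\<theta> ^^ j) w) * (1 + c ((\<theta> ^^ j) w))))"

lemma expansion_0[simp]: "expansion \<theta> c 0 w = 1" by (simp add: expansion_def)

lemma expansion_Suc:
  "expansion \<theta> c (Suc n) w = expansion \<theta> c n w * (1 + 1 / (c ((\<theta> ^^ n) w) * (1 + c ((\<theta> ^^ n) w))))"
  by (simp add: expansion_def)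

lemma expansion_Suc_shift:
  "expansion \<theta> c (Suc n) w = (1 + 1 / (c w * (1 + c w))) * expansion \<theta> c n (\<theta> w)"
  unfolding expansion_def by (subst prod.lessThan_Suc_shift) (simp add: funpow_swap1)

lemma uniform_limit_of_operators:
  fixes P :: "nat \<Rightarrow> 'a::real_normed_vector \<Rightarrow> 'b::banach"
  assumes step: "\<And>m n x. n0 \<le> n \<Longrightarrow> n \<le> m \<Longrightarrow> norm (P m x - P n x) \<le> b n * norm x"
    and b: "b \<longlonglongrightarrow> 0"
  shows "(\<lambda>n. P n x) \<longlonglongrightarrow> lim (\<lambda>n. P n x)"
proof -
  have lim0: "(\<lambda>n. b n * norm x) \<longlonglongrightarrow> 0" using tendsto_mult_right[OF b, of "norm x"] by simp
  have "Cauchy (\<lambda>n. P n x)"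
  proof (rule metric_CauchyI)
    fix e :: real assume "e > 0"
    then have "eventually (\<lambda>n. b n * norm x < e / 2) sequentially"
      using order_tendstoD(2)[OF lim0, of "e/2"] by simp
    then obtain N where N: "\<And>n. n \<ge> N \<Longrightarrow> b n * norm x < e / 2" by (auto simp: eventually_at_top_linorder)
    define N' where "N' = max N n0"
    have "dist (P m x) (P N' x) < e / 2" if "m \<ge> N'" for m
      using step[of N' m x] N[of N'] that by (simp add: dist_norm N'_def)
    then have "dist (P m x) (P n x) < e" if "m \<ge> N'" "n \<ge> N'" for m n
      using that dist_triangle_half_l by blast
    then show "\<exists>M. \<forall>m\<ge>M. \<forall>n\<ge>M. dist (P m x) (P n x) < e" by blast
  qed
  then show ?thesis by (simp add: Cauchy_convergent_iff convergent_LIMSEQ_iff)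
qed

lemma linear_limit:
  assumes "\<And>n. linear (P n)" "\<And>x. (\<lambda>n. P n x) \<longlonglongrightarrow> Q x"
  shows "linear (Q :: 'a::real_normed_vector \<Rightarrow> 'b::real_normed_vector)"
proof (rule linearI)
  show "Q (x + y) = Q x + Q y" for x y
    using tendsto_add[OF assms(2)[of x] assms(2)[of y]] assms(2)[of "x + y"]
    by (simp add: linear_add[OF assms(1)] LIMSEQ_unique)
  show "Q (r *\<^sub>R x) = r *\<^sub>R Q x" for r x
    using tendsto_scaleR[OF tendsto_const assms(2)[of x], of r] assms(2)[of "r *\<^sub>R x"]
    by (simp add: linear_scale[OF assms(1)] LIMSEQ_unique)
qed

text \<open>The pathwise content of a contracting cone family, on a set of points closed under
  the map and its inverse. \<open>C_thick\<close> is the separation hypothesis. The two limits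
  at the end are what temperedness and the ergodic theorem yield: the lengthening factors win
  over \<open>c\<close>, along forward orbits and when starting far in the past.\<close>

locale cone_dynamics =
  fixes \<Omega> :: "'w set" and \<theta> \<tau> :: "'w \<Rightarrow> 'w" and A :: "'w \<Rightarrow> 'a::banach \<Rightarrow>\<^sub>L 'a"
    and k :: "'w \<Rightarrow> nat" and C E0 F0 :: "'w \<Rightarrow> 'a set" and c :: "'w \<Rightarrow> real"
  assumes fwd: "w \<in> \<Omega> \<Longrightarrow> \<theta> w \<in> \<Omega>" and bwd: "w \<in> \<Omega> \<Longrightarrow> \<tau> w \<in> \<Omega>"
    and \<theta>\<tau>: "w \<in> \<Omega> \<Longrightarrow> \<theta> (\<tau> w) = w" and \<tau>\<theta>: "w \<in> \<Omega> \<Longrightarrow> \<tau> (\<theta> w) = w"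
    and k_inv: "w \<in> \<Omega> \<Longrightarrow> k (\<theta> w) = k w"
    and inj_A: "w \<in> \<Omega> \<Longrightarrow> inj (A w)"
    and closed_C: "w \<in> \<Omega> \<Longrightarrow> closed (C w)"
    and C_scale: "w \<in> \<Omega> \<Longrightarrow> v \<in> C w \<Longrightarrow> r *\<^sub>R v \<in> C w"
    and C_map: "w \<in> \<Omega> \<Longrightarrow> v \<in> C w \<Longrightarrow> A w v \<in> C (\<theta> w)"
    and C_thick: "w \<in> \<Omega> \<Longrightarrow> v \<in> C w \<Longrightarrow> norm h \<le> norm (A w v) / c w \<Longrightarrow> A w v + h \<in> C (\<theta> w)"
    and c_ge_1: "w \<in> \<Omega> \<Longrightarrow> 1 \<le> c w"
    and dim_E0: "w \<in> \<Omega> \<Longrightarrow> has_dim (E0 w) (k w)" and codim_F0: "w \<in> \<Omega> \<Longrightarrow> has_codim (F0 w) (k w)"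
    and E0_C: "w \<in> \<Omega> \<Longrightarrow> E0 w \<subseteq> C w" and F0_C: "w \<in> \<Omega> \<Longrightarrow> F0 w \<inter> C w = {0}"
    and expansion_fwd: "w \<in> \<Omega> \<Longrightarrow> (\<lambda>n. 1 / expansion \<theta> c n w) \<longlonglongrightarrow> 0"
    and expansion_bwd: "w \<in> \<Omega> \<Longrightarrow>
      (\<lambda>n. c ((\<tau> ^^ n) w) * (1 + c ((\<tau> ^^ n) w)) / expansion \<theta> c n ((\<tau> ^^ n) w)) \<longlonglongrightarrow> 0"
begin

abbreviation T :: "nat \<Rightarrow> 'w \<Rightarrow> 'a \<Rightarrow> 'a" where "T n w \<equiv> blinfun_apply (cocycle \<theta> A n w)"
abbreviation \<Lambda> :: "nat \<Rightarrow> 'w \<Rightarrow> real" where "\<Lambda> \<equiv> expansion \<theta> c"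

lemma fwd_n: "w \<in> \<Omega> \<Longrightarrow> (\<theta> ^^ n) w \<in> \<Omega>" by (induction n) (auto intro: fwd)
lemma bwd_n: "w \<in> \<Omega> \<Longrightarrow> (\<tau> ^^ n) w \<in> \<Omega>" by (induction n) (auto intro: bwd)

lemma \<theta>\<tau>_n: "w \<in> \<Omega> \<Longrightarrow> (\<theta> ^^ n) ((\<tau> ^^ n) w) = w"
proof (induction n)
  case (Suc n)
  have "(\<theta> ^^ Suc n) ((\<tau> ^^ Suc n) w) = (\<theta> ^^ n) (\<theta> (\<tau> ((\<tau> ^^ n) w)))" by (simp add: funpow_swap1)
  then show ?case using Suc bwd_n \<theta>\<tau> by simp
qed simp

lemma k_fwd_n: "w \<in> \<Omega> \<Longrightarrow> k ((\<theta> ^^ n) w) = k w" by (induction n) (auto simp: k_inv fwd_n)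
lemma k_bwd_n: "w \<in> \<Omega> \<Longrightarrow> k ((\<tau> ^^ n) w) = k w"
  using k_fwd_n[OF bwd_n, of w n n] \<theta>\<tau>_n by simp
lemma k_bwd: "w \<in> \<Omega> \<Longrightarrow> k (\<tau> w) = k w" using k_bwd_n[of w 1] by simp

lemma c_pos: "w \<in> \<Omega> \<Longrightarrow> 0 < c w" using c_ge_1 by fastforce

lemma factor_ge_1: "w \<in> \<Omega> \<Longrightarrow> 1 \<le> 1 + 1 / (c w * (1 + c w))" using c_pos[of w] by simp
lemma factor_le_2: assumes "w \<in> \<Omega>" shows "1 + 1 / (c w * (1 + c w)) \<le> 2"
proof -
  have "1 * 1 \<le> c w * (1 + c w)" using c_ge_1[OF assms] by (intro mult_mono) auto
  then show ?thesis by (simp add: field_simps)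
qed

lemma expansion_ge_1: "w \<in> \<Omega> \<Longrightarrow> 1 \<le> \<Lambda> n w"
  unfolding expansion_def by (rule prod_ge_1) (use factor_ge_1 fwd_n in blast)

lemma T_Suc: "T (Suc n) w x = A ((\<theta> ^^ n) w) (T n w x)" by simp

lemma T_add: "T (m + n) w x = T m ((\<theta> ^^ n) w) (T n w x)"
  by (induction m) (simp_all add: funpow_add)

lemma T_Suc_shift: "T (Suc n) w x = T n (\<theta> w) (A w x)"
  using T_add[of n 1 w x] by simp

lemma linear_T: "linear (T n w)" by (rule bounded_linear.linear[OF blinfun.bounded_linear_right])

lemma T_zero_iff: "w \<in> \<Omega> \<Longrightarrow> T n w x = 0 \<longleftrightarrow> x = 0"
proof (induction n)
  case (Suc n)
  have "A ((\<theta> ^^ n) w) y = 0 \<longleftrightarrow> y = 0" for y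
    using inj_A[OF fwd_n[OF Suc.prems, of n]] by (metis blinfun.zero_right injD)
  then show ?case using Suc by simp
qed simp

lemma A_zero_iff: "w \<in> \<Omega> \<Longrightarrow> A w x = 0 \<longleftrightarrow> x = 0" using T_zero_iff[of w 1 x] by simp

lemma inj_T: "w \<in> \<Omega> \<Longrightarrow> inj_on (T n w) V"
  by (rule inj_onI) (metis T_zero_iff blinfun.diff_right right_minus_eq)

lemma T_C: "w \<in> \<Omega> \<Longrightarrow> v \<in> C w \<Longrightarrow> T n w v \<in> C ((\<theta> ^^ n) w)"
  by (induction n) (auto simp: C_map fwd_n)

text \<open>Subspaces that avoid the cone: the candidates for \<open>F\<close> and its
  approximations. They pull back to such subspaces because the maps are injective and preserve
  the cones.\<close>

definition transversal :: "'a set \<Rightarrow> 'w \<Rightarrow> bool" where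
  "transversal N w \<longleftrightarrow> subspace N \<and> N \<inter> C w = {0}"

lemma transversal_vimage:
  assumes "w \<in> \<Omega>" "transversal N ((\<theta> ^^ n) w)"
  shows "transversal (T n w -` N) w"
proof -
  have "subspace (T n w -` N)"
    using assms(2) linear_subspace_vimage[OF linear_T] by (simp add: transversal_def)
  moreover have "x = 0" if "T n w x \<in> N" "x \<in> C w" for x
  proof -
    have "T n w x \<in> {0}" using T_C[OF assms(1) that(2)] that(1) assms(2) unfolding transversal_def by blast
    then show ?thesis using T_zero_iff[OF assms(1)] by simp
  qed
  moreover have "0 \<in> C w"
    using E0_C[OF assms(1)] subspace_0[OF has_dim_subspace[OF dim_E0[OF assms(1)]]] by blast
  ultimately show ?thesis unfolding transversal_def using subspace_0 by blast
qed

lemma transversal_A_vimage: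
  "w \<in> \<Omega> \<Longrightarrow> transversal N (\<theta> w) \<Longrightarrow> transversal (A w -` N) w"
  using transversal_vimage[of w N 1] by (simp add: vimage_def)

text \<open>The cone contains the ball around \<open>A w v\<close> of radius
  \<open>norm (A w v) / c w\<close>, so a point of \<open>N\<close> closer than that lies in
  \<open>N \<inter> C\<close> and is \<open>0\<close>, which is not that close.\<close>

lemma angle:
  assumes "w \<in> \<Omega>" "v \<in> C w" "transversal N (\<theta> w)" "y \<in> N"
  shows "norm (A w v) \<le> c w * norm (A w v - y)"
proof (rule ccontr)
  assume "\<not> ?thesis"
  then have lt: "norm (y - A w v) < norm (A w v) / c w"
    using c_pos[OF assms(1)] by (simp add: field_simps norm_minus_commute)
  then have "A w v + (y - A w v) \<in> C (\<theta> w)" using assms by (intro C_thick) auto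
  then have "y \<in> N \<inter> C (\<theta> w)" using assms by simp
  then have "y = 0" using assms(3) unfolding transversal_def by auto
  then have "norm (A w v) < norm (A w v) / c w" using lt by simp
  then show False using c_ge_1[OF assms(1)] c_pos[OF assms(1)]
    by (simp add: field_simps) (smt (verit) mult_left_mono norm_ge_zero mult.commute mult_cancel_left1)
qed

text \<open>A segment in a cone cannot be long in a transversal direction: the angle estimate at
  the end point \<open>v + t u\<close>, compared with the point \<open>t A u\<close> of
  \<open>N\<close>, bounds its image by that of \<open>v\<close>.\<close>

lemma cone_step_bound:
  assumes w: "w \<in> \<Omega>" and N: "transversal N (\<theta> w)" and u: "A w u \<in> N"
    and v: "v \<in> C w" and x: "v + t *\<^sub>R u \<in> C w"
  shows "\<bar>t\<bar> * norm (A w u) \<le> (1 + c w) * norm (A w v)"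
proof -
  have sN: "subspace N" using N by (simp add: transversal_def)
  have tu: "t *\<^sub>R A w u \<in> N" using sN u by (simp add: subspace_scale)
  have eq: "A w (v + t *\<^sub>R u) = A w v + t *\<^sub>R A w u" by (simp add: blinfun.bilinear_simps)
  have "norm (A w (v + t *\<^sub>R u)) \<le> c w * norm (A w v)"
    using angle[OF w x N tu] unfolding eq by simp
  moreover have "\<bar>t\<bar> * norm (A w u) \<le> norm (A w (v + t *\<^sub>R u)) + norm (A w v)"
    unfolding eq using norm_triangle_ineq4[of "A w v + t *\<^sub>R A w u" "A w v"] by simp
  ultimately show ?thesis by (simp add: algebra_simps)
qed

text \<open>The mechanism of domination. At the end \<open>t'\<close> of the old segment the
  image has norm at least \<open>s norm (A w u) / (1 + c w)\<close>, by the previous lemma with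
  the roles of \<open>v\<close> and the end point exchanged. The ball around it in the next cone
  therefore lets the segment grow by \<open>s / (c w (1 + c w))\<close>.\<close>

lemma cone_step:
  assumes w: "w \<in> \<Omega>" and N: "transversal N (\<theta> w)" and u: "A w u \<in> N" and s: "0 \<le> s"
    and seg: "\<And>t. \<bar>t\<bar> \<le> s \<Longrightarrow> v + t *\<^sub>R u \<in> C w"
    and t: "\<bar>t\<bar> \<le> s * (1 + 1 / (c w * (1 + c w)))"
  shows "A w v + t *\<^sub>R A w u \<in> C (\<theta> w)"
proof (cases "\<bar>t\<bar> \<le> s")
  case True
  then have "A w (v + t *\<^sub>R u) \<in> C (\<theta> w)" using C_map[OF w seg] by blast
  then show ?thesis by (simp add: blinfun.bilinear_simps)
next
  case False
  define t' where "t' = s * sgn t"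
  have tt: "\<bar>t'\<bar> = s" "\<bar>t - t'\<bar> = \<bar>t\<bar> - s"
    using False s by (auto simp: t'_def sgn_if abs_if)
  have inC: "v + t' *\<^sub>R u \<in> C w" using tt s by (intro seg) auto
  have v: "v \<in> C w" using seg[of 0] s by simp
  have cp: "0 < c w" using c_pos[OF w] .
  \<comment> \<open>The segment read from its end point \<open>v + t' u\<close>: the base
    point \<open>v\<close> is reached with parameter \<open>- t'\<close>.\<close>
  have key: "s * norm (A w u) \<le> (1 + c w) * norm (A w (v + t' *\<^sub>R u))"
    using cone_step_bound[OF w N u inC, of "- t'"] v tt by simp
  have "\<bar>t - t'\<bar> \<le> s / (c w * (1 + c w))" using t tt by (simp add: algebra_simps)
  then have "norm ((t - t') *\<^sub>R A w u) \<le> s / (c w * (1 + c w)) * norm (A w u)"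
    unfolding norm_scaleR by (rule mult_right_mono[OF _ norm_ge_zero])
  also have "\<dots> = s * norm (A w u) / (c w * (1 + c w))" by simp
  also have "\<dots> \<le> (1 + c w) * norm (A w (v + t' *\<^sub>R u)) / (c w * (1 + c w))"
    using key cp by (intro divide_right_mono) auto
  also have "\<dots> = norm (A w (v + t' *\<^sub>R u)) / c w"
    using cp mult_divide_mult_cancel_right[of "1 + c w" "norm (A w (v + t' *\<^sub>R u))" "c w"]
    by (simp only: mult.commute)
  finally have "A w (v + t' *\<^sub>R u) + (t - t') *\<^sub>R A w u \<in> C (\<theta> w)" by (rule C_thick[OF w inC])
  then show ?thesis by (simp add: blinfun.bilinear_simps algebra_simps)
qed

lemma cone_growth:
  assumes w: "w \<in> \<Omega>" and s: "0 \<le> s" and seg: "\<And>t. \<bar>t\<bar> \<le> s \<Longrightarrow> v + t *\<^sub>R u \<in> C w"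
  shows "transversal N ((\<theta> ^^ n) w) \<Longrightarrow> T n w u \<in> N \<Longrightarrow> \<bar>t\<bar> \<le> s * \<Lambda> n w \<Longrightarrow>
    T n w v + t *\<^sub>R T n w u \<in> C ((\<theta> ^^ n) w)"
proof (induction n arbitrary: N t)
  case 0
  then show ?case using seg by simp
next
  case (Suc n)
  let ?\<eta> = "(\<theta> ^^ n) w"
  have \<eta>: "?\<eta> \<in> \<Omega>" using w by (rule fwd_n)
  have N: "transversal N (\<theta> ?\<eta>)" using Suc.prems(1) by simp
  have u: "A ?\<eta> (T n w u) \<in> N" using Suc.prems(2) by simp
  have "0 \<le> s * \<Lambda> n w" using s expansion_ge_1[OF w, of n] by simp
  moreover have "T n w v + t *\<^sub>R T n w u \<in> C ?\<eta>" if "\<bar>t\<bar> \<le> s * \<Lambda> n w" for t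
    using Suc.IH[OF transversal_A_vimage[OF \<eta> N]] u that by simp
  ultimately show ?case
    using cone_step[OF \<eta> N u, of "s * \<Lambda> n w" "T n w v" t] Suc.prems(3)
    by (simp add: expansion_Suc mult.assoc)
qed

text \<open>Growth and \<open>cone_step_bound\<close> at the last step together bound
  \<open>T n w u\<close> by \<open>T n w v\<close> with an exponentially good constant. That
  step uses the segment one time unit earlier; the factor \<open>2\<close> replaces the last
  factor of the product.\<close>

lemma cone_growth_bound:
  assumes w: "w \<in> \<Omega>" and s: "0 \<le> s" and seg: "\<And>t. \<bar>t\<bar> \<le> s \<Longrightarrow> v + t *\<^sub>R u \<in> C w"
    and N: "transversal N ((\<theta> ^^ n) w)" and u: "T n w u \<in> N" and n: "0 < n"
  shows "s * \<Lambda> n w * norm (T n w u) \<le> 2 * (1 + c ((\<theta> ^^ (n - 1)) w)) * norm (T n w v)"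
proof -
  obtain m where m: "n = Suc m" using n by (cases n) auto
  let ?\<eta> = "(\<theta> ^^ m) w"
  have \<eta>: "?\<eta> \<in> \<Omega>" using w by (rule fwd_n)
  have N': "transversal N (\<theta> ?\<eta>)" and u': "A ?\<eta> (T m w u) \<in> N" using N u m by simp_all
  have sP: "0 \<le> s * \<Lambda> m w" using s expansion_ge_1[OF w, of m] by simp
  have seg': "T m w v + t *\<^sub>R T m w u \<in> C ?\<eta>" if "\<bar>t\<bar> \<le> s * \<Lambda> m w" for t
    using cone_growth[OF w s seg transversal_A_vimage[OF \<eta> N']] u' that by simp
  have "T m w v \<in> C ?\<eta>" using T_C[OF w seg[of 0]] s by simp
  then have b: "s * \<Lambda> m w * norm (T n w u) \<le> (1 + c ?\<eta>) * norm (T n w v)"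
    using cone_step_bound[OF \<eta> N' u' _ seg'[of "s * \<Lambda> m w"]] sP m by simp
  have "s * \<Lambda> n w * norm (T n w u) \<le> s * (\<Lambda> m w * 2) * norm (T n w u)"
    unfolding m expansion_Suc using s expansion_ge_1[OF w, of m] factor_le_2[OF \<eta>]
    by (intro mult_right_mono mult_left_mono) auto
  also have "\<dots> \<le> 2 * ((1 + c ?\<eta>) * norm (T n w v))" using b by (simp add: mult.commute mult.left_commute)
  finally show ?thesis using m by (simp add: algebra_simps)
qed

section \<open>The complement F\<close>

text \<open>\<open>F\<close> is the limit of the pulled-back subspaces \<open>Fn\<close>, as the
  kernel of the limit of the projections along them onto a fixed complement. The complement is
  taken to be the image of \<open>E0\<close> under one step, not \<open>E0\<close>: vectors in
  the image of a cone are surrounded by a ball of controlled radius in the next cone.\<close>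

definition E1 :: "'w \<Rightarrow> 'a set" where "E1 w = A (\<tau> w) ` E0 (\<tau> w)"
definition Fn :: "nat \<Rightarrow> 'w \<Rightarrow> 'a set" where "Fn n w = T n w -` F0 ((\<theta> ^^ n) w)"
definition proj_n :: "nat \<Rightarrow> 'w \<Rightarrow> 'a \<Rightarrow> 'a" where "proj_n n w = proj_along (E1 w) (Fn n w)"
definition proj_lim :: "'w \<Rightarrow> 'a \<Rightarrow> 'a" where "proj_lim w x = lim (\<lambda>n. proj_n n w x)"
definition F :: "'w \<Rightarrow> 'a set" where "F w = {x. proj_lim w x = 0}"

lemma transversal_F0: "w \<in> \<Omega> \<Longrightarrow> transversal (F0 w) w"
  using codim_F0 F0_C by (auto simp: transversal_def has_codim_def)

lemma transversal_Fn: "w \<in> \<Omega> \<Longrightarrow> transversal (Fn n w) w"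
  unfolding Fn_def by (intro transversal_vimage transversal_F0 fwd_n)

lemma dim_T_image: "w \<in> \<Omega> \<Longrightarrow> has_dim V m \<Longrightarrow> has_dim (T n w ` V) m"
  by (rule has_dim_image[OF _ linear_T inj_T])

lemma dim_E1: "w \<in> \<Omega> \<Longrightarrow> has_dim (E1 w) (k w)"
  unfolding E1_def using dim_T_image[OF bwd dim_E0[OF bwd], of w w 1] by (simp add: k_bwd)

lemma E1_expand: assumes "w \<in> \<Omega>" "e \<in> E1 w" obtains a where "a \<in> C (\<tau> w)" "e = A (\<tau> w) a"
  using assms E0_C[OF bwd] unfolding E1_def by blast

lemma E1_C: "w \<in> \<Omega> \<Longrightarrow> e \<in> E1 w \<Longrightarrow> e \<in> C w"
  using C_map[OF bwd] \<theta>\<tau> by (metis E1_expand)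

lemma subspace_C_inter: "w \<in> \<Omega> \<Longrightarrow> transversal N w \<Longrightarrow> subspace W \<Longrightarrow> W \<subseteq> C w \<Longrightarrow> W \<inter> N = {0}"
  unfolding transversal_def using subspace_0 by blast

text \<open>Pushed forward by \<open>n\<close> steps, \<open>W\<close> still lies in the cone
  and has the dimension complementary to \<open>F0\<close>; the resulting decomposition is
  pulled back.\<close>

lemma Fn_complement:
  assumes w: "w \<in> \<Omega>" and W: "has_dim W (k w)" "W \<subseteq> C w"
  shows "algebraic_splitting W (Fn n w)"
proof -
  let ?\<eta> = "(\<theta> ^^ n) w"
  have \<eta>: "?\<eta> \<in> \<Omega>" using w by (rule fwd_n)
  have dimTW: "has_dim (T n w ` W) (k ?\<eta>)" using dim_T_image[OF w W(1)] k_fwd_n[OF w] by simp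
  have "T n w ` W \<subseteq> C ?\<eta>" using T_C[OF w] W(2) by blast
  then have "T n w ` W \<inter> F0 ?\<eta> = {0}"
    by (rule subspace_C_inter[OF \<eta> transversal_F0[OF \<eta>] has_dim_subspace[OF dimTW]])
  then interpret img: algebraic_splitting "T n w ` W" "F0 ?\<eta>"
    by (rule complement_of_dim[OF codim_F0[OF \<eta>] dimTW])
  show ?thesis
  proof
    show "subspace W" using W(1) by (rule has_dim_subspace)
    then show "W \<inter> Fn n w = {0}" by (rule subspace_C_inter[OF w transversal_Fn[OF w] _ W(2)])
    show "subspace (Fn n w)" using transversal_Fn[OF w] by (simp add: transversal_def)
    fix x
    obtain e f where "e \<in> W" "f \<in> F0 ?\<eta>" "T n w x = T n w e + f" using img.sum by blast
    then have "x - e \<in> Fn n w" by (simp add: Fn_def blinfun.diff_right)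
    then show "\<exists>e\<in>W. \<exists>f\<in>Fn n w. x = e + f" using \<open>e \<in> W\<close> by force
  qed
qed

lemma splitting_n: "w \<in> \<Omega> \<Longrightarrow> algebraic_splitting (E1 w) (Fn n w)"
  using Fn_complement dim_E1 E1_C by blast

text \<open>The angle between the range and the kernel bounds the norm of a projection. This is
  the only source of norm bounds for the approximating projections, and it makes their limits
  tempered.\<close>

lemma proj_bound:
  assumes w: "w \<in> \<Omega>" and N: "transversal N w" and sp: "algebraic_splitting W N"
    and W: "W \<subseteq> A (\<tau> w) ` C (\<tau> w)"
  shows "norm (proj_along W N x) \<le> c (\<tau> w) * norm x"
proof -
  interpret algebraic_splitting W N by fact
  obtain v where v: "v \<in> C (\<tau> w)" "proj_along W N x = A (\<tau> w) v" using proj_mem W by blast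
  have "- (x - proj_along W N x) \<in> N" using proj_compl subspace_neg[OF subspace_F] by blast
  then have "norm (A (\<tau> w) v) \<le> c (\<tau> w) * norm (A (\<tau> w) v - - (x - proj_along W N x))"
    using N \<theta>\<tau>[OF w] by (intro angle[OF bwd[OF w] v(1)]) simp_all
  then show ?thesis using v by simp
qed

lemma proj_n_bound: "w \<in> \<Omega> \<Longrightarrow> norm (proj_n n w x) \<le> c (\<tau> w) * norm x"
  unfolding proj_n_def using E0_C[OF bwd]
  by (intro proj_bound transversal_Fn splitting_n) (auto simp: E1_def)

lemma C_thick_bwd:
  assumes "w \<in> \<Omega>" "a \<in> C (\<tau> w)" "e = A (\<tau> w) a" "norm h \<le> norm e / c (\<tau> w)"
  shows "e + h \<in> C w"
  using C_thick[OF bwd[OF assms(1)] assms(2), of h] assms \<theta>\<tau> by simp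

text \<open>If \<open>u \<in> Fn n w\<close> had a large component \<open>e\<close> in
  \<open>E1\<close> along \<open>Fn m\<close>, then the segment through \<open>e\<close> in
  direction \<open>u\<close> would have grown after \<open>n\<close> steps until it contains the
  image of \<open>e - u\<close>. But \<open>e - u\<close> lies in \<open>Fn m w\<close>, so its
  image avoids the cone.\<close>

lemma proj_n_contract:
  assumes w: "w \<in> \<Omega>" and u: "u \<in> Fn n w" and mn: "n \<le> m"
  shows "norm (proj_n m w u) \<le> c (\<tau> w) / \<Lambda> n w * norm u"
proof (cases "u = 0")
  case True
  then show ?thesis using linear_0[OF algebraic_splitting.linear_proj[OF splitting_n[OF w]]] by (simp add: proj_n_def)
next
  case False
  interpret m: algebraic_splitting "E1 w" "Fn m w" using w by (rule splitting_n)
  define e where "e = proj_n m w u"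
  define f where "f = u - e"
  have e: "e \<in> E1 w" and f: "f \<in> Fn m w"
    using m.proj_mem m.proj_compl by (auto simp: e_def f_def proj_n_def)
  obtain a where a: "a \<in> C (\<tau> w)" "e = A (\<tau> w) a" using E1_expand[OF w e] .
  have cp: "0 < c (\<tau> w)" using c_pos[OF bwd[OF w]] .
  have Lp: "0 < \<Lambda> n w" using expansion_ge_1[OF w, of n] by simp
  define s where "s = norm e / (c (\<tau> w) * norm u)"
  have s: "0 \<le> s" using cp by (simp add: s_def)
  have seg: "e + t *\<^sub>R u \<in> C w" if "\<bar>t\<bar> \<le> s" for t
  proof (rule C_thick_bwd[OF w a])
    have "norm (t *\<^sub>R u) \<le> s * norm u" using that by (simp add: mult_right_mono)
    then show "norm (t *\<^sub>R u) \<le> norm e / c (\<tau> w)" using False by (simp add: s_def)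
  qed
  have "e = 0" if large: "1 \<le> s * \<Lambda> n w"
  proof -
    let ?\<eta> = "(\<theta> ^^ n) w"
    have \<eta>: "?\<eta> \<in> \<Omega>" using w by (rule fwd_n)
    have "T n w e + (- 1) *\<^sub>R T n w u \<in> C ?\<eta>"
      using u large by (intro cone_growth[OF w s seg transversal_F0[OF \<eta>]]) (auto simp: Fn_def)
    then have "(- 1) *\<^sub>R (T n w e + (- 1) *\<^sub>R T n w u) \<in> C ?\<eta>" by (rule C_scale[OF \<eta>])
    then have "T n w f \<in> C ?\<eta>" by (simp add: f_def blinfun.diff_right)
    moreover have "T (m - n + n) w f \<in> F0 ((\<theta> ^^ (m - n + n)) w)" using f mn by (simp add: Fn_def)
    then have "T n w f \<in> Fn (m - n) ?\<eta>" unfolding T_add by (simp add: Fn_def funpow_add)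
    ultimately have "T n w f = 0" using transversal_Fn[OF \<eta>, of "m - n"] unfolding transversal_def by blast
    then have "f = 0" using T_zero_iff[OF w] by simp
    then have "e = u" by (simp add: f_def)
    then have "u \<in> E1 w \<inter> Fn n w" using e u by simp
    then show "e = 0" using algebraic_splitting.inter[OF splitting_n[OF w, of n]] \<open>e = u\<close> by simp
  qed
  moreover have "norm e \<le> c (\<tau> w) / \<Lambda> n w * norm u" if "s * \<Lambda> n w < 1"
    using that cp Lp False by (simp add: s_def field_simps)
  moreover have "0 \<le> c (\<tau> w) / \<Lambda> n w * norm u" using cp Lp by simp
  ultimately show ?thesis unfolding e_def[symmetric] by (cases "1 \<le> s * \<Lambda> n w") auto
qed

lemma proj_n_fix: "w \<in> \<Omega> \<Longrightarrow> e \<in> E1 w \<Longrightarrow> proj_n n w e = e"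
  unfolding proj_n_def by (rule algebraic_splitting.proj_fix[OF splitting_n])

lemma proj_n_mem: "w \<in> \<Omega> \<Longrightarrow> proj_n n w x \<in> E1 w"
  unfolding proj_n_def by (rule algebraic_splitting.proj_mem[OF splitting_n])

lemma proj_n_compl: "w \<in> \<Omega> \<Longrightarrow> x - proj_n n w x \<in> Fn n w"
  unfolding proj_n_def by (rule algebraic_splitting.proj_compl[OF splitting_n])

lemma linear_proj_n: "w \<in> \<Omega> \<Longrightarrow> linear (proj_n n w)"
  unfolding proj_n_def by (rule algebraic_splitting.linear_proj[OF splitting_n])

text \<open>Both projections have range \<open>E1\<close>, so their difference is the later one
  applied to a vector in the kernel of the earlier one.\<close>

lemma proj_n_diff:
  assumes w: "w \<in> \<Omega>" and mn: "n \<le> m"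
  shows "norm (proj_n m w x - proj_n n w x) \<le> c (\<tau> w) * (1 + c (\<tau> w)) * (1 / \<Lambda> n w) * norm x"
proof -
  let ?u = "x - proj_n n w x"
  have cp: "0 < c (\<tau> w)" using c_pos[OF bwd[OF w]] .
  have Lp: "0 < \<Lambda> n w" using expansion_ge_1[OF w, of n] by simp
  have "proj_n m w x - proj_n n w x = proj_n m w ?u"
    using linear_diff[OF linear_proj_n[OF w]] proj_n_fix[OF w proj_n_mem[OF w]] by simp
  also have "norm \<dots> \<le> c (\<tau> w) / \<Lambda> n w * norm ?u" by (rule proj_n_contract[OF w proj_n_compl[OF w] mn])
  also have "norm ?u \<le> norm x + c (\<tau> w) * norm x"
    using norm_triangle_ineq4[of x "proj_n n w x"] proj_n_bound[OF w, of n x] by linarith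
  then have "c (\<tau> w) / \<Lambda> n w * norm ?u \<le> c (\<tau> w) / \<Lambda> n w * (norm x + c (\<tau> w) * norm x)"
    using cp Lp by (intro mult_left_mono) auto
  also have "\<dots> = c (\<tau> w) * (1 + c (\<tau> w)) * (1 / \<Lambda> n w) * norm x" by (simp add: field_simps)
  finally show ?thesis .
qed

lemma proj_n_error_tendsto: "w \<in> \<Omega> \<Longrightarrow> (\<lambda>n. c (\<tau> w) * (1 + c (\<tau> w)) * (1 / \<Lambda> n w)) \<longlonglongrightarrow> 0"
  by (rule tendsto_mult_right_zero[OF expansion_fwd])

lemma proj_lim: "w \<in> \<Omega> \<Longrightarrow> (\<lambda>n. proj_n n w x) \<longlonglongrightarrow> proj_lim w x"
  unfolding proj_lim_def
  by (rule uniform_limit_of_operators[OF proj_n_diff proj_n_error_tendsto])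

lemma linear_proj_lim: "w \<in> \<Omega> \<Longrightarrow> linear (proj_lim w)"
  by (rule linear_limit[OF linear_proj_n proj_lim])

lemma proj_lim_bound: "w \<in> \<Omega> \<Longrightarrow> norm (proj_lim w x) \<le> c (\<tau> w) * norm x"
  by (rule LIMSEQ_le_const2[OF tendsto_norm[OF proj_lim]]) (auto intro: proj_n_bound)

lemma bounded_linear_proj_lim: "w \<in> \<Omega> \<Longrightarrow> bounded_linear (proj_lim w)"
  using proj_lim_bound linear_proj_lim
  by (intro bounded_linear_intro[where K = "c (\<tau> w)"]) (auto simp: linear_add linear_scale mult.commute)

lemma proj_lim_fix: "w \<in> \<Omega> \<Longrightarrow> e \<in> E1 w \<Longrightarrow> proj_lim w e = e"
  using proj_lim[of w e] by (simp add: proj_n_fix LIMSEQ_const_iff)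

lemma proj_lim_mem: "w \<in> \<Omega> \<Longrightarrow> proj_lim w x \<in> E1 w"
  using closed_sequentially[OF closed_has_dim[OF dim_E1] proj_n_mem proj_lim] .

lemma F_subspace: "w \<in> \<Omega> \<Longrightarrow> subspace (F w)"
  unfolding F_def by (rule linear_subspace_kernel[OF linear_proj_lim])

lemma closed_F: "w \<in> \<Omega> \<Longrightarrow> closed (F w)"
  unfolding F_def
  by (intro closed_Collect_eq continuous_on_const linear_continuous_on bounded_linear_proj_lim)

text \<open>Approximants of \<open>u\<close> in \<open>Fn (Suc n) w\<close> are mapped into
  \<open>Fn n (\<theta> w)\<close>; the projections there are uniformly bounded, so the limit
  passes through.\<close>

lemma F_map:
  assumes w: "w \<in> \<Omega>" and u: "u \<in> F w"
  shows "A w u \<in> F (\<theta> w)"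
proof -
  define un where "un n = u - proj_n (Suc n) w u" for n
  have "(\<lambda>n. proj_n (Suc n) w u) \<longlonglongrightarrow> 0"
    using LIMSEQ_Suc[OF proj_lim[OF w, of u]] u by (simp add: F_def)
  then have "(\<lambda>n. A w (proj_n (Suc n) w u)) \<longlonglongrightarrow> A w 0" by (intro tendsto_intros)
  then have lim: "(\<lambda>n. c w * norm (A w (proj_n (Suc n) w u))) \<longlonglongrightarrow> 0"
    by (intro tendsto_mult_right_zero tendsto_norm_zero) simp
  have "norm (proj_n n (\<theta> w) (A w u)) \<le> c w * norm (A w (proj_n (Suc n) w u))" for n
  proof -
    have "un n \<in> Fn (Suc n) w" unfolding un_def by (rule proj_n_compl[OF w])
    then have "A w (un n) \<in> Fn n (\<theta> w)" unfolding Fn_def vimage_def mem_Collect_eq T_Suc_shift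
      by (simp add: funpow_swap1)
    then have "proj_n n (\<theta> w) (A w (un n)) = 0"
      unfolding proj_n_def using algebraic_splitting.proj_zero_iff[OF splitting_n[OF fwd[OF w]]] by blast
    then have "proj_n n (\<theta> w) (A w u) = proj_n n (\<theta> w) (A w (proj_n (Suc n) w u))"
      by (simp add: un_def blinfun.diff_right linear_diff[OF linear_proj_n[OF fwd[OF w]]])
    then show ?thesis using proj_n_bound[OF fwd[OF w]] by (simp add: \<tau>\<theta>[OF w])
  qed
  then have "(\<lambda>n. proj_n n (\<theta> w) (A w u)) \<longlonglongrightarrow> 0"
    by (intro Lim_null_comparison[OF always_eventually lim]) blast
  then show ?thesis unfolding F_def using LIMSEQ_unique[OF proj_lim[OF fwd[OF w]]] by blast
qed

text \<open>A limit of subspaces avoiding a closed cone could touch the cone. One step rules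
  this out: the angle estimate for \<open>A w u\<close> holds against every approximating
  subspace.\<close>

lemma F_C: assumes w: "w \<in> \<Omega>" shows "transversal (F w) w"
proof -
  have "u = 0" if u: "u \<in> F w" "u \<in> C w" for u
  proof -
    have le: "norm (A w u) \<le> c w * norm (A w (proj_n (Suc n) w u))" for n
    proof -
      have "u - proj_n (Suc n) w u \<in> Fn (Suc n) w" by (rule proj_n_compl[OF w])
      then have "A w (u - proj_n (Suc n) w u) \<in> Fn n (\<theta> w)"
        unfolding Fn_def vimage_def mem_Collect_eq T_Suc_shift by (simp add: funpow_swap1)
      then show ?thesis
        using angle[OF w u(2) transversal_Fn[OF fwd[OF w]]] by (fastforce simp: blinfun.diff_right)
    qed
    have "(\<lambda>n. proj_n (Suc n) w u) \<longlonglongrightarrow> 0"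
      using LIMSEQ_Suc[OF proj_lim[OF w, of u]] u by (simp add: F_def)
    then have "(\<lambda>n. A w (proj_n (Suc n) w u)) \<longlonglongrightarrow> A w 0" by (intro tendsto_intros)
    then have lim: "(\<lambda>n. c w * norm (A w (proj_n (Suc n) w u))) \<longlonglongrightarrow> 0"
      by (intro tendsto_mult_right_zero tendsto_norm_zero) simp
    have "norm (A w u) \<le> 0" by (rule LIMSEQ_le_const[OF lim]) (use le in blast)
    then show ?thesis using A_zero_iff[OF w] by simp
  qed
  moreover have "0 \<in> C w" using transversal_F0[OF w] unfolding transversal_def by blast
  ultimately show ?thesis
    unfolding transversal_def using F_subspace[OF w] subspace_0 by blast
qed

lemma splitting_E1_F: assumes w: "w \<in> \<Omega>" shows "algebraic_splitting (E1 w) (F w)"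
proof
  show "subspace (E1 w)" by (rule has_dim_subspace[OF dim_E1[OF w]])
  then show "E1 w \<inter> F w = {0}" using E1_C[OF w] by (intro subspace_C_inter[OF w F_C[OF w]]) auto
  show "subspace (F w)" by (rule F_subspace[OF w])
  fix x
  have "x - proj_lim w x \<in> F w"
    unfolding F_def using linear_diff[OF linear_proj_lim[OF w]] proj_lim_fix[OF w proj_lim_mem[OF w]] by simp
  then show "\<exists>e\<in>E1 w. \<exists>f\<in>F w. x = e + f" using proj_lim_mem[OF w, of x] by force
qed

lemma codim_F: "w \<in> \<Omega> \<Longrightarrow> has_codim (F w) (k w)"
  by (rule splitting_has_codim[OF splitting_E1_F dim_E1])

lemma F_complement:
  assumes "w \<in> \<Omega>" "has_dim W (k w)" "W \<subseteq> C w"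
  shows "algebraic_splitting W (F w)"
  by (rule complement_of_dim[OF codim_F[OF assms(1)] assms(2)
      subspace_C_inter[OF assms(1) F_C[OF assms(1)] has_dim_subspace[OF assms(2)] assms(3)]])

text \<open>Otherwise a nonzero vector of \<open>E1\<close> would be mapped into
  \<open>F\<close>, although its image stays in the cone.\<close>

lemma F_vimage: assumes w: "w \<in> \<Omega>" and b: "A w b \<in> F (\<theta> w)" shows "b \<in> F w"
proof -
  interpret algebraic_splitting "E1 w" "F w" using w by (rule splitting_E1_F)
  obtain e f where ef: "e \<in> E1 w" "f \<in> F w" "b = e + f" using sum by blast
  then have "A w e = A w b - A w f" by (simp add: blinfun.add_right)
  then have "A w e \<in> F (\<theta> w)"
    using b F_map[OF w ef(2)] subspace_diff[OF F_subspace[OF fwd[OF w]]] by simp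
  moreover have "A w e \<in> C (\<theta> w)" by (rule C_map[OF w E1_C[OF w ef(1)]])
  ultimately have "A w e = 0" using F_C[OF fwd[OF w]] unfolding transversal_def by blast
  then show ?thesis using A_zero_iff[OF w] ef by simp
qed

lemma F_map_n: "w \<in> \<Omega> \<Longrightarrow> u \<in> F w \<Longrightarrow> T n w u \<in> F ((\<theta> ^^ n) w)"
  by (induction n) (auto simp: F_map fwd_n)

lemma F_vimage_n: "w \<in> \<Omega> \<Longrightarrow> T n w b \<in> F ((\<theta> ^^ n) w) \<Longrightarrow> b \<in> F w"
  by (induction n) (auto dest: F_vimage[OF fwd_n])

section \<open>The subspace E and domination\<close>

text \<open>\<open>E\<close> is the limit of the subspaces \<open>En\<close> pushed forward from
  the past, as the range of the limit of the projections onto them along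
  \<open>F\<close>.\<close>

definition En :: "nat \<Rightarrow> 'w \<Rightarrow> 'a set" where "En n w = T n ((\<tau> ^^ n) w) ` E0 ((\<tau> ^^ n) w)"
definition Qn :: "nat \<Rightarrow> 'w \<Rightarrow> 'a \<Rightarrow> 'a" where "Qn n w = proj_along (En n w) (F w)"
definition Q :: "'w \<Rightarrow> 'a \<Rightarrow> 'a" where "Q w x = lim (\<lambda>n. Qn n w x)"
definition E :: "'w \<Rightarrow> 'a set" where "E w = range (Q w)"

lemma dim_En: assumes "w \<in> \<Omega>" shows "has_dim (En n w) (k w)"
  unfolding En_def k_bwd_n[OF assms, of n, symmetric]
  by (rule dim_T_image[OF bwd_n[OF assms] dim_E0[OF bwd_n[OF assms]]])

lemma En_C: assumes "w \<in> \<Omega>" shows "En n w \<subseteq> C w"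
proof -
  have "T n ((\<tau> ^^ n) w) a \<in> C ((\<theta> ^^ n) ((\<tau> ^^ n) w))" if "a \<in> E0 ((\<tau> ^^ n) w)" for a
    using that E0_C[OF bwd_n[OF assms]] by (intro T_C[OF bwd_n[OF assms]]) blast
  then show ?thesis unfolding En_def \<theta>\<tau>_n[OF assms] by blast
qed

lemma En_Suc: "w \<in> \<Omega> \<Longrightarrow> En (Suc n) w = A (\<tau> w) ` En n (\<tau> w)"
proof -
  assume w: "w \<in> \<Omega>"
  have eq: "(\<tau> ^^ Suc n) w = (\<tau> ^^ n) (\<tau> w)" by (simp add: funpow_swap1)
  show ?thesis unfolding En_def eq image_image T_Suc \<theta>\<tau>_n[OF bwd[OF w]] ..
qed

lemma En_expand: "w \<in> \<Omega> \<Longrightarrow> 0 < n \<Longrightarrow> En n w \<subseteq> A (\<tau> w) ` C (\<tau> w)"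
  by (cases n) (simp_all add: En_Suc En_C[OF bwd] image_mono)

lemma splitting_En: "w \<in> \<Omega> \<Longrightarrow> algebraic_splitting (En n w) (F w)"
  by (intro F_complement dim_En En_C)

lemma Qn_bound: "w \<in> \<Omega> \<Longrightarrow> 0 < n \<Longrightarrow> norm (Qn n w x) \<le> c (\<tau> w) * norm x"
  unfolding Qn_def by (intro proj_bound F_C splitting_En En_expand)

lemma linear_Qn: "w \<in> \<Omega> \<Longrightarrow> linear (Qn n w)"
  unfolding Qn_def by (rule algebraic_splitting.linear_proj[OF splitting_En])

lemma Qn_mem: "w \<in> \<Omega> \<Longrightarrow> Qn n w x \<in> En n w"
  unfolding Qn_def by (rule algebraic_splitting.proj_mem[OF splitting_En])

lemma Qn_compl: "w \<in> \<Omega> \<Longrightarrow> x - Qn n w x \<in> F w"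
  unfolding Qn_def by (rule algebraic_splitting.proj_compl[OF splitting_En])

lemma Qn_unique: "w \<in> \<Omega> \<Longrightarrow> e \<in> En n w \<Longrightarrow> x - e \<in> F w \<Longrightarrow> Qn n w x = e"
  unfolding Qn_def by (rule algebraic_splitting.proj_unique[OF splitting_En])

lemma Qn_F: "w \<in> \<Omega> \<Longrightarrow> x \<in> F w \<Longrightarrow> Qn n w x = 0"
  unfolding Qn_def using algebraic_splitting.proj_zero_iff[OF splitting_En] by blast

text \<open>Two vectors of a cone whose difference lies in \<open>F\<close> become close
  relative to their size. The first step replaces the unknown length of the initial segment: by
  the angle estimate, the image of the difference is at most \<open>1 + c\<close> times the
  image of \<open>a\<close>, hence a segment of length \<open>1 / (c (1 + c))\<close> fits. The
  remaining steps let it grow.\<close>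

lemma cone_pair_contraction:
  assumes \<eta>: "\<eta> \<in> \<Omega>" and a: "a \<in> C \<eta>" "a' \<in> C \<eta>" and b: "a - a' \<in> F \<eta>" and n: "0 < n"
  shows "norm (T n \<eta> (a - a')) \<le>
    4 * c \<eta> * (1 + c \<eta>) * (1 + c ((\<theta> ^^ (n - 1)) \<eta>)) / \<Lambda> n \<eta> * norm (T n \<eta> a)"
proof -
  obtain m where m: "n = Suc m" using n by (cases n) auto
  let ?b = "a - a'"
  have cp: "0 < c \<eta>" using c_pos[OF \<eta>] .
  have \<theta>\<eta>: "\<theta> \<eta> \<in> \<Omega>" using fwd[OF \<eta>] .
  have Ab: "A \<eta> ?b \<in> F (\<theta> \<eta>)" using F_map[OF \<eta> b] .
  have nb: "- A \<eta> ?b \<in> F (\<theta> \<eta>)" using Ab F_subspace[OF \<theta>\<eta>] subspace_neg by blast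
  have "norm (A \<eta> a') \<le> c \<eta> * norm (A \<eta> a' - - A \<eta> ?b)"
    by (rule angle[OF \<eta> a(2) F_C[OF \<theta>\<eta>] nb])
  then have "norm (A \<eta> a') \<le> c \<eta> * norm (A \<eta> a)" by (simp add: blinfun.diff_right)
  moreover have "norm (A \<eta> ?b) \<le> norm (A \<eta> a) + norm (A \<eta> a')"
    unfolding blinfun.diff_right by (rule norm_triangle_ineq4)
  ultimately have base: "norm (A \<eta> ?b) \<le> (1 + c \<eta>) * norm (A \<eta> a)" by (simp add: algebra_simps)
  define s where "s = 1 / (c \<eta> * (1 + c \<eta>))"
  have s: "0 < s" using cp by (simp add: s_def)
  have seg: "A \<eta> a + t *\<^sub>R A \<eta> ?b \<in> C (\<theta> \<eta>)" if t: "\<bar>t\<bar> \<le> s" for t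
  proof (rule C_thick[OF \<eta> a(1)])
    have "norm (t *\<^sub>R A \<eta> ?b) \<le> s * ((1 + c \<eta>) * norm (A \<eta> a))"
      unfolding norm_scaleR using t base s by (intro mult_mono) auto
    also have "\<dots> = norm (A \<eta> a) / c \<eta>"
    proof -
      have "(1 + c \<eta>) / (c \<eta> * (1 + c \<eta>)) = 1 / c \<eta>" using cp by simp
      then show ?thesis by (simp add: s_def flip: mult.assoc)
    qed
    finally show "norm (t *\<^sub>R A \<eta> ?b) \<le> norm (A \<eta> a) / c \<eta>" .
  qed
  have Lm: "0 < \<Lambda> m (\<theta> \<eta>)" "0 < \<Lambda> n \<eta>"
    using expansion_ge_1[OF \<theta>\<eta>, of m] expansion_ge_1[OF \<eta>, of n] by simp_all
  have cm: "0 < c ((\<theta> ^^ m) \<eta>)" using c_pos[OF fwd_n[OF \<eta>]] .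
  have fin: "s * \<Lambda> m (\<theta> \<eta>) * norm (T n \<eta> ?b) \<le> 2 * (1 + c ((\<theta> ^^ m) \<eta>)) * norm (T n \<eta> a)"
  proof (cases m)
    case 0
    have "s * norm (A \<eta> ?b) \<le> 1 * ((1 + c \<eta>) * norm (A \<eta> a))"
    proof (rule mult_mono[OF _ base])
      have "1 * 1 \<le> c \<eta> * (1 + c \<eta>)" using c_ge_1[OF \<eta>] by (intro mult_mono) auto
      then show "s \<le> 1" by (simp add: s_def)
    qed auto
    moreover have "0 \<le> (1 + c \<eta>) * norm (A \<eta> a)" using cp by simp
    ultimately have "s * norm (A \<eta> ?b) \<le> 2 * ((1 + c \<eta>) * norm (A \<eta> a))" by linarith
    then show ?thesis by (simp add: 0 m algebra_simps)
  next
    case (Suc j)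
    have "(\<theta> ^^ (m - 1)) (\<theta> \<eta>) = (\<theta> ^^ m) \<eta>" using Suc by (simp add: funpow_swap1)
    then show ?thesis
      using cone_growth_bound[OF \<theta>\<eta> less_imp_le[OF s] seg F_C[OF fwd_n[OF \<theta>\<eta>]] F_map_n[OF \<theta>\<eta> Ab], of m] Suc
      unfolding m T_Suc_shift by simp
  qed
  have "\<Lambda> n \<eta> \<le> 2 * \<Lambda> m (\<theta> \<eta>)"
    unfolding m expansion_Suc_shift using factor_le_2[OF \<eta>] Lm by (intro mult_right_mono) auto
  then have "\<Lambda> n \<eta> * (s * norm (T n \<eta> ?b)) \<le> 2 * \<Lambda> m (\<theta> \<eta>) * (s * norm (T n \<eta> ?b))"
    using s by (intro mult_right_mono) auto
  also have "\<dots> \<le> 4 * (1 + c ((\<theta> ^^ m) \<eta>)) * norm (T n \<eta> a)" using fin by (simp add: algebra_simps)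
  finally have "\<Lambda> n \<eta> * (s * norm (T n \<eta> ?b)) \<le> 4 * (1 + c ((\<theta> ^^ m) \<eta>)) * norm (T n \<eta> a)" .
  then have "norm (T n \<eta> ?b) \<le> 4 * (1 + c ((\<theta> ^^ m) \<eta>)) * norm (T n \<eta> a) / (\<Lambda> n \<eta> * s)"
    using Lm s by (subst pos_le_divide_eq) (auto simp: mult_ac)
  also have "\<dots> = 4 * c \<eta> * (1 + c \<eta>) * (1 + c ((\<theta> ^^ (n - 1)) \<eta>)) / \<Lambda> n \<eta> * norm (T n \<eta> a)"
    using cp by (simp add: s_def m field_simps)
  finally show ?thesis .
qed

text \<open>The factor \<open>1 + c (\<tau> w)\<close> comes from the last of the
  \<open>n\<close> steps, \<open>c (\<tau> w)\<close> from the norm of \<open>Qn n w\<close>,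
  and the values of \<open>c\<close> at the point \<open>n\<close> steps in the past from the
  first step.\<close>

definition Qn_error :: "nat \<Rightarrow> 'w \<Rightarrow> real" where
  "Qn_error n w = 4 * (1 + c (\<tau> w)) * c (\<tau> w)
     * (c ((\<tau> ^^ n) w) * (1 + c ((\<tau> ^^ n) w)) / \<Lambda> n ((\<tau> ^^ n) w))"

lemma Qn_error_tendsto: "w \<in> \<Omega> \<Longrightarrow> (\<lambda>n. Qn_error n w) \<longlonglongrightarrow> 0"
  unfolding Qn_error_def by (rule tendsto_mult_right_zero[OF expansion_bwd])

text \<open>Both images are push-forwards, over \<open>n\<close> steps, of cone vectors at the
  point \<open>n\<close> steps in the past; those vectors differ by an element of
  \<open>F\<close>, since \<open>F\<close> is invariant under preimages.\<close>

lemma Qn_diff: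
  assumes w: "w \<in> \<Omega>" and n: "1 \<le> n" "n \<le> m"
  shows "norm (Qn m w x - Qn n w x) \<le> Qn_error n w * norm x"
proof -
  let ?\<eta> = "(\<tau> ^^ n) w"
  have \<eta>: "?\<eta> \<in> \<Omega>" using w by (rule bwd_n)
  have \<theta>\<eta>: "(\<theta> ^^ n) ?\<eta> = w" using w by (rule \<theta>\<tau>_n)
  have last: "(\<theta> ^^ (n - 1)) ?\<eta> = \<tau> w"
    using n(1) \<theta>\<tau>_n[OF bwd[OF w], of "n - 1"] by (cases n) (simp_all add: funpow_swap1)
  obtain j where j: "m = n + j" using n(2) le_iff_add by blast
  obtain a where a: "a \<in> E0 ?\<eta>" "Qn n w x = T n ?\<eta> a" using Qn_mem[OF w, of n x] by (auto simp: En_def)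
  obtain a'' where a'': "a'' \<in> E0 ((\<tau> ^^ m) w)" "Qn m w x = T m ((\<tau> ^^ m) w) a''"
    using Qn_mem[OF w, of m x] by (auto simp: En_def)
  have \<tau>m: "(\<tau> ^^ m) w = (\<tau> ^^ j) ?\<eta>" by (metis add.commute comp_apply funpow_add j)
  define a' where "a' = T j ((\<tau> ^^ j) ?\<eta>) a''"
  have "a'' \<in> C ((\<tau> ^^ j) ?\<eta>)" using a'' E0_C[OF bwd_n[OF \<eta>]] \<tau>m by auto
  then have "T j ((\<tau> ^^ j) ?\<eta>) a'' \<in> C ((\<theta> ^^ j) ((\<tau> ^^ j) ?\<eta>))" by (rule T_C[OF bwd_n[OF \<eta>]])
  then have a'C: "a' \<in> C ?\<eta>" unfolding a'_def \<theta>\<tau>_n[OF \<eta>] .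
  have Qm: "Qn m w x = T n ?\<eta> a'"
    unfolding a''(2) \<tau>m unfolding a'_def j T_add \<theta>\<tau>_n[OF \<eta>] ..
  have aC: "a \<in> C ?\<eta>" using a E0_C[OF \<eta>] by blast
  have diff: "T n ?\<eta> (a - a') = Qn n w x - Qn m w x" unfolding a(2) Qm by (simp add: blinfun.diff_right)
  also have "\<dots> = (x - Qn m w x) - (x - Qn n w x)" by simp
  finally have "T n ?\<eta> (a - a') \<in> F w"
    using subspace_diff[OF F_subspace[OF w] Qn_compl[OF w, of x m] Qn_compl[OF w, of x n]] by simp
  then have "a - a' \<in> F ?\<eta>" using F_vimage_n[OF \<eta>, of n] \<theta>\<eta> by simp
  then have "norm (T n ?\<eta> (a - a')) \<le>
    4 * c ?\<eta> * (1 + c ?\<eta>) * (1 + c (\<tau> w)) / \<Lambda> n ?\<eta> * norm (T n ?\<eta> a)"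
    using cone_pair_contraction[OF \<eta> aC a'C, of n] n(1) unfolding last by simp
  also have "\<dots> \<le> 4 * c ?\<eta> * (1 + c ?\<eta>) * (1 + c (\<tau> w)) / \<Lambda> n ?\<eta> * (c (\<tau> w) * norm x)"
    unfolding a(2)[symmetric] using Qn_bound[OF w, of n x] n(1) c_pos[OF \<eta>] c_pos[OF bwd[OF w]] expansion_ge_1[OF \<eta>, of n]
    by (intro mult_left_mono) auto
  also have "\<dots> = Qn_error n w * norm x" by (simp add: Qn_error_def)
  finally show ?thesis unfolding diff by (simp add: norm_minus_commute)
qed

lemma Q_lim: "w \<in> \<Omega> \<Longrightarrow> (\<lambda>n. Qn n w x) \<longlonglongrightarrow> Q w x"
  unfolding Q_def by (rule uniform_limit_of_operators[OF Qn_diff Qn_error_tendsto])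

lemma linear_Q: "w \<in> \<Omega> \<Longrightarrow> linear (Q w)"
  by (rule linear_limit[OF linear_Qn Q_lim])

lemma Q_bound: "w \<in> \<Omega> \<Longrightarrow> norm (Q w x) \<le> c (\<tau> w) * norm x"
  by (rule LIMSEQ_le_const2[OF tendsto_norm[OF Q_lim]]) (auto intro!: Qn_bound exI[of _ 1])

lemma Q_compl: "w \<in> \<Omega> \<Longrightarrow> x - Q w x \<in> F w"
  by (rule closed_sequentially[OF closed_F Qn_compl tendsto_diff[OF tendsto_const Q_lim]])

lemma Q_F: "w \<in> \<Omega> \<Longrightarrow> x \<in> F w \<Longrightarrow> Q w x = 0"
  using Q_lim[of w x] by (simp add: Qn_F LIMSEQ_const_iff)

lemma Q_C: "w \<in> \<Omega> \<Longrightarrow> Q w x \<in> C w"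
  using closed_sequentially[OF closed_C _ Q_lim] Qn_mem En_C by blast

lemma Q_idem: assumes "w \<in> \<Omega>" shows "Q w (Q w x) = Q w x"
  using Q_F[OF assms Q_compl[OF assms], of x] linear_diff[OF linear_Q[OF assms]] by simp

lemma Q_A: assumes w: "w \<in> \<Omega>" shows "A w (Q w x) = Q (\<theta> w) (A w x)"
proof -
  have "Qn (Suc n) (\<theta> w) (A w x) = A w (Qn n w x)" for n
  proof (rule Qn_unique[OF fwd[OF w]])
    show "A w (Qn n w x) \<in> En (Suc n) (\<theta> w)"
      using Qn_mem[OF w] by (simp add: En_Suc[OF fwd[OF w]] \<tau>\<theta>[OF w])
    show "A w x - A w (Qn n w x) \<in> F (\<theta> w)"
      using F_map[OF w Qn_compl[OF w]] by (simp add: blinfun.diff_right)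
  qed
  moreover have "(\<lambda>n. A w (Qn n w x)) \<longlonglongrightarrow> A w (Q w x)" by (intro tendsto_intros Q_lim w)
  ultimately show ?thesis
    using LIMSEQ_unique LIMSEQ_Suc[OF Q_lim[OF fwd[OF w], of "A w x"]] by simp
qed

lemma splitting_E_F: assumes w: "w \<in> \<Omega>" shows "algebraic_splitting (E w) (F w)"
proof
  show sE: "subspace (E w)" unfolding E_def by (intro linear_subspace_image linear_Q w) simp
  show "E w \<inter> F w = {0}"
    using Q_C[OF w] by (intro subspace_C_inter[OF w F_C[OF w] sE]) (auto simp: E_def)
  show "subspace (F w)" by (rule F_subspace[OF w])
  show "\<exists>e\<in>E w. \<exists>f\<in>F w. x = e + f" for x
    using Q_compl[OF w, of x] by (auto simp: E_def intro!: exI[of _ x] bexI[of _ "x - Q w x"])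
qed

lemma Q_eq_proj: "w \<in> \<Omega> \<Longrightarrow> proj_along (E w) (F w) = Q w"
  by (rule ext, rule algebraic_splitting.proj_unique[OF splitting_E_F]) (auto simp: E_def Q_compl)

text \<open>\<open>Q w\<close> maps the complement \<open>E1 w\<close> of its kernel
  isomorphically onto \<open>E w\<close>.\<close>

lemma dim_E: assumes w: "w \<in> \<Omega>" shows "has_dim (E w) (k w)"
proof -
  interpret E1: algebraic_splitting "E1 w" "F w" using w by (rule splitting_E1_F)
  interpret EF: algebraic_splitting "E w" "F w" using w by (rule splitting_E_F)
  have Q0: "x \<in> F w" if "Q w x = 0" for x using Q_compl[OF w, of x] that by simp
  have "inj_on (Q w) (E1 w)"
    unfolding linear_inj_on_iff_eq_0[OF linear_Q[OF w] E1.subspace_E] using Q0 E1.inter by blast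
  then have "has_dim (Q w ` E1 w) (k w)" by (rule has_dim_image[OF dim_E1[OF w] linear_Q[OF w]])
  moreover have "Q w ` E1 w = E w"
  proof
    show "E w \<subseteq> Q w ` E1 w"
    proof
      fix e assume "e \<in> E w"
      then have fix_e: "Q w e = e" using Q_idem[OF w] by (auto simp: E_def)
      obtain e' f where ef: "e' \<in> E1 w" "f \<in> F w" "e = e' + f" using E1.sum by blast
      then have "Q w e = Q w e'" by (simp add: linear_add[OF linear_Q[OF w]] Q_F[OF w])
      then show "e \<in> Q w ` E1 w" using ef fix_e by (metis imageI)
    qed
  qed (auto simp: E_def)
  ultimately show ?thesis by simp
qed

lemma E_C: "w \<in> \<Omega> \<Longrightarrow> E w \<subseteq> C w" using Q_C by (auto simp: E_def)

lemma closed_E: "w \<in> \<Omega> \<Longrightarrow> closed (E w)" using closed_has_dim[OF dim_E] .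

lemma E_image: assumes w: "w \<in> \<Omega>" shows "A w ` E w = E (\<theta> w)"
proof (rule has_dim_subset_eq)
  show "has_dim (A w ` E w) (k w)" using dim_T_image[OF w dim_E[OF w], of 1] by simp
  show "has_dim (E (\<theta> w)) (k w)" using dim_E[OF fwd[OF w]] k_inv[OF w] by simp
  show "A w ` E w \<subseteq> E (\<theta> w)" by (auto simp: E_def Q_A[OF w])
qed

lemma E_expand: "w \<in> \<Omega> \<Longrightarrow> e \<in> E w \<Longrightarrow> \<exists>a\<in>C (\<tau> w). e = A (\<tau> w) a"
  using E_image[OF bwd, of w] E_C[OF bwd, of w] \<theta>\<tau>[of w] by auto

lemma angle_E_F:
  assumes w: "w \<in> \<Omega>" and "e \<in> E w" "f \<in> F w"
  shows "norm e \<le> c (\<tau> w) * norm (e - f)"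
  using E_expand[OF w assms(2)] angle[OF bwd[OF w] _ _ , of _ "F w" f] F_C[OF w] \<theta>\<tau>[OF w] assms(3) by auto

text \<open>Since \<open>v\<close> is the image of a cone vector, the initial segment in
  direction \<open>u\<close> can have length \<open>norm v / (c (\<tau> w) norm u)\<close>. For
  \<open>n = 0\<close> the truncated \<open>n - 1\<close> denotes the point itself and the
  constant is at least \<open>1\<close>.\<close>

lemma domination:
  assumes w: "w \<in> \<Omega>" and v: "v \<in> E w" and u: "u \<in> F w"
  shows "norm v * norm (T n w u) \<le>
    2 * c (\<tau> w) * (1 + c ((\<theta> ^^ (n - 1)) w)) / \<Lambda> n w * (norm u * norm (T n w v))"
proof (cases "n = 0 \<or> u = 0")
  case True
  have "1 * 1 \<le> (2 * c (\<tau> w)) * (1 + c w)"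
    using c_ge_1[OF w] c_ge_1[OF bwd[OF w]] by (intro mult_mono) auto
  then have "1 * (norm u * norm v) \<le> 2 * c (\<tau> w) * (1 + c w) * (norm u * norm v)"
    by (intro mult_right_mono) auto
  then show ?thesis using True by (auto simp: mult.commute)
next
  case False
  have cp: "0 < c (\<tau> w)" using c_pos[OF bwd[OF w]] .
  have Lp: "0 < \<Lambda> n w" using expansion_ge_1[OF w, of n] by simp
  obtain a where a: "a \<in> C (\<tau> w)" "v = A (\<tau> w) a" using E_expand[OF w v] by blast
  define s where "s = norm v / (c (\<tau> w) * norm u)"
  have s: "0 \<le> s" using cp by (simp add: s_def)
  have seg: "v + t *\<^sub>R u \<in> C w" if "\<bar>t\<bar> \<le> s" for t
  proof (rule C_thick_bwd[OF w a])
    have "norm (t *\<^sub>R u) \<le> s * norm u" using that by (simp add: mult_right_mono)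
    then show "norm (t *\<^sub>R u) \<le> norm v / c (\<tau> w)" using False by (simp add: s_def)
  qed
  have "s * \<Lambda> n w * norm (T n w u) \<le> 2 * (1 + c ((\<theta> ^^ (n - 1)) w)) * norm (T n w v)"
    using cone_growth_bound[OF w s seg F_C[OF fwd_n[OF w]] F_map_n[OF w u], of n] False by simp
  then show ?thesis using cp Lp False by (simp add: s_def field_simps)
qed

end

section \<open>Measurability of the projections\<close>

text \<open>For simple \<open>y\<close> only countably many vectors are plugged in; continuity
  in the second argument passes to the limit.\<close>

lemma borel_measurable_operator_apply:
  fixes G :: "'w \<Rightarrow> 'a::{metric_space, second_countable_topology} \<Rightarrow> 'b::metric_space"
  assumes G: "\<And>x. (\<lambda>w. G w x) \<in> borel_measurable M"
    and cont: "\<And>w. w \<in> space M \<Longrightarrow> continuous_on UNIV (G w)"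
    and y: "y \<in> borel_measurable M"
  shows "(\<lambda>w. G w (y w)) \<in> borel_measurable M"
proof -
  obtain s where s: "\<And>i. simple_function M (s i)" "\<And>w. w \<in> space M \<Longrightarrow> (\<lambda>i. s i w) \<longlonglongrightarrow> y w"
    using borel_measurable_implies_sequence_metric[OF y, of undefined] by blast
  have "(\<lambda>w. G w (s i w)) \<in> borel_measurable M" for i
  proof (rule measurable_compose_countable'[where I = "s i ` space M"])
    show "countable (s i ` space M)" using s(1)[of i] by (auto simp: simple_function_def intro: countable_finite)
    show "s i \<in> measurable M (count_space (s i ` space M))"
      using s(1)[of i] by (auto simp: simple_function_def measurable_count_space_eq2)
  qed (rule G)
  then show ?thesis
  proof (rule borel_measurable_LIMSEQ_metric)
    fix w assume w: "w \<in> space M"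
    show "(\<lambda>i. G w (s i w)) \<longlonglongrightarrow> G w (y w)"
      by (rule continuous_on_tendsto_compose[OF cont[OF w] s(2)[OF w]]) auto
  qed
qed

text \<open>The projections at finite stages solve linear equations \<open>R a = z\<close> with
  \<open>a\<close> in a moving finite-dimensional space, the range of \<open>P\<close>. Choosing
  the first member of a countable dense set whose \<open>P\<close>-image solves the equation up
  to \<open>1 / (j + 1)\<close> is measurable, and as \<open>R\<close> is bounded below on the
  range of \<open>P\<close>, these choices converge to the solution. Measurable bases of the
  subspaces are thus avoided.\<close>

lemma borel_measurable_unique_solution:
  fixes P R :: "'w \<Rightarrow> 'a::{banach, second_countable_topology} \<Rightarrow> 'a"
  assumes P: "\<And>x. (\<lambda>w. P w x) \<in> borel_measurable M" "\<And>w. w \<in> space M \<Longrightarrow> bounded_linear (P w)"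
    and R: "\<And>x. (\<lambda>w. R w x) \<in> borel_measurable M" "\<And>w. w \<in> space M \<Longrightarrow> bounded_linear (R w)"
    and z[measurable]: "z \<in> borel_measurable M"
    and dim: "\<And>w. w \<in> space M \<Longrightarrow> has_dim (range (P w)) (d w)"
    and inj: "\<And>w v. w \<in> space M \<Longrightarrow> v \<in> range (P w) \<Longrightarrow> R w v = 0 \<Longrightarrow> v = 0"
    and sol: "\<And>w. w \<in> space M \<Longrightarrow> a w \<in> range (P w)" "\<And>w. w \<in> space M \<Longrightarrow> R w (a w) = z w"
  shows "a \<in> borel_measurable M"
proof -
  obtain D :: "'a set" where D: "countable D" "\<And>X. open X \<Longrightarrow> X \<noteq> {} \<Longrightarrow> \<exists>d\<in>D. d \<in> X"
    by (rule countable_dense_setE) blast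
  have "D \<noteq> {}" using D(2)[of UNIV] by auto
  define q where "q = from_nat_into D"
  have q: "\<exists>i. q i \<in> X" if "open X" "X \<noteq> {}" for X
  proof -
    obtain d where "d \<in> D" "d \<in> X" using D(2)[OF \<open>open X\<close> \<open>X \<noteq> {}\<close>] by blast
    moreover obtain i where "q i = d" unfolding q_def using from_nat_into_surj[OF D(1) \<open>d \<in> D\<close>] by blast
    ultimately show ?thesis by blast
  qed
  have RP: "(\<lambda>w. R w (P w x)) \<in> borel_measurable M" for x
    by (rule borel_measurable_operator_apply[OF R(1) _ P(1)]) (intro linear_continuous_on R)
  define i where "i j w = (LEAST i. dist (R w (P w (q i))) (z w) < 1 / real (Suc j))" for j w
  have i_meas: "i j \<in> measurable M (count_space UNIV)" for j
    unfolding i_def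
    by (intro measurable_Least borel_measurable_pred_less borel_measurable_dist RP z) simp
  have i_prop: "dist (R w (P w (q (i j w)))) (z w) < 1 / real (Suc j)" if w: "w \<in> space M" for j w
  proof -
    obtain x where x: "a w = P w x" using sol(1)[OF w] by blast
    have c: "continuous_on UNIV (\<lambda>x. dist (R w (P w x)) (z w))"
      by (intro continuous_on_dist continuous_on_const linear_continuous_on
          bounded_linear_compose[OF R(2)[OF w] P(2)[OF w]])
    let ?X = "{x. dist (R w (P w x)) (z w) < 1 / real (Suc j)}"
    have "open ?X" by (intro open_Collect_less c continuous_on_const)
    moreover have "x \<in> ?X" using sol(2)[OF w] x by simp
    ultimately obtain m where "q m \<in> ?X" using q by blast
    then have m: "dist (R w (P w (q m))) (z w) < 1 / real (Suc j)" by simp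
    show ?thesis unfolding i_def
      by (rule LeastI[where P = "\<lambda>i. dist (R w (P w (q i))) (z w) < 1 / real (Suc j)", OF m])
  qed
  have "(\<lambda>w. P w (q (i j w))) \<in> borel_measurable M" for j
    by (rule measurable_compose_countable[OF P(1) i_meas])
  then show ?thesis
  proof (rule borel_measurable_LIMSEQ_metric)
    fix w assume w: "w \<in> space M"
    note linR = bounded_linear.linear[OF R(2)[OF w]]
    obtain m where m: "\<forall>v\<in>range (P w). norm v \<le> m * norm (R w v)"
      by (rule exE[OF inj_on_finite_dim_bounded_below[OF dim[OF w] linR inj[OF w]]])
    have sub: "subspace (range (P w))" by (rule has_dim_subspace[OF dim[OF w]])
    have "norm (P w (q (i j w)) - a w) \<le> \<bar>m\<bar> * (1 / real (Suc j))" for j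
    proof -
      let ?v = "P w (q (i j w)) - a w"
      have "norm ?v \<le> m * norm (R w ?v)" by (intro m[rule_format] subspace_diff[OF sub rangeI sol(1)[OF w]])
      also have "\<dots> \<le> \<bar>m\<bar> * norm (R w ?v)" by (intro mult_right_mono) auto
      also have "norm (R w ?v) = dist (R w (P w (q (i j w)))) (z w)"
        unfolding linear_diff[OF linR] sol(2)[OF w] dist_norm ..
      also have "\<bar>m\<bar> * \<dots> \<le> \<bar>m\<bar> * (1 / real (Suc j))"
        by (rule mult_left_mono[OF less_imp_le[OF i_prop[OF w]] abs_ge_zero])
      finally show ?thesis .
    qed
    moreover have "(\<lambda>j. \<bar>m\<bar> * (1 / real (Suc j))) \<longlonglongrightarrow> 0"
      by (intro tendsto_mult_right_zero) (rule LIMSEQ_Suc[OF lim_1_over_n])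
    ultimately have "(\<lambda>j. P w (q (i j w)) - a w) \<longlonglongrightarrow> 0"
      by (rule Lim_null_comparison[OF always_eventually[OF allI]])
    then show "(\<lambda>j. P w (q (i j w))) \<longlonglongrightarrow> a w" by (rule LIM_zero_cancel)
  qed
qed

locale measurable_cone_dynamics =
  cone_dynamics "space M" \<theta> \<tau> A k C E0 F0 c
  for M :: "'w measure" and \<theta> \<tau> :: "'w \<Rightarrow> 'w" and A :: "'w \<Rightarrow> 'a::{banach, second_countable_topology} \<Rightarrow>\<^sub>L 'a"
    and k C E0 F0 c +
  assumes \<theta>_meas: "\<theta> \<in> measurable M M" and \<tau>_meas: "\<tau> \<in> measurable M M"
    and A_meas: "strongly_measurable M (\<lambda>w. blinfun_apply (A w))"
    and splitting0: "w \<in> space M \<Longrightarrow> splitting (E0 w) (F0 w)"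
    and proj0_meas: "strongly_measurable M (\<lambda>w. proj_along (E0 w) (F0 w))"
begin

abbreviation P0 :: "'w \<Rightarrow> 'a \<Rightarrow> 'a" where "P0 w \<equiv> proj_along (E0 w) (F0 w)"

lemma bounded_linear_P0: "w \<in> space M \<Longrightarrow> bounded_linear (P0 w)"
  by (rule bounded_linear_proj_along[OF splitting0 dim_E0])

lemma alg0: "w \<in> space M \<Longrightarrow> algebraic_splitting (E0 w) (F0 w)"
  by (rule splitting_imp_algebraic[OF splitting0])

lemma range_P0: assumes "w \<in> space M" shows "range (P0 w) = E0 w"
proof
  show "E0 w \<subseteq> range (P0 w)"
    using algebraic_splitting.proj_fix[OF alg0[OF assms]] by (metis rangeI subsetI)
qed (use algebraic_splitting.proj_mem[OF alg0[OF assms]] in blast)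

lemma P0_zero_iff: "w \<in> space M \<Longrightarrow> P0 w x = 0 \<longleftrightarrow> x \<in> F0 w"
  by (rule algebraic_splitting.proj_zero_iff[OF alg0])

lemma \<theta>_n_meas: "(\<theta> ^^ n) \<in> measurable M M"
  by (induction n) (auto intro: measurable_compose[OF _ \<theta>_meas])

lemma \<tau>_n_meas: "(\<tau> ^^ n) \<in> measurable M M"
  by (induction n) (auto intro: measurable_compose[OF _ \<tau>_meas])

lemma A_apply_meas:
  assumes "h \<in> measurable M M" "y \<in> borel_measurable M"
  shows "(\<lambda>w. A (h w) (y w)) \<in> borel_measurable M"
proof (rule borel_measurable_operator_apply[OF _ _ assms(2)])
  show "(\<lambda>w. A (h w) x) \<in> borel_measurable M" for x
    using A_meas by (intro measurable_compose[OF assms(1)]) (simp add: strongly_measurable_def)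
qed (intro linear_continuous_on blinfun.bounded_linear_right)

lemma P0_apply_meas:
  assumes "h \<in> measurable M M" "y \<in> borel_measurable M"
  shows "(\<lambda>w. P0 (h w) (y w)) \<in> borel_measurable M"
proof (rule borel_measurable_operator_apply[OF _ _ assms(2)])
  show "(\<lambda>w. P0 (h w) x) \<in> borel_measurable M" for x
    using proj0_meas by (intro measurable_compose[OF assms(1)]) (simp add: strongly_measurable_def)
qed (intro linear_continuous_on bounded_linear_P0 measurable_space[OF assms(1)])

lemma T_apply_meas:
  assumes h: "h \<in> measurable M M" and y: "y \<in> borel_measurable M"
  shows "(\<lambda>w. T n (h w) (y w)) \<in> borel_measurable M"
proof (induction n)
  case (Suc n)
  have "(\<lambda>w. (\<theta> ^^ n) (h w)) \<in> measurable M M" by (rule measurable_compose[OF h \<theta>_n_meas])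
  then show ?case unfolding T_Suc by (rule A_apply_meas[OF _ Suc])
qed (simp add: y)

text \<open>The component in \<open>E1\<close> is the element of \<open>E1\<close> whose image
  \<open>n\<close> steps ahead agrees with that of \<open>x\<close> modulo
  \<open>F0\<close>.\<close>

lemma proj_n_meas: "(\<lambda>w. proj_n n w x) \<in> borel_measurable M"
proof (rule borel_measurable_unique_solution[where P = "\<lambda>w y. A (\<tau> w) (P0 (\<tau> w) y)"
      and R = "\<lambda>w y. P0 ((\<theta> ^^ n) w) (T n w y)" and z = "\<lambda>w. P0 ((\<theta> ^^ n) w) (T n w x)" and d = k])
  have T: "(\<lambda>w. T n w y) \<in> borel_measurable M" for y
    using T_apply_meas[of "\<lambda>w. w" "\<lambda>_. y"] by simp
  show "(\<lambda>w. A (\<tau> w) (P0 (\<tau> w) y)) \<in> borel_measurable M" for y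
    by (intro A_apply_meas P0_apply_meas \<tau>_meas measurable_const) simp
  show "(\<lambda>w. P0 ((\<theta> ^^ n) w) (T n w y)) \<in> borel_measurable M" for y
    by (intro P0_apply_meas \<theta>_n_meas T)
  then show "(\<lambda>w. P0 ((\<theta> ^^ n) w) (T n w x)) \<in> borel_measurable M" .
  fix w assume w: "w \<in> space M"
  show "bounded_linear (\<lambda>y. A (\<tau> w) (P0 (\<tau> w) y))"
    by (intro bounded_linear_compose[OF blinfun.bounded_linear_right] bounded_linear_P0 bwd w)
  show "bounded_linear (\<lambda>y. P0 ((\<theta> ^^ n) w) (T n w y))"
    by (intro bounded_linear_compose[OF bounded_linear_P0[OF fwd_n[OF w]]] blinfun.bounded_linear_right)
  have ran: "range (\<lambda>y. A (\<tau> w) (P0 (\<tau> w) y)) = E1 w"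
    using image_image[of "A (\<tau> w)" "P0 (\<tau> w)" UNIV]
    unfolding range_P0[OF bwd[OF w]] E1_def by (rule sym)
  show "has_dim (range (\<lambda>y. A (\<tau> w) (P0 (\<tau> w) y))) (k w)" unfolding ran by (rule dim_E1[OF w])
  show "proj_n n w x \<in> range (\<lambda>y. A (\<tau> w) (P0 (\<tau> w) y))" unfolding ran by (rule proj_n_mem[OF w])
  have ker: "P0 ((\<theta> ^^ n) w) (T n w y) = 0 \<longleftrightarrow> y \<in> Fn n w" for y
    using P0_zero_iff[OF fwd_n[OF w]] by (simp add: Fn_def)
  show "v = 0" if "v \<in> range (\<lambda>y. A (\<tau> w) (P0 (\<tau> w) y))" "P0 ((\<theta> ^^ n) w) (T n w v) = 0" for v
  proof -
    have "v \<in> E1 w \<inter> Fn n w" using that unfolding ran ker by (rule IntI)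
    then show ?thesis unfolding algebraic_splitting.inter[OF splitting_n[OF w, of n]] by simp
  qed
  show "P0 ((\<theta> ^^ n) w) (T n w (proj_n n w x)) = P0 ((\<theta> ^^ n) w) (T n w x)"
  proof -
    have "P0 ((\<theta> ^^ n) w) (T n w (x - proj_n n w x)) = 0" unfolding ker by (rule proj_n_compl[OF w])
    then show ?thesis
      unfolding blinfun.diff_right linear_diff[OF bounded_linear.linear[OF bounded_linear_P0[OF fwd_n[OF w]]]]
      by (simp only: right_minus_eq)
  qed
qed

lemma proj_lim_meas: "(\<lambda>w. proj_lim w x) \<in> borel_measurable M"
  by (rule borel_measurable_LIMSEQ_metric[OF proj_n_meas proj_lim])

lemma proj_lim_zero_iff: "proj_lim w x = 0 \<longleftrightarrow> x \<in> F w" by (simp add: F_def)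

text \<open>The unknown is the vector \<open>a\<close> of \<open>E0\<close> in the past whose
  push-forward is \<open>Qn n w x\<close>; it is determined by the equality modulo
  \<open>F\<close> of that push-forward and \<open>x\<close>.\<close>

lemma Qn_meas: "(\<lambda>w. Qn n w x) \<in> borel_measurable M"
proof -
  define a where "a w = (SOME a. a \<in> E0 ((\<tau> ^^ n) w) \<and> T n ((\<tau> ^^ n) w) a = Qn n w x)" for w
  have a: "a w \<in> E0 ((\<tau> ^^ n) w)" "Qn n w x = T n ((\<tau> ^^ n) w) (a w)" if "w \<in> space M" for w
  proof -
    have "\<exists>a. a \<in> E0 ((\<tau> ^^ n) w) \<and> T n ((\<tau> ^^ n) w) a = Qn n w x"
      using Qn_mem[OF that, of n x] unfolding En_def by (elim imageE) auto
    from someI_ex[OF this] show "a w \<in> E0 ((\<tau> ^^ n) w)" "Qn n w x = T n ((\<tau> ^^ n) w) (a w)"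
      unfolding a_def[symmetric] by auto
  qed
  have "a \<in> borel_measurable M"
  proof (rule borel_measurable_unique_solution[where P = "\<lambda>w. P0 ((\<tau> ^^ n) w)"
      and R = "\<lambda>w y. proj_lim w (T n ((\<tau> ^^ n) w) y)" and z = "\<lambda>w. proj_lim w x" and d = k])
    show "(\<lambda>w. P0 ((\<tau> ^^ n) w) y) \<in> borel_measurable M" for y
      by (intro P0_apply_meas \<tau>_n_meas measurable_const) simp
    show "(\<lambda>w. proj_lim w (T n ((\<tau> ^^ n) w) y)) \<in> borel_measurable M" for y
      by (intro borel_measurable_operator_apply[OF proj_lim_meas] linear_continuous_on bounded_linear_proj_lim
          T_apply_meas \<tau>_n_meas measurable_const) simp_all
    show "(\<lambda>w. proj_lim w x) \<in> borel_measurable M" by (rule proj_lim_meas)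
    fix w assume w: "w \<in> space M"
    show "bounded_linear (P0 ((\<tau> ^^ n) w))" by (intro bounded_linear_P0 bwd_n w)
    show "bounded_linear (\<lambda>y. proj_lim w (T n ((\<tau> ^^ n) w) y))"
      by (intro bounded_linear_compose[OF bounded_linear_proj_lim[OF w]] blinfun.bounded_linear_right)
    note ran = range_P0[OF bwd_n[OF w, of n]]
    show "has_dim (range (P0 ((\<tau> ^^ n) w))) (k w)"
      unfolding ran using dim_E0[OF bwd_n[OF w, of n]] k_bwd_n[OF w, of n] by simp
    show "a w \<in> range (P0 ((\<tau> ^^ n) w))" unfolding ran by (rule a(1)[OF w])
    show "v = 0" if "v \<in> range (P0 ((\<tau> ^^ n) w))" "proj_lim w (T n ((\<tau> ^^ n) w) v) = 0" for v
    proof -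
      have "T n ((\<tau> ^^ n) w) v \<in> En n w \<inter> F w" using that unfolding ran proj_lim_zero_iff En_def by blast
      then have "T n ((\<tau> ^^ n) w) v = 0" unfolding algebraic_splitting.inter[OF splitting_En[OF w, of n]] by simp
      then show ?thesis using T_zero_iff[OF bwd_n[OF w]] by blast
    qed
    have "proj_lim w (x - Qn n w x) = 0" unfolding proj_lim_zero_iff by (rule Qn_compl[OF w])
    then show "proj_lim w (T n ((\<tau> ^^ n) w) (a w)) = proj_lim w x"
      unfolding a(2)[OF w] linear_diff[OF linear_proj_lim[OF w]] by simp
  qed
  then have "(\<lambda>w. T n ((\<tau> ^^ n) w) (a w)) \<in> borel_measurable M" by (rule T_apply_meas[OF \<tau>_n_meas])
  then show ?thesis by (subst measurable_cong[OF a(2)])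
qed

lemma Q_meas: "(\<lambda>w. Q w x) \<in> borel_measurable M"
  by (rule borel_measurable_LIMSEQ_metric[OF Qn_meas Q_lim])

end

section \<open>Exponential estimates along one orbit\<close>

text \<open>The primitive of \<open>b\<close> over the integers that vanishes at
  \<open>0\<close>. Products over any stretch of the orbit become differences of its values, so
  one sublinear estimate serves all stretches, on both sides of \<open>0\<close>.\<close>

definition signed_sum :: "(int \<Rightarrow> real) \<Rightarrow> int \<Rightarrow> real" where
  "signed_sum b i = (if 0 \<le> i then \<Sum>j<nat i. b (int j) else - (\<Sum>j<nat (- i). b (- int j - 1)))"

lemma signed_sum_0: "signed_sum b 0 = 0" by (simp add: signed_sum_def)

lemma signed_sum_add_1: "signed_sum b (i + 1) = signed_sum b i + b i"
proof (cases "0 \<le> i")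
  case True
  then have "nat (i + 1) = Suc (nat i)" by simp
  then show ?thesis using True by (simp add: signed_sum_def)
next
  case False
  then obtain n where n: "i = - int (Suc n)" by (cases i rule: int_cases) auto
  have nat: "nat (- i) = Suc n" "nat (- (i + 1)) = n" using n by simp_all
  have "signed_sum b (i + 1) = - (\<Sum>j<n. b (- int j - 1))"
  proof (cases "n = 0")
    case True
    then show ?thesis using n by (simp add: signed_sum_0)
  next
    case False
    then have "\<not> 0 \<le> i + 1" using n by simp
    then show ?thesis by (simp only: signed_sum_def if_False nat)
  qed
  moreover have "signed_sum b i = - (\<Sum>j<Suc n. b (- int j - 1))"
    using False by (simp only: signed_sum_def if_False nat)
  moreover have "- int n - 1 = i" using n by simp
  ultimately show ?thesis by (simp only: sum.lessThan_Suc)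
qed

lemma signed_sum_diff: "signed_sum b (m + int n) - signed_sum b m = (\<Sum>j<n. b (m + int j))"
proof (induction n)
  case (Suc n)
  have "m + int (Suc n) = m + int n + 1" by simp
  then have "signed_sum b (m + int (Suc n)) = signed_sum b (m + int n) + b (m + int n)"
    by (simp only: signed_sum_add_1)
  then show ?case using Suc by (simp only: sum.lessThan_Suc)
qed simp

lemma sublinear_signed_sum:
  assumes fwd: "(\<lambda>n. (\<Sum>j<n. b (int j)) / real n) \<longlonglongrightarrow> L"
    and bwd: "(\<lambda>n. (\<Sum>j<n. b (- int j - 1)) / real n) \<longlonglongrightarrow> L"
  shows "sublinear (\<lambda>i. signed_sum b i - real_of_int i * L)"
  unfolding sublinear_iff_nat
proof
  have pos: "eventually (\<lambda>n::nat. 0 < n) sequentially" by (rule eventually_gt_at_top)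
  have "(\<lambda>n. (\<Sum>j<n. b (int j)) / real n - L) \<longlonglongrightarrow> 0" using tendsto_diff[OF fwd tendsto_const, of L] by simp
  then show "(\<lambda>n. (signed_sum b (int n) - real_of_int (int n) * L) / real n) \<longlonglongrightarrow> 0"
    by (rule Lim_transform_eventually)
       (use pos in eventually_elim, simp add: signed_sum_def diff_divide_distrib)
  have "(\<lambda>n. L - (\<Sum>j<n. b (- int j - 1)) / real n) \<longlonglongrightarrow> 0" using tendsto_diff[OF tendsto_const bwd, of L] by simp
  then show "(\<lambda>n. (signed_sum b (- int n) - real_of_int (- int n) * L) / real n) \<longlonglongrightarrow> 0"
    by (rule Lim_transform_eventually)
       (use pos in eventually_elim, simp add: signed_sum_def diff_divide_distrib add_divide_distrib)
qed

lemma exp_linear_tendsto_0: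
  assumes "(0::real) < d" shows "(\<lambda>n. exp (D - real n * d)) \<longlonglongrightarrow> 0"
proof -
  have "(\<lambda>n. exp D * exp (- d) ^ n) \<longlonglongrightarrow> 0"
    using assms by (intro tendsto_mult_right_zero LIMSEQ_power_zero) simp
  moreover have "exp D * exp (- d) ^ n = exp (D - real n * d)" for n
    by (simp add: exp_diff exp_minus exp_of_nat_mult[symmetric] power_inverse field_simps)
  ultimately show ?thesis by simp
qed

lemma exp_combine: "2 * exp x * (2 * exp y) * exp (- z) * exp h = exp (ln 4 + x + y - z + h)" for x y z h :: real
  by (simp add: exp_add exp_diff exp_minus field_simps)

text \<open>\<open>g\<close> plays the part of \<open>c\<close> along one orbit. Forward and
  backward means of the logarithmic lengthening factor have the same positive limit; equality is
  needed for estimates that are uniform in the starting point.\<close>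

locale tempered_gain =
  fixes g :: "int \<Rightarrow> real" and L :: real
  assumes g_ge_1: "\<And>i. 1 \<le> g i" and sub_g: "sublinear (\<lambda>i. ln (g i))" and L_pos: "0 < L"
    and fwd_mean: "(\<lambda>n. (\<Sum>j<n. ln (1 + 1 / (g (int j) * (1 + g (int j))))) / real n) \<longlonglongrightarrow> L"
    and bwd_mean: "(\<lambda>n. (\<Sum>j<n. ln (1 + 1 / (g (- int j - 1) * (1 + g (- int j - 1))))) / real n) \<longlonglongrightarrow> L"
begin

definition gain :: "int \<Rightarrow> nat \<Rightarrow> real" where
  "gain m n = (\<Prod>j<n. 1 + 1 / (g (m + int j) * (1 + g (m + int j))))"

abbreviation S :: "int \<Rightarrow> real" where "S \<equiv> signed_sum (\<lambda>i. ln (1 + 1 / (g i * (1 + g i))))"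

lemma g_pos: "0 < g i" using g_ge_1[of i] by linarith

lemma gain_eq: "gain m n = exp (S (m + int n) - S m)"
proof -
  have "0 < 1 + 1 / (g i * (1 + g i))" for i
    using g_pos[of i] by (intro add_pos_pos divide_pos_pos mult_pos_pos) auto
  then show ?thesis unfolding gain_def signed_sum_diff by (simp add: exp_sum)
qed

lemma bounds:
  assumes "0 < \<epsilon>"
  obtains D where "0 \<le> D" "\<And>i. g i \<le> exp (\<epsilon> * \<bar>real_of_int i\<bar> + D)"
    "\<And>i. \<bar>S i - real_of_int i * L\<bar> \<le> \<epsilon> * \<bar>real_of_int i\<bar> + D"
proof -
  obtain D1 where D1: "0 \<le> D1" "\<And>i. \<bar>ln (g i)\<bar> \<le> \<epsilon> * \<bar>real_of_int i\<bar> + D1"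
    using sublinearD[OF sub_g assms] by blast
  obtain D2 where D2: "0 \<le> D2" "\<And>i. \<bar>S i - real_of_int i * L\<bar> \<le> \<epsilon> * \<bar>real_of_int i\<bar> + D2"
    using sublinearD[OF sublinear_signed_sum[OF fwd_mean bwd_mean] assms] by blast
  have g: "g i \<le> exp (\<epsilon> * \<bar>real_of_int i\<bar> + (D1 + D2))" for i
  proof -
    have "ln (g i) \<le> \<epsilon> * \<bar>real_of_int i\<bar> + (D1 + D2)" using D1(2)[of i] D2(1) by linarith
    then have "exp (ln (g i)) \<le> exp (\<epsilon> * \<bar>real_of_int i\<bar> + (D1 + D2))" by (simp only: exp_le_cancel_iff)
    then show ?thesis using g_pos[of i] by (simp only: exp_ln)
  qed
  have S: "\<bar>S i - real_of_int i * L\<bar> \<le> \<epsilon> * \<bar>real_of_int i\<bar> + (D1 + D2)" for i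
    using D2(2)[of i] D1(1) by linarith
  show ?thesis using that[OF _ g S] D1(1) D2(1) by simp
qed

lemma inverse_gain_tendsto_0: "(\<lambda>n. 1 / gain 0 n) \<longlonglongrightarrow> 0"
proof -
  obtain D where D: "\<And>i. \<bar>S i - real_of_int i * L\<bar> \<le> L / 2 * \<bar>real_of_int i\<bar> + D"
    using bounds[of "L / 2"] half_gt_zero[OF L_pos] by blast
  have "norm (1 / gain 0 n) \<le> exp (D - real n * (L / 2))" for n
  proof -
    have "1 / gain 0 n = exp (- S (int n))" by (simp add: gain_eq signed_sum_0 exp_minus inverse_eq_divide)
    moreover have "- S (int n) \<le> D - real n * (L / 2)"
    proof -
      define x where "x = real n * L"
      have "\<bar>S (int n) - x\<bar> \<le> x / 2 + D" using D[of "int n"] by (simp add: x_def mult.commute)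
      moreover have "real n * (L / 2) = x / 2" by (simp add: x_def)
      ultimately show ?thesis by linarith
    qed
    ultimately show ?thesis by simp
  qed
  then show ?thesis using exp_linear_tendsto_0[OF half_gt_zero[OF L_pos]]
    by (rule Lim_null_comparison[OF always_eventually[OF allI]])
qed

lemma backward_gain_tendsto_0: "(\<lambda>n. g (- int n) * (1 + g (- int n)) / gain (- int n) n) \<longlonglongrightarrow> 0"
proof -
  have "0 < L / 6" using L_pos by simp
  then obtain D where D: "0 \<le> D" "\<And>i. g i \<le> exp (L / 6 * \<bar>real_of_int i\<bar> + D)"
    "\<And>i. \<bar>S i - real_of_int i * L\<bar> \<le> L / 6 * \<bar>real_of_int i\<bar> + D"
    using bounds[of "L / 6"] by blast
  have "norm (g (- int n) * (1 + g (- int n)) / gain (- int n) n) \<le> 2 * exp (3 * D - real n * (L / 2))" for n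
  proof -
    let ?x = "L / 6 * real n + D"
    have g: "g (- int n) \<le> exp ?x" using D(2)[of "- int n"] by simp
    have "0 \<le> ?x" using L_pos D(1) by simp
    then have "1 \<le> exp ?x" by simp
    then have "1 + g (- int n) \<le> 2 * exp ?x" using g by linarith
    then have "g (- int n) * (1 + g (- int n)) \<le> exp ?x * (2 * exp ?x)"
      using g_pos[of "- int n"] by (intro mult_mono[OF g]) simp_all
    also have "\<dots> = 2 * exp (?x + ?x)" by (simp only: exp_add[of ?x ?x] mult.left_commute)
    finally have num: "g (- int n) * (1 + g (- int n)) \<le> 2 * exp (?x + ?x)" .
    have inv: "1 / gain (- int n) n = exp (S (- int n))"
      by (simp add: gain_eq signed_sum_0 exp_minus inverse_eq_divide)
    have "g (- int n) * (1 + g (- int n)) / gain (- int n) n = g (- int n) * (1 + g (- int n)) * (1 / gain (- int n) n)"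
      by simp
    also have "\<dots> \<le> 2 * exp (?x + ?x) * exp (S (- int n))"
      unfolding inv by (rule mult_right_mono[OF num]) simp
    also have "\<dots> = 2 * exp (?x + ?x + S (- int n))" by (simp only: exp_add[of "?x + ?x" "S (- int n)"] mult.assoc)
    also have "\<dots> \<le> 2 * exp (3 * D - real n * (L / 2))"
    proof -
      define x where "x = real n * L"
      have "\<bar>S (- int n) + x\<bar> \<le> x / 6 + D" using D(3)[of "- int n"] by (simp add: x_def mult.commute)
      then have "S (- int n) \<le> x / 6 + D - x" unfolding abs_le_iff by linarith
      moreover have eqs: "real n * (L / 2) = x / 2" "L / 6 * real n = x / 6" by (simp_all add: x_def)
      ultimately have "?x + ?x + S (- int n) \<le> 3 * D - real n * (L / 2)" unfolding eqs by linarith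
      then show ?thesis by (intro mult_left_mono) (simp_all only: exp_le_cancel_iff zero_le_numeral)
    qed
    moreover have "0 \<le> g (- int n) * (1 + g (- int n)) / gain (- int n) n"
      unfolding gain_eq using g_pos[of "- int n"] by (intro divide_nonneg_nonneg mult_nonneg_nonneg) simp_all
    ultimately show ?thesis by (simp only: real_norm_def abs_of_nonneg)
  qed
  moreover have "(\<lambda>n. 2 * exp (3 * D - real n * (L / 2))) \<longlonglongrightarrow> 0"
    by (rule tendsto_mult_right_zero[OF exp_linear_tendsto_0[OF half_gt_zero[OF L_pos]]])
  ultimately show ?thesis by (rule Lim_null_comparison[OF always_eventually[OF allI]])
qed

text \<open>The constant in the domination estimate started at time \<open>m\<close>, after
  giving away the rate \<open>L / 2\<close>, is bounded in \<open>n\<close> and grows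
  subexponentially in \<open>m\<close>: the sublinear errors in \<open>n\<close> are absorbed by
  the remaining \<open>L / 2\<close>.\<close>

lemma domination_constant_bound:
  assumes "0 < \<epsilon>"
  shows "\<exists>D. \<forall>m n. 2 * g (m - 1) * (1 + g (m + int (n - 1))) / gain m n * exp (real n * (L / 2))
    \<le> exp (\<epsilon> * \<bar>real_of_int m\<bar> + D)"
proof -
  \<comment> \<open>Four errors in \<open>m\<close> occur (two values of \<open>g\<close>, two
    of \<open>S\<close>), and two in \<open>n\<close> against the rate
    \<open>L / 2\<close>.\<close>
  define e where "e = min (\<epsilon> / 4) (L / 4)"
  have e: "0 < e" "4 * e \<le> \<epsilon>" "4 * e \<le> L" using assms L_pos by (auto simp: e_def)
  obtain D where D: "0 \<le> D" "\<And>i. g i \<le> exp (e * \<bar>real_of_int i\<bar> + D)"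
    "\<And>i. \<bar>S i - real_of_int i * L\<bar> \<le> e * \<bar>real_of_int i\<bar> + D"
    using bounds[OF e(1)] by blast
  have "2 * g (m - 1) * (1 + g (m + int (n - 1))) / gain m n * exp (real n * (L / 2))
    \<le> exp (\<epsilon> * \<bar>real_of_int m\<bar> + (ln 4 + e + 4 * D))" for m n
  proof -
    let ?M = "\<bar>real_of_int m\<bar>"
    let ?x = "e * ?M + e + D" and ?y = "e * ?M + e * real n + D"
    have mono: "e * \<bar>real_of_int i\<bar> \<le> e * (?M + r)" if "\<bar>real_of_int i\<bar> \<le> ?M + r" for i r
      using that e by (intro mult_left_mono) auto
    have "g (m - 1) \<le> exp (e * \<bar>real_of_int (m - 1)\<bar> + D)" by (rule D)
    also have "\<dots> \<le> exp ?x" using mono[of "m - 1" 1] by (simp add: algebra_simps)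
    finally have g1: "g (m - 1) \<le> exp ?x" .
    have "g (m + int (n - 1)) \<le> exp (e * \<bar>real_of_int (m + int (n - 1))\<bar> + D)" by (rule D)
    also have "\<dots> \<le> exp ?y" using mono[of "m + int (n - 1)" "real n"] by (simp add: algebra_simps)
    finally have g2: "g (m + int (n - 1)) \<le> exp ?y" .
    have "0 \<le> ?y" using e(1) D(1) by simp
    then have "1 \<le> exp ?y" by simp
    then have g3: "1 + g (m + int (n - 1)) \<le> 2 * exp ?y" using g2 by linarith
    have num: "2 * g (m - 1) * (1 + g (m + int (n - 1))) \<le> 2 * exp ?x * (2 * exp ?y)"
      using g1 g3 less_imp_le[OF g_pos[of "m + int (n - 1)"]] less_imp_le[OF g_pos[of "m - 1"]]
      by (intro mult_mono) simp_all
    let ?z = "real n * L - 2 * e * ?M - e * real n - 2 * D"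
    have "?z \<le> S (m + int n) - S m"
    proof -
      have m: "\<bar>S m - real_of_int m * L\<bar> \<le> e * ?M + D" by (rule D)
      have "\<bar>S (m + int n) - (real_of_int m * L + real n * L)\<bar> \<le> e * \<bar>real_of_int (m + int n)\<bar> + D"
        using D(3)[of "m + int n"] by (simp add: distrib_right)
      moreover have "e * \<bar>real_of_int (m + int n)\<bar> \<le> e * ?M + e * real n"
        using mono[of "m + int n" "real n"] by (simp add: distrib_left)
      ultimately show ?thesis using m by linarith
    qed
    then have inv: "1 / gain m n \<le> exp (- ?z)"
      unfolding gain_eq exp_minus inverse_eq_divide[symmetric] by (intro le_imp_inverse_le) simp_all
    have "2 * g (m - 1) * (1 + g (m + int (n - 1))) / gain m n * exp (real n * (L / 2))
      = 2 * g (m - 1) * (1 + g (m + int (n - 1))) * (1 / gain m n) * exp (real n * (L / 2))" by simp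
    also have "\<dots> \<le> (2 * exp ?x * (2 * exp ?y)) * exp (- ?z) * exp (real n * (L / 2))"
      by (rule mult_right_mono[OF mult_mono[OF num inv]]) (simp_all add: gain_eq)
    also have "\<dots> = exp (ln 4 + ?x + ?y - ?z + real n * (L / 2))"
      by (rule exp_combine)
    also have "\<dots> \<le> exp (\<epsilon> * ?M + (ln 4 + e + 4 * D))"
    proof -
      have "4 * e * ?M \<le> \<epsilon> * ?M" "real n * (4 * e) \<le> real n * L"
        using e by (intro mult_right_mono mult_left_mono, simp_all)+
      then show ?thesis unfolding exp_le_cancel_iff by (simp add: algebra_simps)
    qed
    finally show ?thesis .
  qed
  then show ?thesis by blast
qed

end

section \<open>Separation index and operator norms\<close>

text \<open>After scaling to unit length, points at distance less than \<open>1 / c\<close> are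
  in \<open>C'\<close> by definition of the index; closedness adds the boundary of that
  ball.\<close>

lemma thick_of_separation:
  fixes A :: "'a::real_normed_vector \<Rightarrow>\<^sub>L 'a"
  assumes C: "\<And>r v. v \<in> C \<Longrightarrow> r *\<^sub>R v \<in> C" and C': "closed C'" "\<And>r v. v \<in> C' \<Longrightarrow> r *\<^sub>R v \<in> C'" "0 \<in> C'"
    and c: "1 \<le> c" and sep: "ereal (1 / c) \<le> separation_index (A ` C) (- C')"
    and v: "v \<in> C" and h: "norm h \<le> norm (A v) / c"
  shows "A v + h \<in> C'"
proof (cases "A v = 0")
  case True
  then show ?thesis using h C' by simp
next
  case False
  define e where "e = (1 / norm (A v)) *\<^sub>R A v"
  define h' where "h' = (1 / norm (A v)) *\<^sub>R h"
  have e: "e \<in> A ` C \<inter> sphere 0 1"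
  proof
    show "e \<in> A ` C"
      unfolding e_def blinfun.scaleR_right[symmetric] by (rule imageI[OF C[OF v]])
  qed (use False in \<open>simp add: e_def\<close>)
  have h': "norm h' \<le> 1 / c" using h False c by (simp add: h'_def field_simps)
  have near: "e + t *\<^sub>R h' \<in> C'" if t: "0 \<le> t" "t < 1" for t
  proof (rule ccontr)
    assume "e + t *\<^sub>R h' \<notin> C'"
    then have "separation_index (A ` C) (- C') \<le> ereal (norm (e - (e + t *\<^sub>R h')))"
      unfolding separation_index_def by (intro INF_lower2[OF e] INF_lower) auto
    then have "1 / c \<le> t * norm h'" using order_trans[OF sep] t by fastforce
    also have "\<dots> \<le> t * (1 / c)" using h' t by (intro mult_left_mono) auto
    also have "\<dots> < 1 * (1 / c)" using t c by (intro mult_strict_right_mono) simp_all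
    finally show False by simp
  qed
  have lim: "(\<lambda>n. e + (1 - inverse (real (Suc n))) *\<^sub>R h') \<longlonglongrightarrow> e + (1 - 0) *\<^sub>R h'"
    by (intro tendsto_intros LIMSEQ_inverse_real_of_nat)
  have "e + (1 - inverse (real (Suc n))) *\<^sub>R h' \<in> C'" for n
    by (rule near) (auto simp: field_simps)
  then have "e + (1 - 0) *\<^sub>R h' \<in> C'" by (rule closed_sequentially[OF C'(1) _ lim])
  then have "norm (A v) *\<^sub>R (e + h') \<in> C'" using C'(2) by simp
  then show ?thesis using False by (simp add: e_def h'_def scaleR_add_right)
qed

context cone_dynamics
begin

text \<open>If \<open>E\<close> is trivial, the index is \<open>\<infinity>\<close>, its real
  value is \<open>0\<close> and so is \<open>ln 0\<close>.\<close>

lemma ln_separation_bound: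
  assumes w: "w \<in> \<Omega>"
  shows "\<bar>ln (real_of_ereal (separation_index (E w) (F w)))\<bar> \<le> ln (c (\<tau> w))"
proof (cases "E w \<inter> sphere 0 1 = {}")
  case True
  then show ?thesis using c_ge_1[OF bwd[OF w]] by (simp add: separation_index_def top_ereal_def)
next
  case False
  have cp: "0 < c (\<tau> w)" using c_pos[OF bwd[OF w]] .
  have lo: "ereal (1 / c (\<tau> w)) \<le> separation_index (E w) (F w)"
    unfolding separation_index_def
  proof (intro INF_greatest)
    fix v u assume "v \<in> E w \<inter> sphere 0 1" "u \<in> F w"
    then show "ereal (1 / c (\<tau> w)) \<le> ereal (norm (v - u))"
      using angle_E_F[OF w, of v u] cp by (simp add: field_simps)
  qed
  obtain v where v: "v \<in> E w \<inter> sphere 0 1" using False by blast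
  have "separation_index (E w) (F w) \<le> ereal (norm (v - 0))"
    unfolding separation_index_def
    by (intro INF_lower2[OF v] INF_lower subspace_0 F_subspace w)
  then have hi: "separation_index (E w) (F w) \<le> ereal 1" using v by simp
  obtain r where r: "separation_index (E w) (F w) = ereal r"
    using lo hi by (cases "separation_index (E w) (F w)") auto
  have "1 / c (\<tau> w) \<le> r" "r \<le> 1" using lo hi r by simp_all
  moreover have "0 < r" using \<open>1 / c (\<tau> w) \<le> r\<close> cp by (smt (verit) divide_pos_pos)
  ultimately have "ln r \<le> 0" "- ln (c (\<tau> w)) \<le> ln r"
    using ln_le_cancel_iff[of "1 / c (\<tau> w)" r] cp by (simp_all add: ln_div)
  then show ?thesis unfolding r by simp
qed

lemma bounded_linear_Q: "w \<in> \<Omega> \<Longrightarrow> bounded_linear (Q w)"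
  using Q_bound linear_Q
  by (intro bounded_linear_intro[where K = "c (\<tau> w)"]) (auto simp: linear_add linear_scale mult.commute)

lemma compl_proj_eq: "w \<in> \<Omega> \<Longrightarrow> proj_along (F w) (E w) = (\<lambda>x. x - Q w x)"
  by (rule ext) (simp add: algebraic_splitting.proj_swap[OF splitting_E_F] Q_eq_proj)

text \<open>On a nontrivial space one of the two projections is nonzero, and a nonzero bounded
  idempotent has norm at least \<open>1\<close>. On the trivial space both norms are
  \<open>0\<close> and \<open>ln 0 = 0\<close>.\<close>

lemma ln_projection_norm_bound:
  assumes w: "w \<in> \<Omega>"
  shows "\<bar>ln (max (onorm (proj_along (E w) (F w))) (onorm (proj_along (F w) (E w))))\<bar> \<le> ln (1 + c (\<tau> w))"
proof -
  define a where "a = onorm (Q w)"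
  define b where "b = onorm (\<lambda>x. x - Q w x)"
  have cp: "1 \<le> c (\<tau> w)" using c_ge_1[OF bwd[OF w]] .
  have blQ: "bounded_linear (Q w)" and blR: "bounded_linear (\<lambda>x. x - Q w x)"
    using bounded_linear_Q[OF w] bounded_linear_sub[OF bounded_linear_ident] by auto
  have "a \<le> c (\<tau> w)" unfolding a_def using cp by (intro onorm_bound Q_bound w) simp
  moreover have "norm (x - Q w x) \<le> (1 + c (\<tau> w)) * norm x" for x
    using norm_triangle_ineq4[of x "Q w x"] Q_bound[OF w, of x] by (simp add: algebra_simps)
  then have "b \<le> 1 + c (\<tau> w)" unfolding b_def using cp by (intro onorm_bound) simp_all
  ultimately have up: "max a b \<le> 1 + c (\<tau> w)" by simp
  have one: "1 \<le> onorm f" if "bounded_linear f" "f y = y" "y \<noteq> 0" for f :: "'a \<Rightarrow> 'a" and y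
    using onorm[OF that(1), of y] that(2,3) by simp
  have "\<bar>ln (max a b)\<bar> \<le> ln (1 + c (\<tau> w))"
  proof (cases "\<exists>x::'a. x \<noteq> 0")
    case True
    then obtain x :: 'a where "x \<noteq> 0" by blast
    have "1 \<le> max a b"
    proof (cases "Q w x = 0")
      case True
      then have "1 \<le> b" unfolding b_def using \<open>x \<noteq> 0\<close> by (intro one[OF blR, of x]) simp_all
      then show ?thesis by simp
    next
      case False
      then have "1 \<le> a" unfolding a_def by (intro one[OF blQ, of "Q w x"] Q_idem w)
      then show ?thesis by simp
    qed
    then have "ln (max a b) \<le> ln (1 + c (\<tau> w))" "0 \<le> ln (max a b)"
      using up by (simp_all only: ln_le_cancel_iff ln_ge_zero)
    then show ?thesis by simp
  next
    case False
    then have triv: "x = 0" for x :: 'a by blast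
    have "onorm f = 0" for f :: "'a \<Rightarrow> 'a"
    proof -
      have "norm (f x) / norm x = 0" for x using triv[of x] by simp
      then show ?thesis unfolding onorm_def by (simp only: cSUP_const[OF UNIV_not_empty])
    qed
    then show ?thesis using cp by (simp add: a_def b_def)
  qed
  then show ?thesis unfolding compl_proj_eq[OF w] Q_eq_proj[OF w] a_def b_def .
qed

lemma E_image_n: "w \<in> \<Omega> \<Longrightarrow> T n w ` E w = E ((\<theta> ^^ n) w)"
proof (induction n)
  case (Suc n)
  have "T (Suc n) w ` E w = A ((\<theta> ^^ n) w) ` (T n w ` E w)" unfolding image_image T_Suc ..
  then show ?case using Suc E_image[OF fwd_n] by simp
qed simp

text \<open>The two suprema decouple: the one over \<open>F\<close> is bounded for each fixed
  vector of \<open>E\<close>, then the one over \<open>E\<close> is bounded by dividing by the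
  former.\<close>

lemma domination_onorm:
  assumes w: "w \<in> \<Omega>"
  shows "onorm_on (E ((\<theta> ^^ n) w)) (inv_into (E w) (T n w)) * onorm_on (F w) (T n w)
    \<le> 2 * c (\<tau> w) * (1 + c ((\<theta> ^^ (n - 1)) w)) / \<Lambda> n w"
proof -
  let ?B = "2 * c (\<tau> w) * (1 + c ((\<theta> ^^ (n - 1)) w)) / \<Lambda> n w"
  let ?I = "inv_into (E w) (T n w)"
  let ?b = "onorm_on (F w) (T n w)"
  have B: "0 \<le> ?B"
    using c_pos[OF bwd[OF w]] c_pos[OF fwd_n[OF w, of "n - 1"]] expansion_ge_1[OF w, of n] by simp
  have zero_F: "0 \<in> F w" by (rule subspace_0[OF F_subspace[OF w]])
  have zero_E: "0 \<in> E ((\<theta> ^^ n) w)" by (rule subspace_0[OF has_dim_subspace[OF dim_E[OF fwd_n[OF w]]]])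
  have bdd: "bdd_above ((\<lambda>x. norm (T n w x) / norm x) ` F w)"
    by (rule bdd_aboveI2[where M = "onorm (T n w)"]) (rule le_onorm[OF blinfun.bounded_linear_right])
  have b0: "0 \<le> ?b" unfolding onorm_on_def using cSUP_upper[OF zero_F bdd] by simp
  have pair: "norm (?I y) / norm y * ?b \<le> ?B" if y: "y \<in> E ((\<theta> ^^ n) w)" for y
  proof (cases "norm (?I y) / norm y = 0")
    case True
    then show ?thesis by (simp only: mult_zero_left B)
  next
    case False
    obtain v where v: "v \<in> E w" "y = T n w v" using y E_image_n[OF w, of n] by blast
    have Iy: "?I y = v" unfolding v(2) by (rule inv_into_f_f[OF inj_T[OF w] v(1)])
    have pos: "0 < norm v / norm y" using False unfolding Iy by (simp add: divide_nonneg_nonneg order_less_le)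
    have "?b \<le> ?B / (norm v / norm y)" unfolding onorm_on_def
    proof (rule cSUP_least)
      show "F w \<noteq> {}" using zero_F by blast
      fix u assume u: "u \<in> F w"
      have "norm v * norm (T n w u) \<le> ?B * (norm u * norm y)" using domination[OF w v(1) u, of n] v(2) by simp
      then have "norm (T n w u) / norm u * (norm v / norm y) \<le> ?B"
        using B pos by (cases "u = 0") (auto simp: divide_le_eq mult_ac zero_less_divide_iff)
      then show "norm (T n w u) / norm u \<le> ?B / (norm v / norm y)" using pos by (simp only: pos_le_divide_eq)
    qed
    then have "?b * (norm v / norm y) \<le> ?B" using pos by (simp only: pos_le_divide_eq)
    then show ?thesis unfolding Iy by (simp only: mult.commute)
  qed
  show ?thesis
  proof (cases "?b = 0")
    case True
    then show ?thesis by (simp only: mult_zero_right B)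
  next
    case False
    then have pos: "0 < ?b" using b0 by simp
    have "onorm_on (E ((\<theta> ^^ n) w)) ?I \<le> ?B / ?b"
      unfolding onorm_on_def[of "E ((\<theta> ^^ n) w)"]
      using zero_E pair pos by (intro cSUP_least) (auto simp only: pos_le_divide_eq)
    then show ?thesis using pos by (simp only: pos_le_divide_eq)
  qed
qed

end

section \<open>From almost every point to the dominated splitting\<close>

lemma real_SUP_bounds:
  fixes x :: "nat \<Rightarrow> real"
  assumes "\<And>n. x n \<le> B"
  shows "x n \<le> real_of_ereal (SUP n. ereal (x n))" "real_of_ereal (SUP n. ereal (x n)) \<le> B"
proof -
  have lo: "ereal (x n) \<le> (SUP n. ereal (x n))" for n by (rule SUP_upper) simp
  have hi: "(SUP n. ereal (x n)) \<le> ereal B" using assms by (intro SUP_least) simp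
  obtain r where "(SUP n. ereal (x n)) = ereal r"
    using lo[of 0] hi by (cases "SUP n. ereal (x n)") auto
  then show "x n \<le> real_of_ereal (SUP n. ereal (x n))" "real_of_ereal (SUP n. ereal (x n)) \<le> B"
    using lo[of n] hi by simp_all
qed

context linear_rds
begin

abbreviation \<tau> :: "'w \<Rightarrow> 'w" where "\<tau> \<equiv> inv_into (space M) \<theta>"

lemma fwd_space: "w \<in> space M \<Longrightarrow> \<theta> w \<in> space M"
  using measurable by (rule measurable_space)
lemma bwd_space: "w \<in> space M \<Longrightarrow> \<tau> w \<in> space M"
  using measurable_inv by (rule measurable_space)
lemma fwd_bwd: "w \<in> space M \<Longrightarrow> \<theta> (\<tau> w) = w"
  by (rule bij_betw_inv_into_right[OF bij])
lemma bwd_fwd: "w \<in> space M \<Longrightarrow> \<tau> (\<theta> w) = w"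
  by (rule bij_betw_inv_into_left[OF bij])

lemma preserving_fwd: "measure_preserving_map M \<theta>" by unfold_locales (fact measurable, fact preserving)
lemma preserving_bwd: "measure_preserving_map M \<tau>" by unfold_locales (fact measurable_inv, fact preserving_inv)

abbreviation orbit :: "int \<Rightarrow> 'w \<Rightarrow> 'w" where "orbit \<equiv> int_iterate M \<theta>"

lemma orbit_0: "orbit 0 w = w" by (simp add: int_iterate_def)

lemma orbit_nat: "orbit (int n) w = (\<theta> ^^ n) w" by (simp add: int_iterate_def)

lemma orbit_neg: "orbit (- int n) w = (\<tau> ^^ n) w" by (cases "n = 0") (simp_all add: int_iterate_def)

lemma bwd_iter_space: "w \<in> space M \<Longrightarrow> (\<tau> ^^ n) w \<in> space M" by (induction n) (auto intro: bwd_space)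

lemma orbit_step: assumes "w \<in> space M" shows "\<theta> (orbit i w) = orbit (i + 1) w"
proof (cases i rule: int_cases)
  case (nonneg n)
  have "i + 1 = int (Suc n)" using nonneg by simp
  then show ?thesis unfolding nonneg orbit_nat by (metis funpow.simps(2) comp_apply orbit_nat)
next
  case (neg n)
  have i: "i + 1 = - int n" using neg by simp
  show ?thesis unfolding i unfolding neg orbit_neg using fwd_bwd[OF bwd_iter_space[OF assms]] by simp
qed

lemma orbit_in: assumes "w \<in> Y" "\<theta> ` Y \<subseteq> Y" "\<tau> ` Y \<subseteq> Y" shows "orbit i w \<in> Y"
proof -
  have "(\<theta> ^^ n) w \<in> Y" "(\<tau> ^^ n) w \<in> Y" for n using assms by (induction n) auto
  then show ?thesis by (simp add: int_iterate_def)
qed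

lemma orbit_space: "w \<in> space M \<Longrightarrow> orbit i w \<in> space M"
  by (rule orbit_in) (auto intro: fwd_space bwd_space)

lemma orbit_fwd: "w \<in> space M \<Longrightarrow> (\<theta> ^^ n) (orbit i w) = orbit (i + int n) w"
proof (induction n)
  case (Suc n)
  have eq: "i + int (Suc n) = i + int n + 1" by simp
  show ?case unfolding eq using Suc orbit_step[of w "i + int n"] by simp
qed simp

lemma orbit_bwd: assumes "w \<in> space M" shows "\<tau> (orbit i w) = orbit (i - 1) w"
  using bwd_fwd[OF orbit_space[OF assms, of "i - 1"]] unfolding orbit_step[OF assms] by simp

lemma invariant_along_orbit:
  assumes inv: "\<And>w. w \<in> space M \<Longrightarrow> L (\<theta> w) = L w" and w: "w \<in> space M"
  shows "L (orbit i w) = L w"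
proof -
  have step: "L (orbit (j + 1) w) = L (orbit j w)" for j
    using inv[OF orbit_space[OF w, of j]] orbit_step[OF w, of j] by simp
  show ?thesis
  proof (induction i rule: int_induct[where k = 0])
    case base
    then show ?case by (simp add: orbit_0)
  next
    case (step1 i)
    then show ?case using step[of i] by simp
  next
    case (step2 i)
    then show ?case using step[of "i - 1"] by simp
  qed
qed

text \<open>The points whose whole two-sided orbit avoids the exceptional null set.\<close>

lemma AE_invariant_set:
  assumes "AE w in M. P w"
  obtains \<Omega>' where "\<Omega>' \<in> sets M" "\<theta> ` \<Omega>' = \<Omega>'" "\<tau> ` \<Omega>' \<subseteq> \<Omega>'" "measure M \<Omega>' = 1" "\<And>w. w \<in> \<Omega>' \<Longrightarrow> P w"
proof -
  interpret fwd: measure_preserving_map M \<theta> by (rule preserving_fwd)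
  interpret bwd: measure_preserving_map M \<tau> by (rule preserving_bwd)
  obtain N where N: "N \<in> null_sets M" "{w\<in>space M. \<not> P w} \<subseteq> N" using assms by (auto elim: AE_E2 simp: eventually_ae_filter)
  define \<Omega>' where "\<Omega>' = {w\<in>space M. \<forall>n. (\<theta> ^^ n) w \<notin> N \<and> (\<tau> ^^ n) w \<notin> N}"
  have Nm: "N \<in> sets M" using N by auto
  have ae: "AE w in M. w \<notin> N" using AE_not_in[OF N(1)] .
  have "AE w in M. (\<theta> ^^ n) w \<notin> N" for n using fwd.AE_iter[OF ae] .
  moreover have "AE w in M. (\<tau> ^^ n) w \<notin> N" for n using bwd.AE_iter[OF ae] .
  ultimately have ae_all: "AE w in M. \<forall>n. (\<theta> ^^ n) w \<notin> N \<and> (\<tau> ^^ n) w \<notin> N"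
    unfolding AE_all_countable by (simp add: AE_conj_iff)
  have meas: "\<Omega>' \<in> sets M"
  proof -
    have "{w\<in>space M. (\<theta> ^^ n) w \<notin> N \<and> (\<tau> ^^ n) w \<notin> N} =
        ((\<theta> ^^ n) -` (space M - N) \<inter> space M) \<inter> ((\<tau> ^^ n) -` (space M - N) \<inter> space M)" for n
      using measurable_space[OF fwd.iter_meas] measurable_space[OF bwd.iter_meas] by auto
    then have "{w\<in>space M. (\<theta> ^^ n) w \<notin> N \<and> (\<tau> ^^ n) w \<notin> N} \<in> sets M" for n
      using measurable_sets[OF fwd.iter_meas, of "space M - N"] measurable_sets[OF bwd.iter_meas, of "space M - N"] Nm by auto
    then have "{w\<in>space M. \<forall>n\<in>UNIV. (\<theta> ^^ n) w \<notin> N \<and> (\<tau> ^^ n) w \<notin> N} \<in> sets M"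
      by (intro sets.sets_Collect_countable_All') auto
    then show ?thesis by (simp add: \<Omega>'_def)
  qed
  have fwd_in: "\<theta> w \<in> \<Omega>'" if "w \<in> \<Omega>'" for w
  proof -
    have w: "w \<in> space M" and all: "\<And>n. (\<theta> ^^ n) w \<notin> N" "\<And>n. (\<tau> ^^ n) w \<notin> N"
      using that by (auto simp: \<Omega>'_def)
    have "(\<theta> ^^ n) (\<theta> w) \<notin> N" for n using all(1)[of "Suc n"] by (simp add: funpow_swap1)
    moreover have "(\<tau> ^^ n) (\<theta> w) \<notin> N" for n
    proof (cases n)
      case 0
      then show ?thesis using all(1)[of 1] by simp
    next
      case (Suc m)
      then show ?thesis using all(2)[of m] bwd_fwd[OF w] by (simp add: funpow_swap1)
    qed
    ultimately show ?thesis using fwd_space[OF w] by (simp add: \<Omega>'_def)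
  qed
  have bwd_in: "\<tau> w \<in> \<Omega>'" if "w \<in> \<Omega>'" for w
  proof -
    have w: "w \<in> space M" and all: "\<And>n. (\<theta> ^^ n) w \<notin> N" "\<And>n. (\<tau> ^^ n) w \<notin> N"
      using that by (auto simp: \<Omega>'_def)
    have "(\<tau> ^^ n) (\<tau> w) \<notin> N" for n using all(2)[of "Suc n"] by (simp add: funpow_swap1)
    moreover have "(\<theta> ^^ n) (\<tau> w) \<notin> N" for n
    proof (cases n)
      case 0
      then show ?thesis using all(2)[of 1] by simp
    next
      case (Suc m)
      then show ?thesis using all(1)[of m] fwd_bwd[OF w] by (simp add: funpow_swap1)
    qed
    ultimately show ?thesis using bwd_space[OF w] by (simp add: \<Omega>'_def)
  qed
  show ?thesis
  proof
    show "\<Omega>' \<in> sets M" by (rule meas)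
    show "\<tau> ` \<Omega>' \<subseteq> \<Omega>'" using bwd_in by blast
    have "w \<in> \<theta> ` \<Omega>'" if "w \<in> \<Omega>'" for w
      using fwd_bwd[of w] bwd_in[OF that] that by (metis (no_types, lifting) \<Omega>'_def image_eqI mem_Collect_eq)
    then show "\<theta> ` \<Omega>' = \<Omega>'" using fwd_in by blast
    show "measure M \<Omega>' = 1"
      using ae_all by (subst prob_eq_1[OF meas]) (auto simp: \<Omega>'_def elim: AE_mp)
    show "P w" if "w \<in> \<Omega>'" for w
    proof -
      have "(\<theta> ^^ 0) w \<notin> N" "w \<in> space M" using that unfolding \<Omega>'_def by blast+
      then show ?thesis using N(2) by auto
    qed
  qed
qed

text \<open>The forward and backward limits are invariant and have the same integral, that of
  \<open>f\<close>, over every invariant set; applied to the sets where one exceeds the other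
  this gives equality. The limit is positive because \<open>f\<close> is: on the set where it is
  not, \<open>f\<close> would have a nonpositive integral.\<close>

lemma two_sided_mean:
  fixes f :: "'w \<Rightarrow> real"
  assumes f[measurable]: "f \<in> borel_measurable M" and pos: "\<And>w. 0 < f w" and b: "\<And>w. f w \<le> b"
  obtains L where "L \<in> borel_measurable M" "\<And>w. w \<in> space M \<Longrightarrow> L (\<theta> w) = L w" "AE w in M. 0 < L w"
    "AE w in M. (\<lambda>n. birkhoff_sum \<theta> f n w / real n) \<longlonglongrightarrow> L w"
    "AE w in M. (\<lambda>n. birkhoff_sum \<tau> f n w / real n) \<longlonglongrightarrow> L w"
proof -
  interpret fwd: measure_preserving_map M \<theta> by (rule preserving_fwd)
  interpret bwd: measure_preserving_map M \<tau> by (rule preserving_bwd)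
  have b': "\<bar>f w\<bar> \<le> b" for w using pos[of w] b[of w] by simp
  obtain L where L: "L \<in> borel_measurable M" "\<And>w. w \<in> space M \<Longrightarrow> L (\<theta> w) = L w" "\<And>w. \<bar>L w\<bar> \<le> b"
    "AE w in M. (\<lambda>n. birkhoff_sum \<theta> f n w / real n) \<longlonglongrightarrow> L w"
    "\<And>B. fwd.invariant_set B \<Longrightarrow> (\<integral>w. L w * indicator B w \<partial>M) = (\<integral>w. f w * indicator B w \<partial>M)"
    using fwd.birkhoff_bounded[OF f b'] by blast
  obtain R where R: "R \<in> borel_measurable M" "\<And>w. w \<in> space M \<Longrightarrow> R (\<tau> w) = R w" "\<And>w. \<bar>R w\<bar> \<le> b"
    "AE w in M. (\<lambda>n. birkhoff_sum \<tau> f n w / real n) \<longlonglongrightarrow> R w"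
    "\<And>B. bwd.invariant_set B \<Longrightarrow> (\<integral>w. R w * indicator B w \<partial>M) = (\<integral>w. f w * indicator B w \<partial>M)"
    using bwd.birkhoff_bounded[OF f b'] by blast
  note [measurable] = L(1) R(1)
  have L\<tau>: "L (\<tau> w) = L w" if "w \<in> space M" for w using L(2)[OF bwd_space[OF that]] fwd_bwd[OF that] by simp
  have R\<theta>: "R (\<theta> w) = R w" if "w \<in> space M" for w using R(2)[OF fwd_space[OF that]] bwd_fwd[OF that] by simp
  have int: "integrable M (\<lambda>w. h w * indicator B w)"
    if h: "h \<in> borel_measurable M" "\<And>w. \<bar>h w\<bar> \<le> b" and B: "B \<in> sets M" for h :: "'w \<Rightarrow> real" and B
    using integrable_real_mult_indicator[OF B integrable_const_bound[of h b]] h by auto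
  have AE_of_zero: "AE w in M. w \<notin> B"
    if B: "B \<in> sets M" and h: "h \<in> borel_measurable M" "integrable M (\<lambda>w. h w * indicator B w)"
      "\<And>w. w \<in> B \<Longrightarrow> 0 < h w" "(\<integral>w. h w * indicator B w \<partial>M) \<le> 0" for B and h :: "'w \<Rightarrow> real"
  proof -
    have nn: "AE w in M. 0 \<le> h w * indicator B w" using h(3) by (auto simp: indicator_def less_imp_le)
    then have "(\<integral>w. h w * indicator B w \<partial>M) = 0" using integral_nonneg_AE[OF nn] h(4) by linarith
    then have "AE w in M. h w * indicator B w = 0" using integral_nonneg_eq_0_iff_AE[OF h(2) nn] by simp
    then show ?thesis by eventually_elim (use h(3) in \<open>fastforce simp: indicator_def split: if_splits\<close>)
  qed
  have invB: "fwd.invariant_set {w\<in>space M. P w}" "bwd.invariant_set {w\<in>space M. P w}"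
    if "{w\<in>space M. P w} \<in> sets M" "\<And>w. w \<in> space M \<Longrightarrow> P (\<theta> w) = P w"
      "\<And>w. w \<in> space M \<Longrightarrow> P (\<tau> w) = P w" for P
    unfolding fwd.invariant_set_def bwd.invariant_set_def using that fwd_space bwd_space by auto
  have not_less: "AE w in M. w \<notin> {w\<in>space M. u w < v w}"
    if u: "u \<in> borel_measurable M" "\<And>w. \<bar>u w\<bar> \<le> b" "\<And>w. w \<in> space M \<Longrightarrow> u (\<theta> w) = u w"
        "\<And>w. w \<in> space M \<Longrightarrow> u (\<tau> w) = u w"
      and v: "v \<in> borel_measurable M" "\<And>w. \<bar>v w\<bar> \<le> b" "\<And>w. w \<in> space M \<Longrightarrow> v (\<theta> w) = v w"
        "\<And>w. w \<in> space M \<Longrightarrow> v (\<tau> w) = v w"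
      and same: "\<And>B. fwd.invariant_set B \<Longrightarrow> bwd.invariant_set B \<Longrightarrow>
        (\<integral>w. v w * indicator B w \<partial>M) = (\<integral>w. u w * indicator B w \<partial>M)" for u v
  proof (rule AE_of_zero[of _ "\<lambda>w. v w - u w"])
    note [measurable] = u(1) v(1)
    let ?B = "{w\<in>space M. u w < v w}"
    show Bm: "?B \<in> sets M" by measurable
    have inv: "fwd.invariant_set ?B" "bwd.invariant_set ?B"
      by (intro invB Bm; simp add: u(3,4) v(3,4))+
    have split: "(\<lambda>w. (v w - u w) * indicator ?B w) = (\<lambda>w. v w * indicator ?B w - u w * indicator ?B w)"
      by (simp add: left_diff_distrib)
    show "(\<lambda>w. v w - u w) \<in> borel_measurable M" by measurable
    show "integrable M (\<lambda>w. (v w - u w) * indicator ?B w)"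
      unfolding split by (intro Bochner_Integration.integrable_diff int u v Bm)
    have "(\<integral>w. (v w - u w) * indicator ?B w \<partial>M) = 0"
      unfolding split using same[OF inv] int[OF u(1,2) Bm] int[OF v(1,2) Bm] by simp
    then show "(\<integral>w. (v w - u w) * indicator ?B w \<partial>M) \<le> 0" by simp
  qed auto
  have RL: "AE w in M. w \<notin> {w\<in>space M. R w < L w}"
    by (rule not_less) (simp_all add: L R L\<tau> R\<theta>)
  have LR: "AE w in M. w \<notin> {w\<in>space M. L w < R w}"
    by (rule not_less) (simp_all add: L R L\<tau> R\<theta>)
  have L_pos: "AE w in M. w \<notin> {w\<in>space M. L w \<le> 0}"
  proof (rule AE_of_zero[of _ f])
    let ?B = "{w\<in>space M. L w \<le> 0}"
    show Bm: "?B \<in> sets M" by measurable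
    have inv: "fwd.invariant_set ?B" by (intro invB Bm; simp add: L(2) L\<tau>)
    show "integrable M (\<lambda>w. f w * indicator ?B w)" by (rule int[OF f b' Bm])
    have "(\<integral>w. L w * indicator ?B w \<partial>M) \<le> (\<integral>w. 0 \<partial>M)"
      using int[OF L(1,3) Bm] by (intro integral_mono) (auto simp: indicator_def)
    then show "(\<integral>w. f w * indicator ?B w \<partial>M) \<le> 0" using L(5)[OF inv] by simp
  qed (use pos in auto)
  show ?thesis
  proof (rule that[OF L(1,2) _ L(4)])
    show "AE w in M. 0 < L w" using L_pos AE_space by eventually_elim auto
    show "AE w in M. (\<lambda>n. birkhoff_sum \<tau> f n w / real n) \<longlonglongrightarrow> L w"
      using R(4) RL LR AE_space
    proof eventually_elim
      case (elim w)
      then have "R w = L w" by (simp add: linorder_not_less antisym)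
      then show ?case using elim(1) by simp
    qed
  qed
qed

end

theorem theorem1:
  fixes M :: "'w measure"
    and \<theta> :: "'w \<Rightarrow> 'w"
    and A :: "'w \<Rightarrow> 'a::{banach, second_countable_topology} \<Rightarrow>\<^sub>L 'a"
    and k :: "'w \<Rightarrow> nat"
    and C :: "'w \<Rightarrow> 'a set"
  assumes "linear_rds M \<theta> A"
    and "measurably_contracting M \<theta> A k C"
  shows "\<exists>\<Omega>' E F. measurably_dominated_splitting M \<theta> A \<Omega>' k E F \<and>
           (\<forall>\<omega>\<in>\<Omega>'. F \<omega> \<inter> C \<omega> = {0})"
proof -
  interpret linear_rds M \<theta> A by fact
  have k_meas: "k \<in> measurable M (count_space UNIV)" and k_inv: "invariant_function M \<theta> k"
    using assms(2) by (auto simp: measurably_contracting_def)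
  have ae_cone: "AE \<omega> in M. k_cone (k \<omega>) (C \<omega>) \<and> blinfun_apply (A \<omega>) ` C \<omega> \<subseteq> C (\<theta> \<omega>)"
    using assms(2) unfolding measurably_contracting_def by (auto elim: AE_mp)
  obtain E0 F0 where ae_split: "AE \<omega> in M. splitting (E0 \<omega>) (F0 \<omega>) \<and>
       has_dim (E0 \<omega>) (k \<omega>) \<and> has_codim (F0 \<omega>) (k \<omega>) \<and>
       E0 \<omega> \<subseteq> interior (C \<omega>) \<union> {0} \<and> F0 \<omega> \<inter> C \<omega> = {0}"
    and proj0: "strongly_measurable M (\<lambda>\<omega>. proj_along (E0 \<omega>) (F0 \<omega>))"
    using assms(2) unfolding measurably_contracting_def by (elim conjE exE) blast
  obtain c where c_meas[measurable]: "c \<in> borel_measurable M" and c_ge: "\<And>\<omega>. \<omega> \<in> space M \<Longrightarrow> 1 \<le> c \<omega>"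
    and ae_c: "AE \<omega> in M. tempered_at M \<theta> c \<omega> \<and>
         ereal (1 / c \<omega>) \<le> separation_index (blinfun_apply (A \<omega>) ` C \<omega>) (- C (\<theta> \<omega>))"
    using assms(2) unfolding measurably_contracting_def by (elim conjE exE bexE) blast
  \<comment> \<open>Replacing \<open>c\<close> by \<open>max 1 c\<close> changes nothing on
    the space and makes \<open>f\<close> bounded everywhere.\<close>
  define f where "f \<omega> = ln (1 + 1 / (max 1 (c \<omega>) * (1 + max 1 (c \<omega>))))" for \<omega>
  have f_meas: "f \<in> borel_measurable M" unfolding f_def[abs_def] by measurable
  have f_bounds: "0 < f \<omega> \<and> f \<omega> \<le> ln 2" for \<omega>
  proof -
    have "1 * 1 \<le> max 1 (c \<omega>) * (1 + max 1 (c \<omega>))" by (intro mult_mono) auto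
    then obtain q where q: "1 / (max 1 (c \<omega>) * (1 + max 1 (c \<omega>))) = q" "0 < q" "q \<le> 1"
      by (simp add: divide_le_eq_1)
    show ?thesis unfolding f_def q(1) using q(2,3) by simp
  qed
  have f_eq: "f \<omega> = ln (1 + 1 / (c \<omega> * (1 + c \<omega>)))" if "\<omega> \<in> space M" for \<omega>
    unfolding f_def using c_ge[OF that] by (simp add: max_def)
  obtain L where L_meas[measurable]: "L \<in> borel_measurable M"
    and L_inv: "\<And>\<omega>. \<omega> \<in> space M \<Longrightarrow> L (\<theta> \<omega>) = L \<omega>" and ae_L: "AE \<omega> in M. 0 < L \<omega>"
    and ae_fwd: "AE \<omega> in M. (\<lambda>n. birkhoff_sum \<theta> f n \<omega> / real n) \<longlonglongrightarrow> L \<omega>"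
    and ae_bwd: "AE \<omega> in M. (\<lambda>n. birkhoff_sum \<tau> f n \<omega> / real n) \<longlonglongrightarrow> L \<omega>"
    using two_sided_mean[OF f_meas f_bounds[THEN conjunct1] f_bounds[THEN conjunct2]] by blast
  define good where "good \<omega> \<longleftrightarrow> inj (blinfun_apply (A \<omega>)) \<and> k_cone (k \<omega>) (C \<omega>) \<and>
      blinfun_apply (A \<omega>) ` C \<omega> \<subseteq> C (\<theta> \<omega>) \<and> splitting (E0 \<omega>) (F0 \<omega>) \<and>
      has_dim (E0 \<omega>) (k \<omega>) \<and> has_codim (F0 \<omega>) (k \<omega>) \<and>
      E0 \<omega> \<subseteq> interior (C \<omega>) \<union> {0} \<and> F0 \<omega> \<inter> C \<omega> = {0} \<and> tempered_at M \<theta> c \<omega> \<and>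
      ereal (1 / c \<omega>) \<le> separation_index (blinfun_apply (A \<omega>) ` C \<omega>) (- C (\<theta> \<omega>)) \<and>
      0 < L \<omega> \<and> (\<lambda>n. birkhoff_sum \<theta> f n \<omega> / real n) \<longlonglongrightarrow> L \<omega> \<and>
      (\<lambda>n. birkhoff_sum \<tau> f n \<omega> / real n) \<longlonglongrightarrow> L \<omega>" for \<omega>
  have "AE \<omega> in M. good \<omega>"
    using injective ae_cone ae_split ae_c ae_L ae_fwd ae_bwd
  proof eventually_elim
    case (elim \<omega>)
    then show ?case unfolding good_def by (intro conjI) simp_all
  qed
  then obtain \<Omega>' where \<Omega>'m: "\<Omega>' \<in> sets M" and \<Omega>'_inv: "\<theta> ` \<Omega>' = \<Omega>'" and \<Omega>'_bwd: "\<tau> ` \<Omega>' \<subseteq> \<Omega>'"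
    and \<Omega>'_prob: "measure M \<Omega>' = 1" and good: "\<And>\<omega>. \<omega> \<in> \<Omega>' \<Longrightarrow> good \<omega>"
    by (rule AE_invariant_set) blast
  have sp: "\<omega> \<in> space M" if "\<omega> \<in> \<Omega>'" for \<omega> using sets.sets_into_space[OF \<Omega>'m] that by blast
  have fwd\<Omega>: "\<theta> \<omega> \<in> \<Omega>'" and bwd\<Omega>: "\<tau> \<omega> \<in> \<Omega>'" if "\<omega> \<in> \<Omega>'" for \<omega> using \<Omega>'_inv \<Omega>'_bwd that by auto
  have orb\<Omega>: "orbit i \<omega> \<in> \<Omega>'" if "\<omega> \<in> \<Omega>'" for i \<omega> using orbit_in[OF that] \<Omega>'_inv \<Omega>'_bwd by blast
  have c\<Omega>: "1 \<le> c \<omega>" if "\<omega> \<in> \<Omega>'" for \<omega> using c_ge[OF sp[OF that]] .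
  have A_inj: "inj (blinfun_apply (A \<omega>))" and cone: "k_cone (k \<omega>) (C \<omega>)"
    and A_cone: "blinfun_apply (A \<omega>) ` C \<omega> \<subseteq> C (\<theta> \<omega>)" and split0: "splitting (E0 \<omega>) (F0 \<omega>)"
    and dim0: "has_dim (E0 \<omega>) (k \<omega>)" and codim0: "has_codim (F0 \<omega>) (k \<omega>)"
    and E0_int: "E0 \<omega> \<subseteq> interior (C \<omega>) \<union> {0}" and F0_C: "F0 \<omega> \<inter> C \<omega> = {0}"
    and c_temp: "tempered_at M \<theta> c \<omega>"
    and sep: "ereal (1 / c \<omega>) \<le> separation_index (blinfun_apply (A \<omega>) ` C \<omega>) (- C (\<theta> \<omega>))"
    and L_pos: "0 < L \<omega>" and mean_fwd: "(\<lambda>n. birkhoff_sum \<theta> f n \<omega> / real n) \<longlonglongrightarrow> L \<omega>"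
    and mean_bwd: "(\<lambda>n. birkhoff_sum \<tau> f n \<omega> / real n) \<longlonglongrightarrow> L \<omega>" if "\<omega> \<in> \<Omega>'" for \<omega>
    using good[OF that] by (simp_all only: good_def)
  have L\<tau>: "L (\<tau> \<omega>) = L \<omega>" if "\<omega> \<in> \<Omega>'" for \<omega>
    using L_inv[OF bwd_space[OF sp[OF that]]] fwd_bwd[OF sp[OF that]] by simp
  have L_orbit: "L (orbit i \<omega>) = L \<omega>" if "\<omega> \<in> \<Omega>'" for i \<omega>
    by (rule invariant_along_orbit[of L]) (use L_inv sp[OF that] in blast)+
  have tg: "tempered_gain (\<lambda>i. c (orbit i \<omega>)) (L \<omega>)" if \<omega>: "\<omega> \<in> \<Omega>'" for \<omega>
  proof
    show "1 \<le> c (orbit i \<omega>)" for i by (rule c\<Omega>[OF orb\<Omega>[OF \<omega>]])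
    show "sublinear (\<lambda>i. ln (c (orbit i \<omega>)))" using c_temp[OF \<omega>] unfolding tempered_at_iff_sublinear .
    show "0 < L \<omega>" by (rule L_pos[OF \<omega>])
    note mean_fwd[OF \<omega>]
    moreover have "birkhoff_sum \<theta> f n \<omega> = (\<Sum>j<n. ln (1 + 1 / (c (orbit (int j) \<omega>) * (1 + c (orbit (int j) \<omega>)))))" for n
      unfolding birkhoff_sum_def orbit_nat[symmetric] by (simp only: f_eq[OF orbit_space[OF sp[OF \<omega>]]])
    ultimately show "(\<lambda>n. (\<Sum>j<n. ln (1 + 1 / (c (orbit (int j) \<omega>) * (1 + c (orbit (int j) \<omega>))))) / real n) \<longlonglongrightarrow> L \<omega>"
      by simp
    note mean_bwd[OF bwd\<Omega>[OF \<omega>]]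
    moreover have "(\<tau> ^^ j) (\<tau> \<omega>) = orbit (- int j - 1) \<omega>" for j
    proof -
      have "- int j - 1 = - int (Suc j)" by simp
      then show ?thesis by (simp only: orbit_neg funpow_Suc_right comp_apply)
    qed
    then have "birkhoff_sum \<tau> f n (\<tau> \<omega>) = (\<Sum>j<n. ln (1 + 1 / (c (orbit (- int j - 1) \<omega>) * (1 + c (orbit (- int j - 1) \<omega>)))))" for n
      unfolding birkhoff_sum_def by (simp only: f_eq[OF orbit_space[OF sp[OF \<omega>]]])
    ultimately show "(\<lambda>n. (\<Sum>j<n. ln (1 + 1 / (c (orbit (- int j - 1) \<omega>) * (1 + c (orbit (- int j - 1) \<omega>))))) / real n) \<longlonglongrightarrow> L \<omega>"
      using L\<tau>[OF \<omega>] by simp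
  qed
  have gain: "expansion \<theta> c n (orbit m \<omega>) = tempered_gain.gain (\<lambda>i. c (orbit i \<omega>)) m n" if \<omega>: "\<omega> \<in> \<Omega>'" for \<omega> m n
    unfolding expansion_def tempered_gain.gain_def[OF tg[OF \<omega>]] orbit_fwd[OF sp[OF \<omega>]] ..

  let ?M = "restrict_space M \<Omega>'"
  have spM: "space ?M = \<Omega>'" using sets.sets_into_space[OF \<Omega>'m] by (auto simp: space_restrict_space)
  interpret cd: measurable_cone_dynamics ?M \<theta> \<tau> A k C E0 F0 c
  proof (unfold_locales, unfold spM)
    show "\<theta> \<in> measurable ?M ?M" "\<tau> \<in> measurable ?M ?M"
      using fwd\<Omega> bwd\<Omega> measurable measurable_inv
      by (auto intro!: measurable_restrict_space3)
    show "strongly_measurable ?M (\<lambda>\<omega>. blinfun_apply (A \<omega>))"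
      using strongly_measurable by (auto simp: strongly_measurable_def intro: measurable_restrict_space1)
    show "strongly_measurable ?M (\<lambda>\<omega>. proj_along (E0 \<omega>) (F0 \<omega>))"
      using proj0 by (auto simp: strongly_measurable_def intro: measurable_restrict_space1)
    fix \<omega> assume \<omega>: "\<omega> \<in> \<Omega>'"
    note \<omega>1 = fwd\<Omega>[OF \<omega>]
    show "\<theta> \<omega> \<in> \<Omega>'" "\<tau> \<omega> \<in> \<Omega>'" using \<omega> by (rule fwd\<Omega>, rule bwd\<Omega>)
    show "\<theta> (\<tau> \<omega>) = \<omega>" "\<tau> (\<theta> \<omega>) = \<omega>" using sp[OF \<omega>] by (rule fwd_bwd, rule bwd_fwd)
    show "k (\<theta> \<omega>) = k \<omega>" using k_inv sp[OF \<omega>] by (simp add: invariant_function_def)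
    show "inj (blinfun_apply (A \<omega>))" "has_dim (E0 \<omega>) (k \<omega>)" "has_codim (F0 \<omega>) (k \<omega>)"
      "F0 \<omega> \<inter> C \<omega> = {0}" "splitting (E0 \<omega>) (F0 \<omega>)" using \<omega> by (rule A_inj dim0 codim0 F0_C split0)+
    show "1 \<le> c \<omega>" by (rule c\<Omega>[OF \<omega>])
    have C0: "0 \<in> C \<omega>" "0 \<in> C (\<theta> \<omega>)" using F0_C[OF \<omega>] F0_C[OF \<omega>1] by blast+
    then show "E0 \<omega> \<subseteq> C \<omega>" using E0_int[OF \<omega>] interior_subset by blast
    have cl: "closed (C \<omega>)" "closed (C (\<theta> \<omega>))" using cone[OF \<omega>] cone[OF \<omega>1] by (simp_all add: k_cone_def)
    have sc: "\<And>v r. v \<in> C \<omega> \<Longrightarrow> r *\<^sub>R v \<in> C \<omega>" "\<And>v r. v \<in> C (\<theta> \<omega>) \<Longrightarrow> r *\<^sub>R v \<in> C (\<theta> \<omega>)"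
      using cone[OF \<omega>] cone[OF \<omega>1] by (simp_all add: k_cone_def)
    show "closed (C \<omega>)" by (rule cl(1))
    show "r *\<^sub>R v \<in> C \<omega>" if "v \<in> C \<omega>" for v r using that by (rule sc(1))
    show "A \<omega> v \<in> C (\<theta> \<omega>)" if "v \<in> C \<omega>" for v using A_cone[OF \<omega>] that by blast
    show "A \<omega> v + w \<in> C (\<theta> \<omega>)" if "v \<in> C \<omega>" "norm w \<le> norm (A \<omega> v) / c \<omega>" for v w
      by (rule thick_of_separation[OF sc(1) cl(2) sc(2) C0(2) c\<Omega>[OF \<omega>] sep[OF \<omega>] that])
    show "(\<lambda>n. 1 / expansion \<theta> c n \<omega>) \<longlonglongrightarrow> 0"
      using tempered_gain.inverse_gain_tendsto_0[OF tg[OF \<omega>]] by (simp only: gain[OF \<omega>, symmetric] orbit_0)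
    show "(\<lambda>n. c ((\<tau> ^^ n) \<omega>) * (1 + c ((\<tau> ^^ n) \<omega>)) / expansion \<theta> c n ((\<tau> ^^ n) \<omega>)) \<longlonglongrightarrow> 0"
      using tempered_gain.backward_gain_tendsto_0[OF tg[OF \<omega>]] by (simp only: gain[OF \<omega>, symmetric] orbit_neg)
  qed
  note cd\<Omega> = spM[symmetric, THEN equalityD1, THEN subsetD]
  \<comment> \<open>Off \<open>\<Omega>'\<close> the trivial splitting keeps the projections
    measurable; the default values of \<open>\<delta>\<close> and \<open>K\<close> keep these
    positive on the whole space.\<close>
  define E where "E \<omega> = (if \<omega> \<in> \<Omega>' then cd.E \<omega> else {0})" for \<omega>
  define F where "F \<omega> = (if \<omega> \<in> \<Omega>' then cd.F \<omega> else UNIV)" for \<omega>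
  define \<delta> where "\<delta> \<omega> = (if 0 < L \<omega> then L \<omega> / 2 else 1)" for \<omega>
  define X where "X n \<omega> = 2 * c (\<tau> \<omega>) * (1 + c ((\<theta> ^^ (n - 1)) \<omega>)) / expansion \<theta> c n \<omega> * exp (real n * \<delta> \<omega>)" for n \<omega>
  \<comment> \<open>The least constant that the pathwise estimates give for the rate
    \<open>\<delta>\<close>, as a supremum of extended reals so that it is measurable before it is known to be finite.\<close>
  define K where "K \<omega> = (if \<omega> \<in> \<Omega>' then real_of_ereal (SUP n. ereal (X n \<omega>)) else 1)" for \<omega>

  have X_bound: "\<exists>D. \<forall>m n. X n (orbit m \<omega>) \<le> exp (\<epsilon> * \<bar>real_of_int m\<bar> + D)" if \<omega>: "\<omega> \<in> \<Omega>'" and "0 < \<epsilon>" for \<omega> \<epsilon>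
  proof -
    have "\<delta> (orbit m \<omega>) = L \<omega> / 2" for m
      using L_pos[OF \<omega>] L_orbit[OF \<omega>] by (simp add: \<delta>_def)
    then have "X n (orbit m \<omega>) = 2 * c (orbit (m - 1) \<omega>) * (1 + c (orbit (m + int (n - 1)) \<omega>))
        / tempered_gain.gain (\<lambda>i. c (orbit i \<omega>)) m n * exp (real n * (L \<omega> / 2))" for m n
      unfolding X_def by (simp only: gain[OF \<omega>] orbit_bwd[OF sp[OF \<omega>]] orbit_fwd[OF sp[OF \<omega>]])
    then show ?thesis using tempered_gain.domination_constant_bound[OF tg[OF \<omega>] \<open>0 < \<epsilon>\<close>] by simp
  qed
  have K_le: "K (orbit m \<omega>) \<le> B" if \<omega>: "\<omega> \<in> \<Omega>'" and "\<And>n. X n (orbit m \<omega>) \<le> B" for \<omega> m B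
    unfolding K_def using orb\<Omega>[OF \<omega>] real_SUP_bounds(2)[OF that(2)] by simp
  have X_le_K: "X n \<omega> \<le> K \<omega>" if \<omega>: "\<omega> \<in> \<Omega>'" for \<omega> n
  proof -
    obtain D where "\<And>m n. X n (orbit m \<omega>) \<le> exp (1 * \<bar>real_of_int m\<bar> + D)" using X_bound[OF \<omega>, of 1] by auto
    from real_SUP_bounds(1)[OF this[of _ 0]] show ?thesis using \<omega> by (simp add: K_def orbit_0)
  qed
  have K_ge_1: "1 \<le> K \<omega>" for \<omega>
  proof (cases "\<omega> \<in> \<Omega>'")
    case True
    have "1 * 1 \<le> (2 * c (\<tau> \<omega>)) * (1 + c \<omega>)" using c\<Omega>[OF True] c\<Omega>[OF bwd\<Omega>[OF True]] by (intro mult_mono) auto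
    then have "1 \<le> X 0 \<omega>" by (simp add: X_def)
    then show ?thesis using X_le_K[OF True, of 0] by simp
  qed (simp add: K_def)
  have K_tempered: "tempered_at M \<theta> K \<omega>" if \<omega>: "\<omega> \<in> \<Omega>'" for \<omega>
    unfolding tempered_at_iff_sublinear sublinear_def
  proof (intro allI impI)
    fix \<epsilon> :: real assume "0 < \<epsilon>"
    then obtain D where D: "\<And>m n. X n (orbit m \<omega>) \<le> exp (\<epsilon> * \<bar>real_of_int m\<bar> + D)" using X_bound[OF \<omega>] by blast
    have "\<bar>ln (K (orbit m \<omega>))\<bar> \<le> \<epsilon> * \<bar>real_of_int m\<bar> + D" for m
    proof -
      have "ln (K (orbit m \<omega>)) \<le> ln (exp (\<epsilon> * \<bar>real_of_int m\<bar> + D))"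
        using K_le[OF \<omega> D] K_ge_1[of "orbit m \<omega>"] by (intro ln_mono) auto
      moreover have "0 \<le> ln (K (orbit m \<omega>))" using K_ge_1 by simp
      ultimately show ?thesis by simp
    qed
    then show "\<exists>D. \<forall>i. \<bar>ln (K (orbit i \<omega>))\<bar> \<le> \<epsilon> * \<bar>real_of_int i\<bar> + D" by blast
  qed
  have \<theta>n[measurable]: "(\<theta> ^^ n) \<in> measurable M M" for n
    by (induction n) (auto intro: measurable_compose[OF _ measurable])
  have c\<theta>[measurable]: "(\<lambda>\<omega>. c ((\<theta> ^^ n) \<omega>)) \<in> borel_measurable M" for n by (rule measurable_compose[OF \<theta>n c_meas])
  have c\<tau>[measurable]: "(\<lambda>\<omega>. c (\<tau> \<omega>)) \<in> borel_measurable M" by (rule measurable_compose[OF measurable_inv c_meas])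
  have \<delta>_meas[measurable]: "\<delta> \<in> borel_measurable M" unfolding \<delta>_def[abs_def] by measurable
  have X_meas[measurable]: "X n \<in> borel_measurable M" for n
    unfolding X_def[abs_def] expansion_def by measurable
  have K_meas: "K \<in> borel_measurable M"
    unfolding K_def[abs_def] using \<Omega>'m by measurable
  have proj_E: "proj_along (E \<omega>) (F \<omega>) x = (if \<omega> \<in> \<Omega>' then cd.Q \<omega> x else 0)"
    and proj_F: "proj_along (F \<omega>) (E \<omega>) x = (if \<omega> \<in> \<Omega>' then x - cd.Q \<omega> x else x)" for \<omega> x
  proof -
    interpret triv: algebraic_splitting "{0}" "UNIV :: 'a set" by unfold_locales auto
    show "proj_along (E \<omega>) (F \<omega>) x = (if \<omega> \<in> \<Omega>' then cd.Q \<omega> x else 0)"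
      using cd.Q_eq_proj[OF cd\<Omega>] triv.proj_zero_iff by (simp add: E_def F_def)
    show "proj_along (F \<omega>) (E \<omega>) x = (if \<omega> \<in> \<Omega>' then x - cd.Q \<omega> x else x)"
      using cd.compl_proj_eq[OF cd\<Omega>] triv.proj_swap triv.proj_zero_iff by (simp add: E_def F_def)
  qed
  have Q_meas[measurable]: "(\<lambda>\<omega>. if \<omega> \<in> \<Omega>' then cd.Q \<omega> x else 0) \<in> borel_measurable M" for x
    using cd.Q_meas[of x] \<Omega>'m by (subst measurable_If_restrict_space_iff) (auto simp: sets.Int_space_eq1)
  have domination: "\<exists>\<delta>\<in>borel_measurable M. \<exists>K\<in>borel_measurable M. invariant_function M \<theta> \<delta> \<and>
      (\<forall>\<omega>\<in>space M. 0 < \<delta> \<omega> \<and> 1 \<le> K \<omega>) \<and>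
      (\<forall>\<omega>\<in>\<Omega>'. tempered_at M \<theta> K \<omega> \<and>
        (\<forall>n. onorm_on (E ((\<theta> ^^ n) \<omega>)) (inv_into (E \<omega>) (blinfun_apply (cocycle \<theta> A n \<omega>))) *
              onorm_on (F \<omega>) (blinfun_apply (cocycle \<theta> A n \<omega>)) \<le> K \<omega> * exp (- real n * \<delta> \<omega>)))"
  proof (rule bexI[of _ \<delta>], rule bexI[of _ K], intro conjI ballI allI)
    show "invariant_function M \<theta> \<delta>" using L_inv by (simp add: invariant_function_def \<delta>_def)
    show "0 < \<delta> \<omega>" for \<omega> by (simp add: \<delta>_def)
    show "1 \<le> K \<omega>" for \<omega> by (rule K_ge_1)
    fix \<omega> assume \<omega>: "\<omega> \<in> \<Omega>'"
    note \<omega>' = cd\<Omega>[OF \<omega>]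
    show "tempered_at M \<theta> K \<omega>" by (rule K_tempered[OF \<omega>])
    fix n
    have n\<Omega>: "(\<theta> ^^ n) \<omega> \<in> \<Omega>'" using orb\<Omega>[OF \<omega>, of "int n"] by (simp add: orbit_nat)
    have "onorm_on (E ((\<theta> ^^ n) \<omega>)) (inv_into (E \<omega>) (blinfun_apply (cocycle \<theta> A n \<omega>))) *
        onorm_on (F \<omega>) (blinfun_apply (cocycle \<theta> A n \<omega>))
        \<le> 2 * c (\<tau> \<omega>) * (1 + c ((\<theta> ^^ (n - 1)) \<omega>)) / expansion \<theta> c n \<omega>"
      using cd.domination_onorm[OF \<omega>', of n] \<omega> n\<Omega> by (simp only: E_def F_def if_True)
    also have "\<dots> = X n \<omega> * exp (- real n * \<delta> \<omega>)"
      unfolding X_def mult.assoc[of _ "exp _" "exp _"] exp_add[symmetric] by simp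
    also have "\<dots> \<le> K \<omega> * exp (- real n * \<delta> \<omega>)" by (intro mult_right_mono X_le_K \<omega>) simp
    finally show "onorm_on (E ((\<theta> ^^ n) \<omega>)) (inv_into (E \<omega>) (blinfun_apply (cocycle \<theta> A n \<omega>))) *
        onorm_on (F \<omega>) (blinfun_apply (cocycle \<theta> A n \<omega>)) \<le> K \<omega> * exp (- real n * \<delta> \<omega>)" .
  qed (fact K_meas \<delta>_meas)+
  have "measurably_dominated_splitting M \<theta> A \<Omega>' k E F"
    unfolding measurably_dominated_splitting_def
  proof (intro conjI ballI)
    show "strongly_measurable M (\<lambda>\<omega>. proj_along (E \<omega>) (F \<omega>))"
      unfolding strongly_measurable_def proj_E using Q_meas by blast
    have "(\<lambda>\<omega>. x - (if \<omega> \<in> \<Omega>' then cd.Q \<omega> x else 0)) \<in> borel_measurable M" for x by measurable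
    then show "strongly_measurable M (\<lambda>\<omega>. proj_along (F \<omega>) (E \<omega>))"
      unfolding strongly_measurable_def proj_F by (simp add: if_distrib[of "\<lambda>y. _ - y"] cong: if_cong)
    fix \<omega> assume \<omega>: "\<omega> \<in> \<Omega>'"
    note \<omega>' = cd\<Omega>[OF \<omega>]
    show "splitting (E \<omega>) (F \<omega>)"
      using cd.splitting_E_F[OF \<omega>'] cd.closed_E[OF \<omega>'] cd.closed_F[OF \<omega>'] \<omega>
      by (simp add: splitting_def algebraic_splitting_def E_def F_def)
    show "has_dim (E \<omega>) (k \<omega>)" using cd.dim_E[OF \<omega>'] \<omega> by (simp add: E_def)
    show "has_codim (F \<omega>) (k \<omega>)" using cd.codim_F[OF \<omega>'] \<omega> by (simp add: F_def)
    show "blinfun_apply (A \<omega>) ` E \<omega> = E (\<theta> \<omega>)" using cd.E_image[OF \<omega>'] \<omega> fwd\<Omega>[OF \<omega>] by (simp add: E_def)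
    show "blinfun_apply (A \<omega>) ` F \<omega> \<subseteq> F (\<theta> \<omega>)" using cd.F_map[OF \<omega>'] \<omega> fwd\<Omega>[OF \<omega>] by (auto simp: F_def)
    have sub_c: "sublinear (\<lambda>i. ln (c (\<tau> (orbit i \<omega>))))"
      using sublinear_shift[OF tempered_gain.sub_g[OF tg[OF \<omega>]], of "- 1"] by (simp add: orbit_bwd[OF sp[OF \<omega>]])
    note o = orb\<Omega>[OF \<omega>]
    note co = c\<Omega>[OF bwd\<Omega>[OF o]]
    show "tempered_at M \<theta> (\<lambda>\<omega>. real_of_ereal (separation_index (E \<omega>) (F \<omega>))) \<omega>"
      unfolding tempered_at_iff_sublinear
    proof (rule sublinear_mono[OF sub_c])
      show "\<bar>ln (real_of_ereal (separation_index (E (orbit i \<omega>)) (F (orbit i \<omega>))))\<bar> \<le> \<bar>ln (c (\<tau> (orbit i \<omega>)))\<bar>" for i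
        using cd.ln_separation_bound[OF cd\<Omega>[OF o[of i]]] o[of i] by (simp add: E_def F_def)
    qed
    show "tempered_at M \<theta> (\<lambda>\<omega>. max (onorm (proj_along (E \<omega>) (F \<omega>))) (onorm (proj_along (F \<omega>) (E \<omega>)))) \<omega>"
      unfolding tempered_at_iff_sublinear
    proof (rule sublinear_mono[OF sublinear_add[OF sublinear_const[of "ln 2"] sub_c]])
      fix i
      let ?\<eta> = "orbit i \<omega>"
      have "\<bar>ln (max (onorm (proj_along (E ?\<eta>) (F ?\<eta>))) (onorm (proj_along (F ?\<eta>) (E ?\<eta>))))\<bar> \<le> ln (1 + c (\<tau> ?\<eta>))"
        using cd.ln_projection_norm_bound[OF cd\<Omega>[OF o[of i]]] o[of i] by (simp add: E_def F_def)
      also have "\<dots> \<le> ln (2 * c (\<tau> ?\<eta>))" using co[of i] by (intro ln_mono) auto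
      also have "\<dots> = ln 2 + ln (c (\<tau> ?\<eta>))" using co[of i] by (intro ln_mult_pos) auto
      finally show "\<bar>ln (max (onorm (proj_along (E ?\<eta>) (F ?\<eta>))) (onorm (proj_along (F ?\<eta>) (E ?\<eta>))))\<bar> \<le> \<bar>ln 2 + ln (c (\<tau> ?\<eta>))\<bar>"
        by linarith
    qed
  qed (fact \<Omega>'m \<Omega>'_inv \<Omega>'_prob k_meas k_inv domination)+
  moreover have "F \<omega> \<inter> C \<omega> = {0}" if "\<omega> \<in> \<Omega>'" for \<omega>
    using cd.F_C[OF cd\<Omega>[OF that]] that by (simp add: F_def cd.transversal_def)
  ultimately show ?thesis by blast
qed

end
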